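(* Let $n\ge1$ and $m\ge0$ be integers, $0<s<1$, $0<\alpha<1$ and $0<r\le1$. Assume that $u\in C^2(B_r)\cap C^0(\overline{B_r})\cap\mathcal L_{2s}$ satisfies $$(-\Delta)^su(x)-\Delta u(x)=f(x),\qquad x\in B_r.$$ Then: (1) If $f\in C^m(\overline{B_r})$, then $u\in C^{m+1,\ln L}(\overline{B_{r/2}})$. (2) If $f\in C^{m,\mathrm{Dini}}(\overline{B_r})$, then $u\in C^{m+2}(\overline{B_{r/2}})$. (3) If $f\in C^{m,\alpha}(\overline{B_r})$, then $u\in C^{m+2,\alpha}(\overline{B_{r/2}})$.
   Context: $B_\rho=B_\rho(0)\subset\mathbb R^n$ is the open ball of radius $\rho$ centered at the origin. $\mathcal L_{2s}$ is the space of $u\in L^1_{loc}(\mathbb R^n)$ with $\int_{\mathbb R^n}\frac{|u(x)|}{1+|x|^{n+2s}}dx<\infty$. For $0<s<1$, $$(-\Delta)^su(x)=C_{n,s}\lim_{\epsilon\to0}\int_{\mathbb R^n\setminus B_\epsilon(x)}\frac{u(x)-u(y)}{|x-y|^{n+2s}}dy,\qquad C_{n,s}=\frac{4^ss\,\Gamma(\frac{n+2s}{2})}{\pi^{n/2}\Gamma(1-s)}.$$ Function spaces, for an integer $k\ge0$ and $\rho>0$: - $C^k(\overline{B_\rho})$: functions whose derivatives up to order $k$ are continuous in $\overline{B_\rho}$. - $C^{k,\alpha}(\overline{B_\rho})$, $\alpha\in(0,1)$: functions $g\in C^k(\overline{B_\rho})$ such that for some constant $C$, $|D^\beta g(x)-D^\beta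 g(y)|\le C|x-y|^\alpha$ for all $x\neq y$ in $B_\rho$ and all multi-indices $|\beta|=k$. - $C^{k,\ln L}(\overline{B_\rho})$: functions $g\in C^k(\overline{B_\rho})$ such that for some constant $C$, $|D^\beta g(x)-D^\beta g(y)|\le C|x-y|\,\big|\ln\min(|x-y|,1/2)\big|$ for all $x\ne y$ in $B_\rho$ and all $|\beta|=k$. - $C^{k,\mathrm{Dini}}(\overline{B_\rho})$: functions $g\in C^k(\overline{B_\rho})$ such that for every $|\beta|=k$, with $\omega_{D^\beta g}(t)=\sup\{|D^\beta g(x)-D^\beta g(y)|:x,y\in B_\rho,\ |x-y|\le t\}$, one has $\int_0^{\mathrm{diam}(B_\rho)}\frac{\omega_{D^\beta g}(t)}{t}dt<\infty$. *)

theory Defs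
  imports "HOL-Analysis.Analysis"
begin

definition partial_deriv :: "'n::finite \<Rightarrow> (real^'n \<Rightarrow> real) \<Rightarrow> real^'n \<Rightarrow> real" where
  "partial_deriv i g x = deriv (\<lambda>t. g (x + t *\<^sub>R axis i 1)) 0"

definition has_partial_at :: "'n::finite \<Rightarrow> (real^'n \<Rightarrow> real) \<Rightarrow> real^'n \<Rightarrow> bool" where
  "has_partial_at i g x \<longleftrightarrow> (\<lambda>t. g (x + t *\<^sub>R axis i 1)) field_differentiable (at 0)"

text \<open>A multi-index of order \<open>k\<close> is written as a list of \<open>k\<close> coordinate directions:
  \<open>[i1, ..., ik]\<close> stands for the iterated derivative taken in \<open>ik\<close> first and in \<open>i1\<close> last.
  All orderings of the directions are quantified over below; for functions of class
  \<open>C^k\<close> they yield the same derivative, by symmetry of mixed partial derivatives.\<close>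

primrec D_multi :: "'n::finite list \<Rightarrow> (real^'n \<Rightarrow> real) \<Rightarrow> real^'n \<Rightarrow> real" where
  "D_multi [] g = g"
| "D_multi (i # is) g = partial_deriv i (D_multi is g)"

definition C_open :: "nat \<Rightarrow> (real^'n::finite) set \<Rightarrow> (real^'n \<Rightarrow> real) set" where
  "C_open k U = {g.
     (\<forall>is i. length is < k \<longrightarrow> (\<forall>x\<in>U. has_partial_at i (D_multi is g) x)) \<and>
     (\<forall>is. length is \<le> k \<longrightarrow> continuous_on U (D_multi is g))}"

text \<open>\<open>C^k\<close> on the closed ball: the derivatives are taken in the open ball and have continuous
  extensions to the closed ball. Functions are total, so \<open>g\<close> itself must in addition be
  continuous up to the boundary with its own boundary values.\<close>

definition C_closed :: "nat \<Rightarrow> real \<Rightarrow> (real^'n::finite \<Rightarrow> real) set" where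
  "C_closed k \<rho> = {g. continuous_on (cball 0 \<rho>) g \<and> g \<in> C_open k (ball 0 \<rho>) \<and>
     (\<forall>is. length is \<le> k \<longrightarrow>
       (\<exists>h. continuous_on (cball 0 \<rho>) h \<and> (\<forall>x\<in>ball 0 \<rho>. h x = D_multi is g x)))}"

definition C_Hoelder :: "nat \<Rightarrow> real \<Rightarrow> real \<Rightarrow> (real^'n::finite \<Rightarrow> real) set" where
  "C_Hoelder k \<alpha> \<rho> = {g \<in> C_closed k \<rho>. \<exists>C. \<forall>is. length is = k \<longrightarrow>
     (\<forall>x\<in>ball 0 \<rho>. \<forall>y\<in>ball 0 \<rho>. x \<noteq> y \<longrightarrow>
       \<bar>D_multi is g x - D_multi is g y\<bar> \<le> C * norm (x - y) powr \<alpha>)}"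

definition C_lnL :: "nat \<Rightarrow> real \<Rightarrow> (real^'n::finite \<Rightarrow> real) set" where
  "C_lnL k \<rho> = {g \<in> C_closed k \<rho>. \<exists>C. \<forall>is. length is = k \<longrightarrow>
     (\<forall>x\<in>ball 0 \<rho>. \<forall>y\<in>ball 0 \<rho>. x \<noteq> y \<longrightarrow>
       \<bar>D_multi is g x - D_multi is g y\<bar>
         \<le> C * norm (x - y) * \<bar>ln (min (norm (x - y)) (1/2))\<bar>)}"

definition modulus :: "real \<Rightarrow> (real^'n::finite \<Rightarrow> real) \<Rightarrow> real \<Rightarrow> real" where
  "modulus \<rho> h t = Sup {\<bar>h x - h y\<bar> | x y. x \<in> ball 0 \<rho> \<and> y \<in> ball 0 \<rho> \<and> norm (x - y) \<le> t}"

text \<open>The suprema are finite here, since the derivatives of \<open>g \<in> C_closed k \<rho>\<close> up to order \<open>k\<close>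
  are bounded; the modulus is nonnegative and monotone in \<open>t > 0\<close>, hence measurable, so that
  integrability is exactly finiteness of the integral.\<close>

definition C_Dini :: "nat \<Rightarrow> real \<Rightarrow> (real^'n::finite \<Rightarrow> real) set" where
  "C_Dini k \<rho> = {g \<in> C_closed k \<rho>. \<forall>is. length is = k \<longrightarrow>
     set_integrable lborel {0<..<diameter (ball (0::real^'n) \<rho>)}
       (\<lambda>t. modulus \<rho> (D_multi is g) t / t)}"

definition L_2s :: "real \<Rightarrow> (real^'n::finite \<Rightarrow> real) set" where
  "L_2s s = {u. (\<forall>K. compact K \<longrightarrow> set_integrable lebesgue K u) \<and>
     integrable lebesgue (\<lambda>x. \<bar>u x\<bar> / (1 + norm x powr (real CARD('n) + 2 * s)))}"

definition C_ns :: "nat \<Rightarrow> real \<Rightarrow> real" where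
  "C_ns n s = 4 powr s * s * Gamma ((real n + 2 * s) / 2)
     / (pi powr (real n / 2) * Gamma (1 - s))"

definition frac_laplacian :: "real \<Rightarrow> (real^'n::finite \<Rightarrow> real) \<Rightarrow> real^'n \<Rightarrow> real" where
  "frac_laplacian s u x = C_ns CARD('n) s *
     Lim (at_right 0) (\<lambda>\<epsilon>. LINT y:(- ball x \<epsilon>)|lebesgue.
       (u x - u y) / norm (x - y) powr (real CARD('n) + 2 * s))"

definition laplacian :: "(real^'n::finite \<Rightarrow> real) \<Rightarrow> real^'n \<Rightarrow> real" where
  "laplacian u x = (\<Sum>i\<in>UNIV. D_multi [i, i] u x)"

end

theory Submission
  imports Defs
begin

text \<open>Everything is expressed through scaled averages \<open>av \<kappa> t g x = \<integral> \<kappa> z * g (x + t z) dz\<close> against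
  compactly supported kernels of finite smoothness; no Newtonian potential is used, so the argument
  is the same in all dimensions.

  Decay of \<open>av (\<Delta>^M \<kappa>) t v\<close> as \<open>t\<close> tends to \<open>0\<close> measures the regularity of \<open>v\<close>. On the one hand
  \<open>av (\<Delta>^(M+1) \<kappa>) t v = t^2 * av (\<Delta>^M \<kappa>) t (\<Delta> v)\<close>, so the equation turns decay for
  \<open>(-\<Delta>)^s v\<close> and \<open>f\<close> into decay for \<open>v\<close> with two more powers of \<open>t\<close>. On the other hand \<open>(-\<Delta>)^s v\<close> is
  a multiple of \<open>\<integral>_0^\<infinity> t^(-1-2s) (v - av \<psi> t v) dt\<close> (for \<open>\<psi>\<close> of integral one), from which it loses only
  \<open>2s\<close> powers. Each round gains \<open>2 - 2s\<close>, until the smoothness of \<open>f\<close> is the obstruction.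

  With the Euler operator \<open>E = n + z . \<nabla>\<close> one has \<open>d/dt (av \<phi> t v) = - (1/t) * av (E \<phi>) t v\<close>, and there
  are \<open>\<phi>\<close> of integral one such that \<open>E \<phi>\<close> is an \<open>M\<close>-fold Laplacian of a kernel. Integrating in \<open>t\<close>
  and differentiating under the integral recovers the derivatives of \<open>v\<close> and their moduli of continuity.\<close>

section \<open>Partial derivatives\<close>

text \<open>The equation controls \<open>v\<close> only inside the ball, while the fractional
  Laplacian sees \<open>v\<close> everywhere, and outside the ball \<open>v\<close> is merely
  integrable against a weight. Instead of cutting \<open>v\<close> off, many Laplacians are kept on
  the kernel: for the part of the fractional Laplacian at scales bounded below they can be moved to
  a kernel of that scale, so the exterior contributes only \<open>\<tau> ^ (2 * M)\<close> and does
  not limit the regularity once M is large. The three conclusions read one kind of rate in three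
  ways. Bounded m-th derivatives of \<open>f\<close> give the rate t^(m+2). At order m+2 this leaves
  the factor 1, and 1/t is not integrable at 0; so one power of t is kept as the factor, and order
  m+1 remains with modulus h |ln h|. A Hoelder or Dini modulus of \<open>f\<close> supplies an
  integrable factor, and order m+2 is reached. Rates are required on every smaller ball and for
  every sufficiently smooth kernel. Hence neither the loss of radius nor the growing smoothness
  demanded of kernels has to be tracked through the rounds.\<close>

abbreviation has_pd :: "'n::finite \<Rightarrow> (real^'n \<Rightarrow> real) \<Rightarrow> real^'n \<Rightarrow> real \<Rightarrow> bool" where
  "has_pd i g x d \<equiv> ((\<lambda>t. g (x + t *\<^sub>R axis i 1)) has_real_derivative d) (at 0)"

lemma has_pd_imp_partial_deriv: "has_pd i g x d \<Longrightarrow> partial_deriv i g x = d"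
  unfolding partial_deriv_def by (rule DERIV_imp_deriv)

lemma has_pd_imp_has_partial_at: "has_pd i g x d \<Longrightarrow> has_partial_at i g x"
  unfolding has_partial_at_def field_differentiable_def by blast

lemma has_partial_at_iff_has_pd: "has_partial_at i g x \<longleftrightarrow> has_pd i g x (partial_deriv i g x)"
  unfolding has_partial_at_def partial_deriv_def by (rule DERIV_deriv_iff_field_differentiable [symmetric])

lemma has_pd_line:
  assumes "has_pd i g (x + t *\<^sub>R axis i 1) d"
  shows "((\<lambda>t. g (x + t *\<^sub>R axis i 1)) has_real_derivative d) (at t)"
proof -
  have "((\<lambda>h. g (x + (t + h) *\<^sub>R axis i 1)) has_real_derivative d) (at 0)"
    using assms by (simp add: scaleR_add_left add.assoc)
  then show ?thesis by (simp add: DERIV_def)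
qed

lemma has_pd_component: "has_pd i (\<lambda>z. z $ l) x (of_bool (i = l))"
proof -
  have "(\<lambda>t. (x + t *\<^sub>R axis i 1) $ l) = (\<lambda>t. x $ l + t * of_bool (i = l))"
    by (auto simp: axis_def)
  then show ?thesis by (auto intro!: derivative_eq_intros)
qed

lemma has_pd_cong_open:
  assumes "has_pd i g x d" "open U" "x \<in> U" "\<And>y. y \<in> U \<Longrightarrow> g y = h y"
  shows "has_pd i h x d"
proof -
  have c: "continuous (at 0) (\<lambda>t. x + t *\<^sub>R axis i (1::real))"
    by (intro continuous_intros)
  have "eventually (\<lambda>t. x + t *\<^sub>R axis i 1 \<in> U) (at (0::real))"
    using c assms(2,3) unfolding continuous_at_open
    by (metis (no_types, lifting) add.right_neutral eventually_at_topological scale_zero_left)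
  then have "eventually (\<lambda>t. g (x + t *\<^sub>R axis i 1) = h (x + t *\<^sub>R axis i 1)) (nhds 0)"
    using assms by (auto simp: eventually_at_filter elim!: eventually_mono)
  then show ?thesis
    using assms(1) by (subst (asm) DERIV_cong_ev) auto
qed

lemma D_multi_cong_open:
  assumes "open U" "\<And>y. y \<in> U \<Longrightarrow> g y = h y" "x \<in> U"
  shows "D_multi is g x = D_multi is h x"
  using assms(3)
proof (induction "is" arbitrary: x)
  case Nil
  then show ?case using assms by simp
next
  case (Cons i js)
  have c: "continuous (at 0) (\<lambda>t. x + t *\<^sub>R axis i (1::real))"
    by (intro continuous_intros)
  have "eventually (\<lambda>t. x + t *\<^sub>R axis i 1 \<in> U) (nhds (0::real))"
    using c assms(1) Cons.prems unfolding continuous_at_open eventually_nhds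
    by (metis (no_types, lifting) add.right_neutral scale_zero_left)
  then have "eventually (\<lambda>t. D_multi js g (x + t *\<^sub>R axis i 1) = D_multi js h (x + t *\<^sub>R axis i 1)) (nhds 0)"
    using Cons.IH by (auto elim!: eventually_mono)
  then show ?case
    by (simp add: partial_deriv_def deriv_cong_ev)
qed

lemma partial_deriv_line_bound:
  assumes "open U" "\<And>p. p \<in> U \<Longrightarrow> has_pd j g p (D p)"
    and near: "\<And>\<theta>. \<bar>\<theta>\<bar> \<le> \<bar>c\<bar> \<Longrightarrow> p + \<theta> *\<^sub>R axis j 1 \<in> U \<and> \<bar>D (p + \<theta> *\<^sub>R axis j 1) - a\<bar> \<le> e"
  shows "\<bar>g (p + c *\<^sub>R axis j 1) - g p - c * a\<bar> \<le> e * \<bar>c\<bar>"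
proof -
  let ?f = "\<lambda>\<theta>. g (p + \<theta> *\<^sub>R axis j 1) - \<theta> * a"
  have d: "(?f has_field_derivative (D (p + \<theta> *\<^sub>R axis j 1) - a)) (at \<theta> within {-\<bar>c\<bar>..\<bar>c\<bar>})"
    if "\<theta> \<in> {-\<bar>c\<bar>..\<bar>c\<bar>}" for \<theta>
  proof -
    have "p + \<theta> *\<^sub>R axis j 1 \<in> U" using near[of \<theta>] that by force
    then have "((\<lambda>\<theta>. g (p + \<theta> *\<^sub>R axis j 1)) has_real_derivative D (p + \<theta> *\<^sub>R axis j 1)) (at \<theta> within {-\<bar>c\<bar>..\<bar>c\<bar>})"
      using assms(2) has_pd_line has_field_derivative_at_within by blast
    then show ?thesis by (auto intro!: derivative_eq_intros)
  qed
  have e: "norm (D (p + \<theta> *\<^sub>R axis j 1) - a) \<le> e" if "\<theta> \<in> {-\<bar>c\<bar>..\<bar>c\<bar>}" for \<theta>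
    using near[of \<theta>] that by force
  have "norm (?f c - ?f 0) \<le> e * norm (c - 0)"
    by (rule field_differentiable_bound[OF convex_real_interval(5) d e]) auto
  then show ?thesis by (simp add: algebra_simps)
qed

lemma has_derivative_from_partials:
  fixes g :: "real^'n::finite \<Rightarrow> real"
  assumes U: "open U" and x: "x \<in> U"
    and pd: "\<And>i p. p \<in> U \<Longrightarrow> has_pd i g p (D i p)"
    and cont: "\<And>i. continuous_on U (D i)"
  shows "(g has_derivative (\<lambda>h. \<Sum>i\<in>UNIV. h $ i * D i x)) (at x)"
proof -
  \<comment> \<open>\<open>P S h\<close> keeps the coordinates of \<open>h\<close> in
    \<open>S\<close> and drops the others. Induction on \<open>S\<close> changes one coordinate at a
    time, so that each step is a one-dimensional mean value estimate.\<close>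
  define P :: "'n set \<Rightarrow> real^'n \<Rightarrow> real^'n" where "P S h = (\<chi> i. if i \<in> S then h $ i else 0)" for S h
  have est: "eventually (\<lambda>h. \<bar>g (x + P S h) - g x - (\<Sum>i\<in>S. h $ i * D i x)\<bar> \<le> e * real (card S) * norm h) (nhds 0)"
    if "e > 0" for S and e :: real
    using finite[of S]
  proof (induction S rule: finite_induct)
    case empty
    have "P {} h = 0" for h by (simp add: P_def vec_eq_iff)
    then show ?case by simp
  next
    case (insert j S)
    obtain d1 where d1: "d1 > 0" "ball x d1 \<subseteq> U"
      using U x openE by blast
    have "isCont (D j) x" using cont U x continuous_on_eq_continuous_at by blast
    then have "\<exists>d>0. \<forall>y. dist y x < d \<longrightarrow> dist (D j y) (D j x) < e"
      using \<open>e > 0\<close> by (simp add: continuous_at_eps_delta)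
    then obtain d2 where d2: "d2 > 0" "\<And>y. dist y x < d2 \<Longrightarrow> \<bar>D j y - D j x\<bar> < e"
      unfolding dist_real_def by metis
    have "eventually (\<lambda>h::real^'n. norm h < min d1 d2) (nhds 0)"
      using d1 d2 by (intro eventually_nhds_metric[THEN iffD2] exI[of _ "min d1 d2"]) auto
    then show ?case
      using insert.IH
    proof eventually_elim
      case (elim h)
      have near: "x + P S h + \<theta> *\<^sub>R axis j 1 \<in> U \<and> \<bar>D j (x + P S h + \<theta> *\<^sub>R axis j 1) - D j x\<bar> \<le> e"
        if "\<bar>\<theta>\<bar> \<le> \<bar>h $ j\<bar>" for \<theta>
      proof -
        have "norm (P S h + \<theta> *\<^sub>R axis j 1) \<le> norm h"
          by (rule norm_le_componentwise_cart) (use that insert.hyps in \<open>auto simp: P_def axis_def\<close>)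
        then have "dist (x + P S h + \<theta> *\<^sub>R axis j 1) x < min d1 d2"
          using elim by (simp add: dist_norm add.assoc)
        then show ?thesis using d1 d2 by (force simp: mem_ball dist_commute)
      qed
      have eq: "P (insert j S) h = P S h + (h $ j) *\<^sub>R axis j 1"
        using insert.hyps by (auto simp: P_def axis_def vec_eq_iff)
      have "\<bar>g (x + P S h + (h $ j) *\<^sub>R axis j 1) - g (x + P S h) - h $ j * D j x\<bar> \<le> e * \<bar>h $ j\<bar>"
        by (rule partial_deriv_line_bound[OF U pd near])
      moreover have "e * \<bar>h $ j\<bar> \<le> e * norm h"
        using \<open>e > 0\<close> component_le_norm_cart[of h j] by simp
      ultimately show ?case
        using elim insert.hyps by (simp add: eq add.assoc algebra_simps)
    qed
  qed
  have bl: "bounded_linear (\<lambda>h. \<Sum>i\<in>UNIV. h $ i * D i x)"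
    by (intro bounded_linear_sum bounded_linear_mult_const bounded_linear_vec_nth)
  have all: "P UNIV h = h" for h by (simp add: P_def vec_eq_iff)
  show ?thesis
    unfolding has_derivative_at_alt
  proof (intro conjI allI impI bl)
    fix e :: real assume "e > 0"
    let ?e = "e / CARD('n)"
    have "eventually (\<lambda>h. \<bar>g (x + h) - g x - (\<Sum>i\<in>UNIV. h $ i * D i x)\<bar> \<le> e * norm h) (nhds 0)"
      using est[where e = ?e and S = UNIV] \<open>e > 0\<close> by (simp add: all)
    then obtain d where "d > 0" and
      d: "\<And>h. norm h < d \<Longrightarrow> \<bar>g (x + h) - g x - (\<Sum>i\<in>UNIV. h $ i * D i x)\<bar> \<le> e * norm h"
      unfolding eventually_nhds_metric by auto
    have "\<forall>y. norm (y - x) < d \<longrightarrow> norm (g y - g x - (\<Sum>i\<in>UNIV. (y - x) $ i * D i x)) \<le> e * norm (y - x)"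
      using d[of "y - x" for y] by simp
    with \<open>d > 0\<close> show "\<exists>d>0. \<forall>y. norm (y - x) < d \<longrightarrow> norm (g y - g x - (\<Sum>i\<in>UNIV. (y - x) $ i * D i x)) \<le> e * norm (y - x)"
      by blast
  qed
qed

lemma DERIV_along_line:
  fixes g :: "real^'n::finite \<Rightarrow> real"
  assumes "open U" "x + t *\<^sub>R y \<in> U" "\<And>i p. p \<in> U \<Longrightarrow> has_pd i g p (D i p)"
    and "\<And>i. continuous_on U (D i)"
  shows "((\<lambda>t. g (x + t *\<^sub>R y)) has_real_derivative (\<Sum>i\<in>UNIV. y $ i * D i (x + t *\<^sub>R y))) (at t)"
proof -
  have 1: "((\<lambda>t. x + t *\<^sub>R y) has_derivative (\<lambda>h. h *\<^sub>R y)) (at t)"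
    by (auto intro!: derivative_eq_intros)
  have "((\<lambda>t. g (x + t *\<^sub>R y)) has_derivative (\<lambda>h. \<Sum>i\<in>UNIV. (h *\<^sub>R y) $ i * D i (x + t *\<^sub>R y))) (at t)"
    by (rule has_derivative_compose[OF 1 has_derivative_from_partials[OF assms(1,2,3,4)]])
  moreover have "(\<lambda>h. \<Sum>i\<in>UNIV. (h *\<^sub>R y) $ i * D i (x + t *\<^sub>R y)) = (*) (\<Sum>i\<in>UNIV. y $ i * D i (x + t *\<^sub>R y))"
    by (rule ext) (simp add: sum_distrib_left mult_ac)
  ultimately show ?thesis
    unfolding has_field_derivative_def by simp
qed

section \<open>Parameter-dependent integrals\<close>

text \<open>Dominated convergence along sequences, the difference quotients being bounded by
  \<open>w\<close> through the mean value theorem. Measurability of \<open>F' a\<close> is not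
  assumed: it is a limit of difference quotients. This saves measurability proofs for derivatives
  later.\<close>

lemma DERIV_under_integral:
  fixes F :: "real \<Rightarrow> 'a \<Rightarrow> real"
  assumes "0 < d"
    and int: "\<And>h. \<bar>h - a\<bar> < d \<Longrightarrow> integrable M (F h)"
    and der: "\<And>h q. \<bar>h - a\<bar> < d \<Longrightarrow> q \<in> space M \<Longrightarrow> ((\<lambda>h. F h q) has_real_derivative F' h q) (at h)"
    and bound: "\<And>h q. \<bar>h - a\<bar> < d \<Longrightarrow> q \<in> space M \<Longrightarrow> \<bar>F' h q\<bar> \<le> w q"
    and w: "integrable M w"
  shows "((\<lambda>h. \<integral>q. F h q \<partial>M) has_real_derivative (\<integral>q. F' a q \<partial>M)) (at a)"
    and "integrable M (F' a)"
proof -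
  have main: "integrable M (F' a) \<and> (\<lambda>n. ((\<integral>q. F (a + X n) q \<partial>M) - (\<integral>q. F a q \<partial>M)) / X n) \<longlonglongrightarrow> (\<integral>q. F' a q \<partial>M)"
    if X0: "\<And>n. X n \<noteq> 0" and X: "X \<longlonglongrightarrow> 0" for X
  proof -
    have "eventually (\<lambda>n. \<bar>X n\<bar> < d) sequentially"
      using order_tendstoD(2)[OF tendsto_rabs_zero[OF X] \<open>0 < d\<close>] .
    then obtain N where N: "\<And>n. n \<ge> N \<Longrightarrow> \<bar>X n\<bar> < d" by (auto simp: eventually_sequentially)
    define s where "s n q = (F (a + X (n + N)) q - F a q) / X (n + N)" for n q
    have ints: "integrable M (F (a + X (n + N)))" "integrable M (F a)" for n
      using int N \<open>0 < d\<close> by auto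
    have lim: "(\<lambda>n. s n q) \<longlonglongrightarrow> F' a q" if "q \<in> space M" for q
    proof -
      have "((\<lambda>h. (F (a + h) q - F a q) / h) \<longlongrightarrow> F' a q) (at 0)"
        using der[of a q] that \<open>0 < d\<close> by (simp add: DERIV_def)
      then have "(\<lambda>n. (F (a + X n) q - F a q) / X n) \<longlonglongrightarrow> F' a q"
        unfolding tendsto_at_iff_sequentially comp_def using X0 X by blast
      then show ?thesis unfolding s_def by (rule LIMSEQ_ignore_initial_segment)
    qed
    have bd: "norm (s n q) \<le> w q" if "q \<in> space M" for n q
    proof -
      have "norm (F (a + X (n + N)) q - F a q) \<le> w q * norm (a + X (n + N) - a)"
        by (rule field_differentiable_bound[where S="ball a d" and f'="\<lambda>h. F' h q"])
           (use that der bound N[of "n + N"] \<open>0 < d\<close> in \<open>auto intro: has_field_derivative_at_within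
             simp: dist_real_def abs_minus_commute\<close>)
      then show ?thesis using X0[of "n + N"] by (simp add: s_def abs_divide divide_le_eq)
    qed
    have meas: "s n \<in> borel_measurable M" for n
      unfolding s_def using ints by (intro borel_measurable_divide borel_measurable_diff) auto
    have F'm: "F' a \<in> borel_measurable M"
      by (rule borel_measurable_LIMSEQ_real[OF lim meas])
    have 1: "integrable M (F' a)"
      by (rule integrable_dominated_convergence[where s = s, OF F'm meas w]) (use lim bd in auto)
    have "(\<lambda>n. \<integral>q. s n q \<partial>M) \<longlonglongrightarrow> (\<integral>q. F' a q \<partial>M)"
      by (rule integral_dominated_convergence[where s = s, OF F'm meas w]) (use lim bd in auto)
    moreover have "(\<integral>q. s n q \<partial>M) = ((\<integral>q. F (a + X (n + N)) q \<partial>M) - (\<integral>q. F a q \<partial>M)) / X (n + N)" for n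
      unfolding s_def using ints by simp
    ultimately show ?thesis using 1
      by (auto intro: LIMSEQ_offset[where k=N])
  qed
  show "((\<lambda>h. \<integral>q. F h q \<partial>M) has_real_derivative (\<integral>q. F' a q \<partial>M)) (at a)"
    unfolding DERIV_def tendsto_at_iff_sequentially comp_def using main by auto
  show "integrable M (F' a)"
    using main[of "\<lambda>n. inverse (real (Suc n))"] LIMSEQ_inverse_real_of_nat by auto
qed

lemma continuous_on_integral_dominated:
  fixes F :: "'b::metric_space \<Rightarrow> 'a \<Rightarrow> real"
  assumes meas: "\<And>p. p \<in> U \<Longrightarrow> F p \<in> borel_measurable M"
    and cont: "\<And>q. q \<in> space M \<Longrightarrow> continuous_on U (\<lambda>p. F p q)"
    and bound: "\<And>p q. p \<in> U \<Longrightarrow> q \<in> space M \<Longrightarrow> \<bar>F p q\<bar> \<le> w q"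
    and w: "integrable M w"
  shows "continuous_on U (\<lambda>p. \<integral>q. F p q \<partial>M)"
  unfolding continuous_on_sequentially
proof (intro allI ballI impI)
  fix X p assume p: "p \<in> U" and X: "(\<forall>n. X n \<in> U) \<and> X \<longlonglongrightarrow> p"
  show "((\<lambda>p. \<integral>q. F p q \<partial>M) \<circ> X) \<longlonglongrightarrow> (\<integral>q. F p q \<partial>M)"
    unfolding comp_def
  proof (rule integral_dominated_convergence[OF meas[OF p] meas w])
    show "AE q in M. (\<lambda>n. F (X n) q) \<longlonglongrightarrow> F p q"
      using cont p X unfolding continuous_on_sequentially by (intro AE_I2) (auto simp: comp_def)
  qed (use X bound in auto)
qed

text \<open>Free of hypotheses, so that it can rewrite under binders: for a non-measurable
  \<open>f\<close> neither side is integrable and both integrals are 0 by convention.\<close>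

lemma lborel_integral_translate:
  fixes f :: "'a::euclidean_space \<Rightarrow> real"
  shows "(\<integral>z. f (c + z) \<partial>lborel) = (\<integral>z. f z \<partial>lborel)"
proof (cases "f \<in> borel_measurable borel")
  case True
  then show ?thesis
    by (subst (2) lborel_distr_plus[symmetric, of c], subst integral_distr) auto
next
  case False
  have 1: "(\<lambda>z. f (c + z)) \<notin> borel_measurable borel"
  proof
    assume "(\<lambda>z. f (c + z)) \<in> borel_measurable borel"
    then have "(\<lambda>z. f (c + z)) \<circ> (\<lambda>z. - c + z) \<in> borel_measurable borel"
      by (intro measurable_comp) auto
    then show False using False by (simp add: comp_def)
  qed
  show ?thesis
    using False 1 not_integrable_integral_eq[of lborel] by (metis borel_measurable_integrable measurable_lborel2)
qed

lemma lborel_integrable_translate: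
  fixes f :: "'a::euclidean_space \<Rightarrow> real"
  assumes "integrable lborel f"
  shows "integrable lborel (\<lambda>z. f (c + z))"
proof -
  have "f \<in> borel_measurable borel" using assms by auto
  then show ?thesis
    using assms by (subst (asm) lborel_distr_plus[symmetric, of c], subst (asm) integrable_distr_eq) auto
qed

section \<open>Compactly supported kernels\<close>

text \<open>Elements of \<open>bump N\<close> vanish outside the unit ball and are of class \<open>C^N\<close>. Truncated powers are
  used instead of smooth bumps because all their signed derivatives in \<open>z \<bullet> z\<close> are nonnegative, which
  keeps the integrals that are normalised later nonzero.\<close>

inductive_set bump :: "nat \<Rightarrow> (real^'n::finite \<Rightarrow> real) set" for N where
  base: "N < k \<Longrightarrow> (\<lambda>z. (max 0 (1 - z \<bullet> z)) ^ k) \<in> bump N"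
| comp: "\<kappa> \<in> bump N \<Longrightarrow> (\<lambda>z. z $ l * \<kappa> z) \<in> bump N"
| add: "\<kappa> \<in> bump N \<Longrightarrow> \<eta> \<in> bump N \<Longrightarrow> (\<lambda>z. \<kappa> z + \<eta> z) \<in> bump N"
| scale: "\<kappa> \<in> bump N \<Longrightarrow> (\<lambda>z. c * \<kappa> z) \<in> bump N"

lemma bump_antimono:
  assumes "N \<le> N'" "\<kappa> \<in> bump N'" shows "\<kappa> \<in> bump N"
  using assms(2,1) by (induction rule: bump.induct) (auto intro: bump.intros)

lemma bump_zero: "(\<lambda>z. 0) \<in> bump N"
  using bump.scale[OF bump.base[of N "Suc N"], of 0] by simp

lemma bump_sum: "(\<And>i. i \<in> S \<Longrightarrow> \<kappa> i \<in> bump N) \<Longrightarrow> (\<lambda>z. \<Sum>i\<in>S. \<kappa> i z) \<in> bump N"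
  by (induction S rule: infinite_finite_induct) (auto intro: bump.add bump_zero)

lemma bump_supp: "\<kappa> \<in> bump N \<Longrightarrow> 1 \<le> norm z \<Longrightarrow> \<kappa> z = 0"
proof (induction rule: bump.induct)
  case (base k)
  then have "1 \<le> z \<bullet> z" by (simp add: norm_eq_sqrt_inner)
  then show ?case using base by simp
qed auto

lemma bump_continuous: "\<kappa> \<in> bump N \<Longrightarrow> continuous_on S \<kappa>"
  by (induction rule: bump.induct) (auto intro!: continuous_intros)

lemma bump_measurable [measurable]: "\<kappa> \<in> bump N \<Longrightarrow> \<kappa> \<in> borel_measurable borel"
  by (rule borel_measurable_continuous_onI[OF bump_continuous])

lemma bump_bounded:
  assumes "\<kappa> \<in> bump N" obtains C where "C > 0" "\<And>z. \<bar>\<kappa> z\<bar> \<le> C * indicator (cball 0 1) z"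
proof -
  have "compact (\<kappa> ` cball 0 1)"
    by (rule compact_continuous_image[OF bump_continuous[OF assms]]) simp
  then obtain B where "B > 0" "\<And>y. y \<in> \<kappa> ` cball 0 1 \<Longrightarrow> norm y \<le> B"
    using compact_imp_bounded bounded_pos by metis
  then show ?thesis
    using bump_supp[OF assms] by (intro that[of B]) (force simp: indicator_def)+
qed

lemma integrable_bounded_compact_support:
  fixes w :: "'a::euclidean_space \<Rightarrow> real"
  assumes [measurable]: "w \<in> borel_measurable borel" and b: "\<And>z. \<bar>w z\<bar> \<le> C * indicator (cball a R) z"
  shows "integrable lborel w"
proof (rule Bochner_Integration.integrable_bound)
  show "integrable lborel (\<lambda>z. C * indicator (cball a R) z :: real)"
    by (intro integrable_mult_right integrable_real_indicator) (use emeasure_lborel_cball_finite[of a R] in auto)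
qed (use b in \<open>auto intro!: AE_I2 intro: order_trans[OF b abs_ge_self]\<close>)

lemma bump_integrable: assumes "\<kappa> \<in> bump N" shows "integrable lborel \<kappa>"
proof -
  obtain C where "\<And>z. \<bar>\<kappa> z\<bar> \<le> C * indicator (cball 0 1) z" using bump_bounded[OF assms] by metis
  then show ?thesis using assms by (intro integrable_bounded_compact_support) auto
qed

text \<open>At the kink the difference quotient is at most |h|^k, which tends to 0 because
  \<open>k\<close> is positive.\<close>

lemma DERIV_pos_part_power:
  assumes "0 < k"
  shows "((\<lambda>\<tau>::real. (max 0 (1 - \<tau>)) ^ Suc k) has_real_derivative - real (Suc k) * (max 0 (1 - \<tau>)) ^ k) (at \<tau>)"
proof -
  consider "\<tau> < 1" | "\<tau> > 1" | "\<tau> = 1" by linarith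
  then show ?thesis
  proof cases
    case 1
    have "((\<lambda>\<tau>::real. (1 - \<tau>) ^ Suc k) has_real_derivative - real (Suc k) * (1 - \<tau>) ^ k) (at \<tau>)"
      by (rule derivative_eq_intros refl)+ (simp add: algebra_simps)
    then have "((\<lambda>\<tau>::real. (max 0 (1 - \<tau>)) ^ Suc k) has_real_derivative - real (Suc k) * (1 - \<tau>) ^ k) (at \<tau>)"
      by (rule has_field_derivative_transform_within_open[where S="{..<1}"]) (use 1 in auto)
    then show ?thesis using 1 by simp
  next
    case 2
    have "((\<lambda>\<tau>::real. (max 0 (1 - \<tau>)) ^ Suc k) has_real_derivative 0) (at \<tau>)"
      by (rule has_field_derivative_transform_within_open[OF DERIV_const, where S="{1<..}"]) (use 2 in auto)
    then show ?thesis using 2 assms by (simp add: power_0_left del: power_Suc)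
  next
    case 3
    have "((\<lambda>h. (max 0 (- h)) ^ Suc k / h) \<longlongrightarrow> 0) (at (0::real))"
    proof (rule Lim_null_comparison)
      show "((\<lambda>h::real. \<bar>h\<bar> ^ k) \<longlongrightarrow> 0) (at 0)"
        using assms by (auto intro!: tendsto_eq_intros)
      have "norm ((max 0 (- h)) ^ Suc k / h) \<le> \<bar>h\<bar> ^ k" if "h \<noteq> 0" for h :: real
      proof -
        have "(max 0 (- h)) ^ Suc k \<le> \<bar>h\<bar> ^ Suc k" by (rule power_mono) auto
        then show ?thesis using that by (simp add: abs_divide divide_le_eq power_abs mult.commute)
      qed
      then show "\<forall>\<^sub>F h in at 0. norm ((max 0 (- h)) ^ Suc k / h) \<le> \<bar>h\<bar> ^ k"
        by (auto simp: eventually_at_filter)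
    qed
    then show ?thesis using 3 assms by (simp add: DERIV_def power_0_left)
  qed
qed

lemma has_pd_base:
  assumes "1 < k"
  shows "has_pd i (\<lambda>z. (max 0 (1 - z \<bullet> z)) ^ k) z (- 2 * real k * (z $ i * (max 0 (1 - z \<bullet> z)) ^ (k - 1)))"
proof -
  obtain j where k: "k = Suc j" "0 < j" using assms by (cases k) auto
  have eq: "(\<lambda>t. (z + t *\<^sub>R axis i 1) \<bullet> (z + t *\<^sub>R axis i 1)) = (\<lambda>t. z \<bullet> z + 2 * t * z $ i + t * t)"
    by (auto simp: inner_add_left inner_add_right inner_axis inner_axis' algebra_simps)
  have "((\<lambda>t. (z + t *\<^sub>R axis i 1) \<bullet> (z + t *\<^sub>R axis i 1)) has_real_derivative 2 * z $ i) (at 0)"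
    unfolding eq by (auto intro!: derivative_eq_intros)
  from DERIV_chain2[OF DERIV_pos_part_power[OF k(2), of "(z + 0 *\<^sub>R axis i 1) \<bullet> (z + 0 *\<^sub>R axis i 1)"] this]
  show ?thesis by (simp add: k(1) algebra_simps)
qed

lemma has_pd_comp:
  assumes "has_pd i f z d"
  shows "has_pd i (\<lambda>z. z $ l * f z) z (of_bool (i = l) * f z + z $ l * d)"
proof -
  have "((\<lambda>t. (z + t *\<^sub>R axis i 1) $ l * f (z + t *\<^sub>R axis i 1)) has_real_derivative
     of_bool (i = l) * f (z + 0 *\<^sub>R axis i 1) + d * (z + 0 *\<^sub>R axis i 1) $ l) (at 0)"
    by (rule DERIV_mult[OF has_pd_component assms])
  then show ?thesis by (simp add: mult.commute)
qed

lemma bump_has_pd_ex: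
  assumes "\<kappa> \<in> bump (Suc N)"
  shows "\<exists>d\<in>bump N. \<forall>z. has_pd i \<kappa> z (d z)"
  using assms
proof (induction rule: bump.induct)
  case (base k)
  have "(\<lambda>z. - 2 * real k * (z $ i * (max 0 (1 - z \<bullet> z)) ^ (k - 1))) \<in> bump N"
    by (intro bump.scale bump.comp bump.base) (use base in auto)
  then show ?case using has_pd_base[where k=k and i=i] base by (intro bexI) auto
next
  case (comp \<kappa> l)
  then obtain d where d: "d \<in> bump N" "\<And>z. has_pd i \<kappa> z (d z)" by blast
  have "(\<lambda>z. of_bool (i = l) * \<kappa> z + z $ l * d z) \<in> bump N"
    by (intro bump.add bump.scale bump.comp d bump_antimono[OF _ comp.hyps]) simp
  moreover have "has_pd i (\<lambda>z. z $ l * \<kappa> z) z (of_bool (i = l) * \<kappa> z + z $ l * d z)" for z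
    by (rule has_pd_comp[OF d(2)])
  ultimately show ?case by (intro bexI allI)
next
  case (add \<kappa> \<eta>)
  then obtain d e where d: "d \<in> bump N" "\<And>z. has_pd i \<kappa> z (d z)" and e: "e \<in> bump N" "\<And>z. has_pd i \<eta> z (e z)" by blast
  then show ?case by (intro bexI[of _ "\<lambda>z. d z + e z"]) (auto intro: DERIV_add bump.add)
next
  case (scale \<kappa> c)
  then obtain d where d: "d \<in> bump N" "\<And>z. has_pd i \<kappa> z (d z)" by blast
  then show ?case by (intro bexI[of _ "\<lambda>z. c * d z"]) (auto intro: DERIV_cmult bump.scale)
qed

lemma bump_has_pd: "\<kappa> \<in> bump (Suc N) \<Longrightarrow> has_pd i \<kappa> z (partial_deriv i \<kappa> z)"
  using bump_has_pd_ex[of \<kappa> N i] has_pd_imp_partial_deriv by metis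

lemma bump_pd: "\<kappa> \<in> bump (Suc N) \<Longrightarrow> partial_deriv i \<kappa> \<in> bump N"
proof -
  assume "\<kappa> \<in> bump (Suc N)"
  then obtain d where d: "d \<in> bump N" "\<And>z. has_pd i \<kappa> z (d z)" using bump_has_pd_ex by blast
  then have "partial_deriv i \<kappa> = d" using has_pd_imp_partial_deriv by blast
  then show ?thesis using d by simp
qed

lemma pd_base: "1 < k \<Longrightarrow> partial_deriv i (\<lambda>z. (max 0 (1 - z \<bullet> z)) ^ k)
    = (\<lambda>z. - 2 * real k * (z $ i * (max 0 (1 - z \<bullet> z)) ^ (k - 1)))"
  using has_pd_imp_partial_deriv[OF has_pd_base] by blast

lemma pd_comp: "\<kappa> \<in> bump (Suc N) \<Longrightarrow> partial_deriv i (\<lambda>z. z $ l * \<kappa> z)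
    = (\<lambda>z. of_bool (i = l) * \<kappa> z + z $ l * partial_deriv i \<kappa> z)"
  by (intro ext has_pd_imp_partial_deriv has_pd_comp bump_has_pd)

lemma pd_add: "\<kappa> \<in> bump (Suc N) \<Longrightarrow> \<eta> \<in> bump (Suc N) \<Longrightarrow> partial_deriv i (\<lambda>z. \<kappa> z + \<eta> z)
    = (\<lambda>z. partial_deriv i \<kappa> z + partial_deriv i \<eta> z)"
  by (intro ext has_pd_imp_partial_deriv DERIV_add bump_has_pd)

lemma pd_scale: "\<kappa> \<in> bump (Suc N) \<Longrightarrow> partial_deriv i (\<lambda>z. c * \<kappa> z) = (\<lambda>z. c * partial_deriv i \<kappa> z)"
  by (intro ext has_pd_imp_partial_deriv DERIV_cmult bump_has_pd)

lemma pd_sum: "(\<And>j. j \<in> S \<Longrightarrow> \<kappa> j \<in> bump (Suc N)) \<Longrightarrow> partial_deriv i (\<lambda>z. \<Sum>j\<in>S. \<kappa> j z)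
    = (\<lambda>z. \<Sum>j\<in>S. partial_deriv i (\<kappa> j) z)"
  by (intro ext has_pd_imp_partial_deriv DERIV_sum bump_has_pd)

text \<open>By induction over the generators instead of a general symmetry theorem: in each case the
  second derivative is computed for arbitrary \<open>i\<close> and \<open>j\<close>, and the
  resulting formula is symmetric.\<close>

lemma pd_commute:
  assumes "\<kappa> \<in> bump (Suc (Suc N))"
  shows "partial_deriv i (partial_deriv j \<kappa>) = partial_deriv j (partial_deriv i \<kappa>)"
  using assms
proof (induction rule: bump.induct)
  case (base k)
  have b: "(\<lambda>z. max 0 (1 - z \<bullet> z) ^ (k - 1)) \<in> bump (Suc N)"
    by (rule bump.base) (use base in auto)
  have "partial_deriv i (partial_deriv j (\<lambda>z. (max 0 (1 - z \<bullet> z)) ^ k)) =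
    (\<lambda>z. - 2 * real k * (of_bool (i = j) * (max 0 (1 - z \<bullet> z)) ^ (k - 1) + z $ j * (- 2 * real (k - 1) * (z $ i * (max 0 (1 - z \<bullet> z)) ^ (k - 1 - 1)))))" for i j
    using base b by (simp only: pd_base pd_scale[OF bump.comp[OF b]] pd_comp[OF b])
  note eq = this
  show ?case unfolding eq[of i j] eq[of j i] by (auto simp: algebra_simps)
next
  case (comp \<kappa> l)
  have b: "\<kappa> \<in> bump (Suc N)" "\<kappa> \<in> bump (Suc (Suc N))" using bump_antimono[OF _ comp.hyps] comp.hyps by auto
  have "partial_deriv i (partial_deriv j (\<lambda>z. z $ l * \<kappa> z)) =
     (\<lambda>z. of_bool (j = l) * partial_deriv i \<kappa> z + (of_bool (i = l) * partial_deriv j \<kappa> z + z $ l * partial_deriv i (partial_deriv j \<kappa>) z))" for i j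
    using bump_pd[OF b(2)]
    by (simp only: pd_comp[OF b(2)] pd_add[OF bump.scale[OF b(1)] bump.comp[OF bump_pd[OF b(2)]]] pd_scale[OF b(1)] pd_comp[OF bump_pd[OF b(2)]])
  note eq = this
  show ?case unfolding eq[of i j] eq[of j i] comp.IH by (auto simp: algebra_simps)
next
  case (add \<kappa> \<eta>)
  then show ?case
    by (simp add: pd_add[OF add.hyps] pd_add[OF bump_pd[OF add.hyps(1)] bump_pd[OF add.hyps(2)]])
next
  case (scale \<kappa> c)
  then show ?case by (simp add: pd_scale[OF scale.hyps] pd_scale[OF bump_pd[OF scale.hyps]])
qed

lemma laplacian_eq: "laplacian g = (\<lambda>x. \<Sum>i\<in>UNIV. partial_deriv i (partial_deriv i g) x)"
  by (auto simp: laplacian_def)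

lemma bump_laplacian: "\<kappa> \<in> bump (Suc (Suc N)) \<Longrightarrow> laplacian \<kappa> \<in> bump N"
  unfolding laplacian_eq by (intro bump_sum bump_pd)

lemma bump_laplacian_pow: "\<kappa> \<in> bump (N + 2 * M) \<Longrightarrow> (laplacian ^^ M) \<kappa> \<in> bump N"
  by (induction M arbitrary: N) (auto intro!: bump_laplacian)

lemma pd_laplacian: "\<kappa> \<in> bump (Suc (Suc (Suc N))) \<Longrightarrow> partial_deriv i (laplacian \<kappa>) = laplacian (partial_deriv i \<kappa>)"
  unfolding laplacian_eq
  by (subst pd_sum[where N=N], intro bump_pd, assumption)
     (simp add: pd_commute[of \<kappa> "Suc N" i] pd_commute[OF bump_pd, of \<kappa> N i])

lemma pd_laplacian_pow: "\<kappa> \<in> bump (Suc (N + 2 * M)) \<Longrightarrow> partial_deriv i ((laplacian ^^ M) \<kappa>) = (laplacian ^^ M) (partial_deriv i \<kappa>)"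
proof (induction M arbitrary: N)
  case (Suc M)
  have "(laplacian ^^ M) \<kappa> \<in> bump (Suc (Suc (Suc N)))"
    using Suc.prems by (intro bump_laplacian_pow) simp
  then show ?case using Suc.IH[of "Suc (Suc N)"] Suc.prems by (simp add: pd_laplacian)
qed simp

lemma D_multi_bump: "\<kappa> \<in> bump (N + length is) \<Longrightarrow> D_multi is \<kappa> \<in> bump N"
  by (induction "is" arbitrary: N) (auto intro!: bump_pd)

lemma D_multi_laplacian_pow: "\<kappa> \<in> bump (N + length is + 2 * M) \<Longrightarrow> D_multi is ((laplacian ^^ M) \<kappa>) = (laplacian ^^ M) (D_multi is \<kappa>)"
proof (induction "is" arbitrary: N)
  case (Cons i js)
  have "D_multi js \<kappa> \<in> bump (Suc (N + 2 * M))"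
    using Cons.prems by (intro D_multi_bump) (simp add: algebra_simps)
  then show ?case using Cons.IH[of "Suc N"] Cons.prems by (simp add: pd_laplacian_pow)
qed simp

section \<open>The Euler operator and its commutation with the Laplacian\<close>

definition euler :: "(real^'n::finite \<Rightarrow> real) \<Rightarrow> real^'n \<Rightarrow> real" where
  "euler \<kappa> z = real CARD('n) * \<kappa> z + (\<Sum>i\<in>UNIV. z $ i * partial_deriv i \<kappa> z)"

lemma bump_euler: "\<kappa> \<in> bump (Suc N) \<Longrightarrow> euler \<kappa> \<in> bump N"
proof -
  assume b: "\<kappa> \<in> bump (Suc N)"
  have "(\<lambda>z. real CARD('a) * \<kappa> z + (\<Sum>i\<in>UNIV. z $ i * partial_deriv i \<kappa> z)) \<in> bump N"
    by (intro bump.add bump.scale bump_sum bump.comp bump_pd b bump_antimono[OF _ b]) simp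
  then show ?thesis by (simp add: euler_def[abs_def])
qed

lemma euler_add_scale: "\<kappa> \<in> bump (Suc N) \<Longrightarrow> \<eta> \<in> bump (Suc N) \<Longrightarrow> euler (\<lambda>z. \<kappa> z + c * \<eta> z) = (\<lambda>z. euler \<kappa> z + c * euler \<eta> z)"
  by (simp add: fun_eq_iff euler_def pd_add[OF _ bump.scale] pd_scale algebra_simps sum.distrib sum_distrib_left)

lemma laplacian_add_scale: "\<kappa> \<in> bump (Suc (Suc N)) \<Longrightarrow> \<eta> \<in> bump (Suc (Suc N)) \<Longrightarrow> laplacian (\<lambda>z. \<kappa> z + c * \<eta> z) = (\<lambda>z. laplacian \<kappa> z + c * laplacian \<eta> z)"
  unfolding laplacian_eq
  by (simp add: pd_add[OF _ bump.scale] pd_scale pd_add[OF bump_pd bump.scale[OF bump_pd]] pd_scale[OF bump_pd] sum.distrib sum_distrib_left)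

lemma laplacian_pow_add_scale: "\<kappa> \<in> bump (N + 2 * M) \<Longrightarrow> \<eta> \<in> bump (N + 2 * M) \<Longrightarrow>
    (laplacian ^^ M) (\<lambda>z. \<kappa> z + c * \<eta> z) = (\<lambda>z. (laplacian ^^ M) \<kappa> z + c * (laplacian ^^ M) \<eta> z)"
proof (induction M arbitrary: N)
  case (Suc M)
  have "(laplacian ^^ M) \<kappa> \<in> bump (Suc (Suc N))" "(laplacian ^^ M) \<eta> \<in> bump (Suc (Suc N))"
    using Suc.prems by (auto intro: bump_laplacian_pow)
  then show ?case using Suc.IH[of "Suc (Suc N)"] Suc.prems by (simp add: laplacian_add_scale)
qed simp

lemma laplacian_comp:
  assumes "\<zeta> \<in> bump (Suc (Suc N))"
  shows "laplacian (\<lambda>z. z $ l * \<zeta> z) = (\<lambda>z. 2 * partial_deriv l \<zeta> z + z $ l * laplacian \<zeta> z)"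
proof -
  have b: "\<zeta> \<in> bump (Suc N)" using bump_antimono[OF _ assms] by simp
  have "partial_deriv i (partial_deriv i (\<lambda>z. z $ l * \<zeta> z)) =
     (\<lambda>z. of_bool (i = l) * partial_deriv i \<zeta> z + (of_bool (i = l) * partial_deriv i \<zeta> z + z $ l * partial_deriv i (partial_deriv i \<zeta>) z))" for i
    by (simp only: pd_comp[OF assms] pd_add[OF bump.scale[OF b] bump.comp[OF bump_pd[OF assms]]] pd_scale[OF b] pd_comp[OF bump_pd[OF assms]])
  note eq = this
  have d: "(\<Sum>i\<in>UNIV. of_bool (i = l) * a i) = (a l :: real)" for a
    by (subst sum.remove[of UNIV l]) auto
  show ?thesis
    unfolding laplacian_eq eq by (simp only: sum.distrib d sum_distrib_left[symmetric]) simp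
qed

text \<open>The commutator of the Laplacian with z . grad is twice the Laplacian, which is
  homogeneous of degree -2. The term 2 arises from the derivatives that hit the coordinate factors
  in \<open>laplacian_comp\<close>.\<close>

lemma laplacian_euler:
  assumes b: "\<kappa> \<in> bump (Suc (Suc (Suc N)))"
  shows "laplacian (euler \<kappa>) = (\<lambda>z. euler (laplacian \<kappa>) z + 2 * laplacian \<kappa> z)"
proof -
  have b2: "\<kappa> \<in> bump (Suc (Suc N))" using bump_antimono[OF _ b] by simp
  let ?s = "\<lambda>z. \<Sum>i\<in>UNIV. z $ i * partial_deriv i \<kappa> z"
  have bs: "?s \<in> bump (Suc (Suc N))" by (intro bump_sum bump.comp bump_pd b)
  have ls: "laplacian ?s = (\<lambda>z. \<Sum>l\<in>UNIV. laplacian (\<lambda>z. z $ l * partial_deriv l \<kappa> z) z)"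
    unfolding laplacian_eq
    by (simp add: pd_sum[OF bump.comp[OF bump_pd[OF b]]] pd_sum[OF bump_pd[OF bump.comp[OF bump_pd[OF b]]]])
       (subst sum.swap, rule refl)
  have "laplacian (euler \<kappa>) = laplacian (\<lambda>z. ?s z + real CARD('a) * \<kappa> z)"
    by (simp add: euler_def[abs_def] add.commute)
  also have "\<dots> = (\<lambda>z. laplacian ?s z + real CARD('a) * laplacian \<kappa> z)"
    by (rule laplacian_add_scale[OF bs b2])
  also have "\<dots> = (\<lambda>z. euler (laplacian \<kappa>) z + 2 * laplacian \<kappa> z)"
    unfolding ls
    by (simp add: fun_eq_iff laplacian_comp[OF bump_pd[OF b]] euler_def sum.distrib pd_laplacian[OF b] sum_distrib_left[symmetric])
       (simp add: laplacian_eq)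
  finally show ?thesis .
qed

text \<open>The gradient of the power \<open>Suc k\<close> is -2 (k+1) z times the power
  \<open>k\<close>, and the divergence of z g(z) is \<open>euler g\<close>. This is the only place
  where an Euler image is recognised as a Laplacian; all higher powers are generated from it by
  commutation.\<close>

lemma laplacian_base:
  assumes "1 < k"
  shows "laplacian (\<lambda>z::real^'n::finite. (max 0 (1 - z \<bullet> z)) ^ Suc k) = (\<lambda>z. - 2 * real (Suc k) * euler (\<lambda>z. (max 0 (1 - z \<bullet> z)) ^ k) z)"
proof -
  obtain N where k: "k = Suc (Suc N)" using assms by (metis less_imp_Suc_add plus_1_eq_Suc add_Suc)
  have b: "(\<lambda>z::real^'n. (max 0 (1 - z \<bullet> z)) ^ k) \<in> bump (Suc N)" by (rule bump.base) (simp add: k)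
  have "partial_deriv i (partial_deriv i (\<lambda>z::real^'n. (max 0 (1 - z \<bullet> z)) ^ Suc k)) =
    (\<lambda>z. - 2 * real (Suc k) * ((max 0 (1 - z \<bullet> z)) ^ k + z $ i * partial_deriv i (\<lambda>z. (max 0 (1 - z \<bullet> z)) ^ k) z))" for i
    using assms by (simp add: pd_base[of "Suc k"] pd_scale[OF bump.comp[OF b], of i _ i, simplified] pd_comp[OF b, of i i] del: power_Suc)
  then show ?thesis
    unfolding laplacian_eq euler_def by (simp add: sum_distrib_left[symmetric] sum.distrib del: power_Suc)
qed

section \<open>Scaled averages\<close>

text \<open>A convolution with the dilated kernel, written in the unscaled variable \<open>z\<close>
  so that t = 0 is meaningful: the value there is \<open>g x\<close> times the integral of the
  kernel.\<close>

definition av :: "(real^'n::finite \<Rightarrow> real) \<Rightarrow> real \<Rightarrow> (real^'n \<Rightarrow> real) \<Rightarrow> real^'n \<Rightarrow> real" where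
  "av \<kappa> t g x = (\<integral>z. \<kappa> z * g (x + t *\<^sub>R z) \<partial>lborel)"

text \<open>Borel rather than Lebesgue measurability, because \<open>g\<close> is composed with maps
  such as (z, y) -> x + \<tau> z + t y and integrated over product spaces.\<close>

definition loc_int :: "('a::euclidean_space \<Rightarrow> real) \<Rightarrow> bool" where
  "loc_int g \<longleftrightarrow> g \<in> borel_measurable borel \<and> (\<forall>R. integrable lborel (\<lambda>q. indicator (cball 0 R) q * g q))"

definition mass :: "('a::euclidean_space \<Rightarrow> real) \<Rightarrow> real \<Rightarrow> real" where
  "mass g R = (\<integral>q. indicator (cball 0 R) q * \<bar>g q\<bar> \<partial>lborel)"

lemma loc_int_measurable [measurable_dest]: "loc_int g \<Longrightarrow> g \<in> borel_measurable borel"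
  by (simp add: loc_int_def)

lemma loc_int_abs: "loc_int g \<Longrightarrow> integrable lborel (\<lambda>q. indicator (cball 0 R) q * \<bar>g q\<bar>)"
  unfolding loc_int_def using integrable_abs[of lborel "\<lambda>q. indicator (cball 0 R) q * g q"]
  by (auto simp: abs_mult)

lemma mass_nonneg: "0 \<le> mass g R"
  unfolding mass_def by (intro integral_nonneg_AE) auto

lemma continuous_cball_bounded:
  fixes f :: "'a::euclidean_space \<Rightarrow> real"
  assumes "continuous_on (cball a R) f"
  obtains B where "B > 0" "\<And>z. z \<in> cball a R \<Longrightarrow> \<bar>f z\<bar> \<le> B"
proof -
  have "bounded (f ` cball a R)"
    by (intro compact_imp_bounded compact_continuous_image assms compact_cball)
  then obtain B where "B > 0" "\<forall>y\<in>f ` cball a R. norm y \<le> B" unfolding bounded_pos by blast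
  then show ?thesis using that[of B] by simp
qed

lemma continuous_imp_loc_int:
  fixes g :: "'a::euclidean_space \<Rightarrow> real"
  assumes "continuous_on UNIV g" shows "loc_int g"
  unfolding loc_int_def
proof (intro conjI allI)
  show [measurable]: "g \<in> borel_measurable borel" using assms by (rule borel_measurable_continuous_onI)
  fix R :: real
  obtain B where B: "B > 0" "\<And>z. z \<in> cball 0 R \<Longrightarrow> \<bar>g z\<bar> \<le> B"
    using continuous_cball_bounded[OF continuous_on_subset[OF assms subset_UNIV]] by blast
  show "integrable lborel (\<lambda>q. indicator (cball 0 R) q * g q)"
    by (rule integrable_bounded_compact_support[where C=B and a=0 and R=R])
       (use B in \<open>auto simp: indicator_def\<close>)
qed

text \<open>\<open>f\<close> need not be integrable, nor even measurable: its integral is then 0 by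
  convention, and \<open>w\<close> is nonnegative.\<close>

lemma abs_integral_le:
  fixes f w :: "'a \<Rightarrow> real"
  assumes "integrable M w" "\<And>x. x \<in> space M \<Longrightarrow> \<bar>f x\<bar> \<le> w x"
  shows "\<bar>\<integral>x. f x \<partial>M\<bar> \<le> (\<integral>x. w x \<partial>M)"
proof (cases "integrable M f")
  case True
  have "\<bar>\<integral>x. f x \<partial>M\<bar> \<le> (\<integral>x. \<bar>f x\<bar> \<partial>M)" by (rule integral_abs_bound)
  also have "\<dots> \<le> (\<integral>x. w x \<partial>M)" using assms True by (intro integral_mono) auto
  finally show ?thesis .
next
  case False
  have "0 \<le> (\<integral>x. w x \<partial>M)" using assms(2) by (intro Bochner_Integration.integral_nonneg) force
  then show ?thesis using False by (simp add: not_integrable_integral_eq)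
qed

text \<open>Nothing is known about \<open>g\<close> off \<open>cball x t\<close>. Measurability of
  the product follows from the support of the kernel: it is a function continuous on the closed unit
  ball, extended by zero.\<close>

lemma integrable_bump_mult:
  assumes k: "\<kappa> \<in> bump N" and g: "continuous_on (cball x t) g" and t: "0 \<le> t"
  shows "integrable lborel (\<lambda>z. \<kappa> z * g (x + t *\<^sub>R z))"
proof -
  have sub: "x + t *\<^sub>R z \<in> cball x t" if "z \<in> cball 0 1" for z
    using that t by (simp add: dist_norm mult_left_le)
  have cg: "continuous_on (cball 0 1) (\<lambda>z. \<kappa> z * g (x + t *\<^sub>R z))"
    by (intro continuous_intros bump_continuous[OF k] continuous_on_compose2[OF g]) (use sub in auto)
  have eq: "(\<lambda>z. \<kappa> z * g (x + t *\<^sub>R z)) = (\<lambda>z. indicator (cball 0 1) z *\<^sub>R (\<kappa> z * g (x + t *\<^sub>R z)))"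
    using bump_supp[OF k] by (fastforce simp: indicator_def)
  have m: "(\<lambda>z. \<kappa> z * g (x + t *\<^sub>R z)) \<in> borel_measurable borel"
    by (subst eq, rule borel_measurable_continuous_on_indicator) (use cg in auto)
  obtain B where B: "B > 0" "\<And>z. z \<in> cball 0 1 \<Longrightarrow> \<bar>\<kappa> z * g (x + t *\<^sub>R z)\<bar> \<le> B"
    using continuous_cball_bounded[OF cg] by blast
  show ?thesis
    by (rule integrable_bounded_compact_support[OF m, where C=B and a=0 and R=1])
       (use B bump_supp[OF k] in \<open>auto simp: indicator_def\<close>)
qed

lemma av_bound:
  assumes k: "\<kappa> \<in> bump N" and t: "0 \<le> t" and g: "\<And>y. y \<in> cball x t \<Longrightarrow> \<bar>g y\<bar> \<le> K"
  shows "\<bar>av \<kappa> t g x\<bar> \<le> (\<integral>z. \<bar>\<kappa> z\<bar> \<partial>lborel) * K"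
proof -
  have "\<bar>\<kappa> z * g (x + t *\<^sub>R z)\<bar> \<le> \<bar>\<kappa> z\<bar> * K" for z
  proof (cases "norm z < 1")
    case True
    then have "x + t *\<^sub>R z \<in> cball x t" using t by (simp add: dist_norm mult_left_le)
    then show ?thesis using g by (simp add: abs_mult mult_left_mono)
  next
    case False
    then show ?thesis using bump_supp[OF k, of z] by simp
  qed
  then have "\<bar>\<integral>z. \<kappa> z * g (x + t *\<^sub>R z) \<partial>lborel\<bar> \<le> (\<integral>z. \<bar>\<kappa> z\<bar> * K \<partial>lborel)"
    by (intro abs_integral_le) (auto intro!: integrable_mult_left integrable_abs bump_integrable[OF k])
  then show ?thesis by (simp add: av_def)
qed

lemma av_cong:
  assumes "\<kappa> \<in> bump N" "0 \<le> t" "\<And>y. y \<in> cball x t \<Longrightarrow> g y = h y"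
  shows "av \<kappa> t g x = av \<kappa> t h x"
  unfolding av_def
proof (intro Bochner_Integration.integral_cong refl)
  fix z
  show "\<kappa> z * g (x + t *\<^sub>R z) = \<kappa> z * h (x + t *\<^sub>R z)"
  proof (cases "norm z < 1")
    case True
    then have "x + t *\<^sub>R z \<in> cball x t" using assms(2) by (simp add: dist_norm mult_left_le)
    then show ?thesis using assms(3) by simp
  qed (use bump_supp[OF assms(1), of z] in simp)
qed

lemma lborel_integral_affine:
  fixes f :: "'a::euclidean_space \<Rightarrow> real"
  assumes [measurable]: "f \<in> borel_measurable borel" and t: "t \<noteq> 0"
  shows "(\<integral>q. f q \<partial>lborel) = \<bar>t\<bar> ^ DIM('a) * (\<integral>z. f (x + t *\<^sub>R z) \<partial>lborel)"
    and "integrable lborel f \<longleftrightarrow> integrable lborel (\<lambda>z. f (x + t *\<^sub>R z))"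
proof -
  show "(\<integral>q. f q \<partial>lborel) = \<bar>t\<bar> ^ DIM('a) * (\<integral>z. f (x + t *\<^sub>R z) \<partial>lborel)"
    by (subst lborel_affine[OF t, of x], subst integral_density) (auto simp: integral_distr)
  show "integrable lborel f \<longleftrightarrow> integrable lborel (\<lambda>z. f (x + t *\<^sub>R z))"
    using t by (subst lborel_affine[OF t, of x], subst integrable_density) (auto simp: integrable_distr_eq)
qed

text \<open>The substitution q = x + t z moves the dependence on \<open>x\<close> and
  \<open>t\<close> from \<open>g\<close>, which is only locally integrable, into the smooth kernel.
  Differentiation in \<open>x\<close> and in \<open>t\<close> both start from this form.\<close>

lemma av_kernel:
  fixes g :: "real^'n::finite \<Rightarrow> real"
  assumes [measurable]: "\<kappa> \<in> borel_measurable borel" "g \<in> borel_measurable borel" and t: "0 < t"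
  shows "av \<kappa> t g x = inverse t ^ CARD('n) * (\<integral>q. \<kappa> (inverse t *\<^sub>R (q - x)) * g q \<partial>lborel)"
    and "integrable lborel (\<lambda>q. \<kappa> (inverse t *\<^sub>R (q - x)) * g q) \<longleftrightarrow> integrable lborel (\<lambda>z. \<kappa> z * g (x + t *\<^sub>R z))"
proof -
  let ?f = "\<lambda>q. \<kappa> (inverse t *\<^sub>R (q - x)) * g q"
  have m: "?f \<in> borel_measurable borel" by measurable
  have eq: "(\<lambda>z. ?f (x + t *\<^sub>R z)) = (\<lambda>z. \<kappa> z * g (x + t *\<^sub>R z))" using t by simp
  show "av \<kappa> t g x = inverse t ^ CARD('n) * (\<integral>q. ?f q \<partial>lborel)"
    using t lborel_integral_affine(1)[OF m, of t x] unfolding eq by (simp add: av_def power_inverse field_simps)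
  show "integrable lborel ?f \<longleftrightarrow> integrable lborel (\<lambda>z. \<kappa> z * g (x + t *\<^sub>R z))"
    using t lborel_integral_affine(2)[OF m, of t x] unfolding eq by simp
qed

text \<open>The right-hand side depends on \<open>x\<close> and \<open>t\<close> only through
  \<open>R\<close>, so it serves as a dominating function uniformly near a given point or
  scale.\<close>

lemma bump_kernel_supp:
  assumes "\<kappa> \<in> bump N" "0 < t" "\<And>z. \<bar>\<kappa> z\<bar> \<le> C * indicator (cball 0 1) z" "norm x + t \<le> R"
  shows "\<bar>\<kappa> (inverse t *\<^sub>R (q - x)) * g q\<bar> \<le> C * (indicator (cball 0 R) q * \<bar>g q\<bar>)"
proof (cases "norm (q - x) \<le> t")
  case True
  then have "norm q \<le> R" using assms(4) norm_triangle_ineq[of "q - x" x] by simp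
  moreover have "\<bar>\<kappa> (inverse t *\<^sub>R (q - x))\<bar> \<le> C"
    using assms(3)[of "inverse t *\<^sub>R (q - x)"] assms(3)[of 0] by (cases "inverse t *\<^sub>R (q - x) \<in> cball 0 1") (auto simp: indicator_def)
  ultimately show ?thesis by (simp add: abs_mult mult_right_mono)
next
  case False
  then have "1 \<le> inverse t * norm (q - x)" using assms(2) by (simp add: field_simps)
  then have "1 \<le> norm (inverse t *\<^sub>R (q - x))" using assms(2) by simp
  moreover have "0 \<le> C" using assms(3)[of 0] by simp
  ultimately show ?thesis using bump_supp[OF assms(1)] by simp
qed

lemma integrable_bump_kernel:
  assumes k: "\<kappa> \<in> bump N" and g: "loc_int g" and t: "0 < t"
  shows "integrable lborel (\<lambda>q. \<kappa> (inverse t *\<^sub>R (q - x)) * g q)"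
proof -
  have [measurable]: "\<kappa> \<in> borel_measurable borel" "g \<in> borel_measurable borel" using k g by auto
  obtain C where C: "\<And>z. \<bar>\<kappa> z\<bar> \<le> C * indicator (cball 0 1) z" using bump_bounded[OF k] by metis
  show ?thesis
    by (rule Bochner_Integration.integrable_bound[OF integrable_mult_right[OF loc_int_abs[OF g, of "norm x + t"], of C]])
       (use bump_kernel_supp[OF k t C order_refl, where x=x and g=g] in \<open>auto intro!: AE_I2 intro: order_trans[OF _ abs_ge_self]\<close>)
qed

lemma integrable_bump_mult_loc:
  assumes k: "\<kappa> \<in> bump N" and g: "loc_int g" and t: "0 < t"
  shows "integrable lborel (\<lambda>z. \<kappa> z * g (x + t *\<^sub>R z))"
proof -
  have [measurable]: "\<kappa> \<in> borel_measurable borel" "g \<in> borel_measurable borel" using k g by auto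
  show ?thesis using av_kernel(2)[of \<kappa> g t x] integrable_bump_kernel[OF assms] t by simp
qed

lemma av_mass_bound:
  fixes g :: "real^'n::finite \<Rightarrow> real"
  assumes k: "\<kappa> \<in> bump N" and g: "loc_int g" and t: "0 < t"
    and C: "\<And>z. \<bar>\<kappa> z\<bar> \<le> C * indicator (cball 0 1) z" and R: "norm x + t \<le> R"
  shows "\<bar>av \<kappa> t g x\<bar> \<le> C * inverse t ^ CARD('n) * mass g R"
proof -
  have [measurable]: "\<kappa> \<in> borel_measurable borel" "g \<in> borel_measurable borel" using k g by auto
  have "\<bar>\<integral>q. \<kappa> (inverse t *\<^sub>R (q - x)) * g q \<partial>lborel\<bar> \<le> (\<integral>q. C * (indicator (cball 0 R) q * \<bar>g q\<bar>) \<partial>lborel)"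
    by (intro abs_integral_le integrable_mult_right loc_int_abs[OF g] bump_kernel_supp[OF k t C R])
  then have "\<bar>\<integral>q. \<kappa> (inverse t *\<^sub>R (q - x)) * g q \<partial>lborel\<bar> \<le> C * mass g R"
    by (simp add: mass_def)
  then show ?thesis using t
    by (simp add: av_kernel(1)[of \<kappa> g t x] abs_mult mult_left_mono mult.assoc mult.left_commute[of C])
qed

lemma av_continuous:
  fixes g :: "real^'n::finite \<Rightarrow> real"
  assumes k: "\<kappa> \<in> bump N" and g: "loc_int g" and t: "0 < t"
  shows "continuous_on UNIV (av \<kappa> t g)"
proof -
  have [measurable]: "\<kappa> \<in> borel_measurable borel" "g \<in> borel_measurable borel" using k g by auto
  obtain C where C: "\<And>z. \<bar>\<kappa> z\<bar> \<le> C * indicator (cball 0 1) z" using bump_bounded[OF k] by metis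
  have "continuous_on (ball 0 R) (\<lambda>x. \<integral>q. \<kappa> (inverse t *\<^sub>R (q - x)) * g q \<partial>lborel)" for R
  proof (rule continuous_on_integral_dominated[where w="\<lambda>q. C * (indicator (cball 0 (R + t)) q * \<bar>g q\<bar>)"])
    show "continuous_on (ball 0 R) (\<lambda>x. \<kappa> (inverse t *\<^sub>R (q - x)) * g q)" for q
      by (intro continuous_intros continuous_on_compose2[OF bump_continuous[OF k, of UNIV]]) auto
    show "\<bar>\<kappa> (inverse t *\<^sub>R (q - x)) * g q\<bar> \<le> C * (indicator (cball 0 (R + t)) q * \<bar>g q\<bar>)" if "x \<in> ball 0 R" for x q
      by (rule bump_kernel_supp[OF k t C]) (use that in auto)
  qed (auto intro: loc_int_abs[OF g])
  then have "continuous_on (ball 0 R) (av \<kappa> t g)" for R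
    using t by (simp add: av_kernel(1)[of \<kappa> g t] continuous_intros cong: continuous_on_cong)
  then have "isCont (av \<kappa> t g) x" for x
    using continuous_on_eq_continuous_at[of "ball 0 (norm x + 1)" "av \<kappa> t g"] by auto
  then show ?thesis by (simp add: continuous_on_eq_continuous_at)
qed

lemma av_loc_int: "\<kappa> \<in> bump N \<Longrightarrow> loc_int g \<Longrightarrow> 0 < t \<Longrightarrow> loc_int (av \<kappa> t g)"
  by (rule continuous_imp_loc_int[OF av_continuous])

lemma av_has_pd:
  fixes g :: "real^'n::finite \<Rightarrow> real"
  assumes k: "\<kappa> \<in> bump (Suc N)" and g: "loc_int g" and t: "0 < t"
  shows "has_pd i (av \<kappa> t g) x (- (1 / t) * av (partial_deriv i \<kappa>) t g x)"
proof -
  have k': "partial_deriv i \<kappa> \<in> bump N" by (rule bump_pd[OF k])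
  have [measurable]: "\<kappa> \<in> borel_measurable borel" "partial_deriv i \<kappa> \<in> borel_measurable borel" "g \<in> borel_measurable borel" using k k' g by auto
  obtain C where C: "\<And>z. \<bar>partial_deriv i \<kappa> z\<bar> \<le> C * indicator (cball 0 1) z" using bump_bounded[OF k'] by metis
  let ?p = "\<lambda>h. x + h *\<^sub>R axis i (1::real)"
  let ?R = "norm x + 1 + t"
  have "((\<lambda>h. \<integral>q. \<kappa> (inverse t *\<^sub>R (q - ?p h)) * g q \<partial>lborel) has_real_derivative
      (\<integral>q. - (1 / t) * (partial_deriv i \<kappa> (inverse t *\<^sub>R (q - ?p 0)) * g q) \<partial>lborel)) (at 0)"
  proof (rule DERIV_under_integral(1)[where d=1 and F'="\<lambda>h q. - (1 / t) * (partial_deriv i \<kappa> (inverse t *\<^sub>R (q - ?p h)) * g q)"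
       and w="\<lambda>q. (1 / t) * (C * (indicator (cball 0 ?R) q * \<bar>g q\<bar>))"])
    show "integrable lborel (\<lambda>q. \<kappa> (inverse t *\<^sub>R (q - ?p h)) * g q)" for h
      by (rule integrable_bump_kernel[OF k g t])
    show "((\<lambda>h. \<kappa> (inverse t *\<^sub>R (q - ?p h)) * g q) has_real_derivative - (1 / t) * (partial_deriv i \<kappa> (inverse t *\<^sub>R (q - ?p h)) * g q)) (at h)" for h q
    proof -
      have eq: "inverse t *\<^sub>R (q - ?p h) = inverse t *\<^sub>R (q - x) + (- h / t) *\<^sub>R axis i 1" for h
        by (simp add: algebra_simps divide_inverse)
      have "((\<lambda>s. \<kappa> (inverse t *\<^sub>R (q - x) + s *\<^sub>R axis i 1)) has_real_derivative partial_deriv i \<kappa> (inverse t *\<^sub>R (q - ?p h))) (at (- h / t))"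
        unfolding eq by (rule has_pd_line[OF bump_has_pd[OF k]])
      moreover have "((\<lambda>h. - h / t) has_real_derivative - 1 / t) (at h)"
        using t by (auto intro!: derivative_eq_intros)
      ultimately have "((\<lambda>h. \<kappa> (inverse t *\<^sub>R (q - x) + (- h / t) *\<^sub>R axis i 1)) has_real_derivative partial_deriv i \<kappa> (inverse t *\<^sub>R (q - ?p h)) * (- 1 / t)) (at h)"
        by (rule DERIV_chain2)
      then have "((\<lambda>h. \<kappa> (inverse t *\<^sub>R (q - ?p h))) has_real_derivative partial_deriv i \<kappa> (inverse t *\<^sub>R (q - ?p h)) * (- 1 / t)) (at h)"
        unfolding eq .
      from DERIV_cmult_right[OF this, of "g q"] show ?thesis by (simp add: mult_ac)
    qed
    show "\<bar>- (1 / t) * (partial_deriv i \<kappa> (inverse t *\<^sub>R (q - ?p h)) * g q)\<bar> \<le> (1 / t) * (C * (indicator (cball 0 ?R) q * \<bar>g q\<bar>))"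
      if "\<bar>h - 0\<bar> < 1" for h q
    proof -
      have "norm (?p h) + t \<le> ?R" using that norm_triangle_ineq[of x "h *\<^sub>R axis i 1"] by (simp add: norm_axis_1)
      from bump_kernel_supp[OF k' t C this, of q g] show ?thesis
        using t by (subst abs_mult) (simp add: mult_left_mono divide_right_mono)
    qed
    show "integrable lborel (\<lambda>q. (1 / t) * (C * (indicator (cball 0 ?R) q * \<bar>g q\<bar>)))"
      by (intro integrable_mult_right loc_int_abs[OF g])
  qed simp
  from DERIV_cmult[OF this, of "inverse t ^ CARD('n)"]
  have "((\<lambda>h. av \<kappa> t g (?p h)) has_real_derivative
      inverse t ^ CARD('n) * (\<integral>q. - (1 / t) * (partial_deriv i \<kappa> (inverse t *\<^sub>R (q - ?p 0)) * g q) \<partial>lborel)) (at 0)"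
    using t by (simp add: av_kernel(1)[of \<kappa> g t])
  then show ?thesis using t by (simp add: av_kernel(1)[of "partial_deriv i \<kappa>" g t])
qed

text \<open>Differentiating t^(-n) \<kappa>((q - x)/t) in \<open>t\<close> gives two terms: the one
  from the power yields n \<kappa>, the one from the argument yields z . grad \<kappa>. Together
  they form \<open>euler\<close>.\<close>

lemma av_scale_derivative:
  fixes g :: "real^'n::finite \<Rightarrow> real"
  assumes k: "\<kappa> \<in> bump (Suc N)" and g: "loc_int g" and t: "0 < t"
  shows "((\<lambda>t. av \<kappa> t g x) has_real_derivative (- (1 / t) * av (euler \<kappa>) t g x)) (at t)"
proof -
  have k': "euler \<kappa> \<in> bump N" by (rule bump_euler[OF k])
  have [measurable]: "\<kappa> \<in> borel_measurable borel" "euler \<kappa> \<in> borel_measurable borel" "g \<in> borel_measurable borel" using k k' g by auto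
  obtain C where C: "\<And>z. \<bar>euler \<kappa> z\<bar> \<le> C * indicator (cball 0 1) z" using bump_bounded[OF k'] by metis
  have C0: "0 \<le> C" using C[of 0] by simp
  let ?R = "norm x + 2 * t"
  let ?F = "\<lambda>\<theta> q. inverse \<theta> ^ CARD('n) * (\<kappa> (inverse \<theta> *\<^sub>R (q - x)) * g q)"
  let ?F' = "\<lambda>\<theta> q. - inverse \<theta> * (inverse \<theta> ^ CARD('n) * (euler \<kappa> (inverse \<theta> *\<^sub>R (q - x)) * g q))"
  have "((\<lambda>\<theta>. \<integral>q. ?F \<theta> q \<partial>lborel) has_real_derivative (\<integral>q. ?F' t q \<partial>lborel)) (at t)"
  \<comment> \<open>The radius t/2 keeps the scale \<theta> above t/2 and below 2 t. This is the
    origin of the constant 2 / t and of the radius \<open>?R\<close>.\<close>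
  proof (rule DERIV_under_integral(1)[where d="t/2" and F'="?F'"
       and w="\<lambda>q. (2 / t) * ((2 / t) ^ CARD('n) * (C * (indicator (cball 0 ?R) q * \<bar>g q\<bar>)))"])
    fix \<theta> assume th: "\<bar>\<theta> - t\<bar> < t / 2"
    then have th0: "0 < \<theta>" "\<theta> \<le> 2 * t" "inverse \<theta> \<le> 2 / t" using t by (auto simp: abs_if field_simps split: if_splits)
    show "integrable lborel (?F \<theta>)"
      by (intro integrable_mult_right integrable_bump_kernel[OF k g th0(1)])
    fix q
    show "((\<lambda>\<theta>. ?F \<theta> q) has_real_derivative ?F' \<theta> q) (at \<theta>)"
    proof -
      have "((\<lambda>s. \<kappa> (0 + s *\<^sub>R (q - x))) has_real_derivative (\<Sum>i\<in>UNIV. (q - x) $ i * partial_deriv i \<kappa> (0 + inverse \<theta> *\<^sub>R (q - x)))) (at (inverse \<theta>))"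
        by (rule DERIV_along_line[of UNIV]) (auto intro: bump_has_pd[OF k] bump_continuous[OF bump_pd[OF k]])
      from DERIV_chain2[OF this DERIV_inverse] th0
      have 1: "((\<lambda>\<theta>. \<kappa> (inverse \<theta> *\<^sub>R (q - x))) has_real_derivative (\<Sum>i\<in>UNIV. (q - x) $ i * partial_deriv i \<kappa> (inverse \<theta> *\<^sub>R (q - x))) * - (inverse \<theta> ^ Suc (Suc 0))) (at \<theta>)"
        by simp
      have 2: "((\<lambda>\<theta>. inverse \<theta> ^ CARD('n)) has_real_derivative - (real CARD('n) * inverse \<theta> ^ Suc CARD('n))) (at \<theta>)"
      proof -
        obtain m where m: "CARD('n) = Suc m" using not0_implies_Suc[of "CARD('n)"] by auto
        have "((\<lambda>\<theta>. inverse \<theta> ^ Suc m) has_real_derivative real (Suc m) * (- (inverse \<theta> ^ Suc (Suc 0)) * inverse \<theta> ^ (Suc m - Suc 0))) (at \<theta>)"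
          by (rule DERIV_power[OF DERIV_inverse]) (use th0 in simp)
        then show ?thesis unfolding m by (simp add: mult_ac)
      qed
      have "?F' \<theta> q = (- (real CARD('n) * inverse \<theta> ^ Suc CARD('n)) * \<kappa> (inverse \<theta> *\<^sub>R (q - x)) +
         (\<Sum>i\<in>UNIV. (q - x) $ i * partial_deriv i \<kappa> (inverse \<theta> *\<^sub>R (q - x))) * - (inverse \<theta> ^ Suc (Suc 0)) * inverse \<theta> ^ CARD('n)) * g q"
        by (simp add: euler_def algebra_simps sum_distrib_left sum_distrib_right)
      then show ?thesis
        using DERIV_cmult_right[OF DERIV_mult[OF 2 1], of "g q"] by (simp only: mult.assoc)
    qed
    have "\<bar>?F' \<theta> q\<bar> = inverse \<theta> * (inverse \<theta> ^ CARD('n) * \<bar>euler \<kappa> (inverse \<theta> *\<^sub>R (q - x)) * g q\<bar>)"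
      using th0 by (simp add: abs_mult)
    also have "\<dots> \<le> (2 / t) * ((2 / t) ^ CARD('n) * (C * (indicator (cball 0 ?R) q * \<bar>g q\<bar>)))"
      using th0 t C0 by (intro mult_mono power_mono bump_kernel_supp[OF k' th0(1) C]) auto
    finally show "\<bar>?F' \<theta> q\<bar> \<le> (2 / t) * ((2 / t) ^ CARD('n) * (C * (indicator (cball 0 ?R) q * \<bar>g q\<bar>)))" .
  next
    show "integrable lborel (\<lambda>q. (2 / t) * ((2 / t) ^ CARD('n) * (C * (indicator (cball 0 ?R) q * \<bar>g q\<bar>))))"
      by (intro integrable_mult_right loc_int_abs[OF g])
  qed (use t in auto)
  then have 3: "((\<lambda>\<theta>. \<integral>q. ?F \<theta> q \<partial>lborel) has_real_derivative (- (1 / t) * av (euler \<kappa>) t g x)) (at t)"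
    using t by (simp add: av_kernel(1)[of "euler \<kappa>" g t] inverse_eq_divide)
  show ?thesis
    by (rule has_field_derivative_transform_within_open[OF 3, where S="{0<..}"])
       (use t in \<open>auto simp: av_kernel(1)[of \<kappa> g]\<close>)
qed

text \<open>The integral of a translate of \<open>w\<close> is constant, so its derivative vanishes; this avoids
  Fubini on \<open>real^'n\<close>.\<close>

lemma integral_pd_zero:
  fixes w :: "real^'n::finite \<Rightarrow> real"
  assumes w: "integrable lborel w" and pd: "\<And>z. has_pd i w z (D z)"
    and bd: "\<And>z. \<bar>D z\<bar> \<le> C * indicator (cball 0 R) z" and "0 \<le> C"
  shows "(\<integral>z. D z \<partial>lborel) = 0"
proof -
  have "((\<lambda>h. \<integral>q. w (h *\<^sub>R axis i 1 + q) \<partial>lborel) has_real_derivative (\<integral>q. D (0 *\<^sub>R axis i 1 + q) \<partial>lborel)) (at 0)"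
  proof (rule DERIV_under_integral(1)[where d=1 and F'="\<lambda>h q. D (h *\<^sub>R axis i 1 + q)" and w="\<lambda>q. C * indicator (cball 0 (R + 1)) q"])
    show "integrable lborel (\<lambda>q. w (h *\<^sub>R axis i 1 + q))" for h
      by (rule lborel_integrable_translate[OF w])
    show "((\<lambda>h. w (h *\<^sub>R axis i 1 + q)) has_real_derivative D (h *\<^sub>R axis i 1 + q)) (at h)" for h q
      using has_pd_line[OF pd, of q h] by (simp add: add.commute)
    show "\<bar>D (h *\<^sub>R axis i 1 + q)\<bar> \<le> C * indicator (cball 0 (R + 1)) q" if "\<bar>h - 0\<bar> < 1" for h q
    proof -
      have "norm q \<le> norm (h *\<^sub>R axis i 1 + q) + norm (h *\<^sub>R axis i (1::real))"
        by (metis add.commute norm_diff_triangle_ineq add_diff_cancel_left' norm_triangle_sub norm_minus_commute)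
      then have "norm q \<le> norm (h *\<^sub>R axis i 1 + q) + 1" using that by (simp add: norm_axis_1)
      moreover have "0 \<le> C * indicator (cball 0 (R+1)) q"
        using \<open>0 \<le> C\<close> by simp
      ultimately show ?thesis using bd[of "h *\<^sub>R axis i 1 + q"] \<open>0 \<le> C\<close>
        by (cases "norm (h *\<^sub>R axis i 1 + q) \<le> R") (auto simp: indicator_def)
    qed
    show "integrable lborel (\<lambda>q::real^'n. C * indicator (cball 0 (R + 1)) q)"
      using emeasure_lborel_cball_finite[of "0::real^'n" "R + 1"] by (intro integrable_mult_right integrable_real_indicator) auto
  qed simp
  moreover have "(\<lambda>h. \<integral>q. w (h *\<^sub>R axis i 1 + q) \<partial>lborel) = (\<lambda>h. \<integral>q. w q \<partial>lborel)"
    by (simp add: lborel_integral_translate)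
  ultimately have "((\<lambda>h::real. \<integral>q. w q \<partial>lborel) has_real_derivative (\<integral>q. D q \<partial>lborel)) (at 0)"
    by simp
  then show ?thesis using DERIV_unique DERIV_const by blast
qed

lemma integral_pd_bump:
  assumes k: "\<kappa> \<in> bump (Suc N)" shows "(\<integral>z. partial_deriv i \<kappa> z \<partial>lborel) = 0"
proof -
  obtain C where "C > 0" "\<And>z. \<bar>partial_deriv i \<kappa> z\<bar> \<le> C * indicator (cball 0 1) z"
    using bump_bounded[OF bump_pd[OF k]] by blast
  then show ?thesis by (intro integral_pd_zero[OF bump_integrable[OF k] bump_has_pd[OF k]]) auto
qed

text \<open>\<open>euler \<kappa>\<close> is the divergence of z \<kappa>(z), a sum of derivatives
  of kernels, each of integral zero.\<close>

lemma integral_euler_zero: "\<kappa> \<in> bump (Suc N) \<Longrightarrow> (\<integral>z. euler \<kappa> z \<partial>lborel) = 0"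
proof -
  assume k: "\<kappa> \<in> bump (Suc N)"
  have "euler \<kappa> = (\<lambda>z. \<Sum>i\<in>UNIV. partial_deriv i (\<lambda>z. z $ i * \<kappa> z) z)"
    by (simp add: fun_eq_iff euler_def pd_comp[OF k] sum.distrib)
  moreover have "integrable lborel (partial_deriv i (\<lambda>z. z $ i * \<kappa> z))" for i
    by (rule bump_integrable[OF bump_pd[OF bump.comp[OF k]]])
  ultimately show ?thesis
    by (simp add: Bochner_Integration.integral_sum integral_pd_bump[OF bump.comp[OF k]])
qed

section \<open>Integration by parts against a kernel\<close>

lemma bump_mult_continuous:
  assumes k: "\<kappa> \<in> bump N" and U: "open U" and sub: "cball x t \<subseteq> U" and g: "continuous_on U g" and t: "0 \<le> t"
  shows "continuous_on UNIV (\<lambda>z. \<kappa> z * g (x + t *\<^sub>R z))"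
proof -
  let ?A = "(\<lambda>z. x + t *\<^sub>R z) -` U" and ?B = "- cball (0::real^'a) 1"
  have oA: "open ?A" by (intro open_vimage U continuous_intros)
  have "continuous_on ?A (\<lambda>z. \<kappa> z * g (x + t *\<^sub>R z))"
    by (intro continuous_intros bump_continuous[OF k] continuous_on_compose2[OF g]) auto
  moreover have "continuous_on ?B (\<lambda>z. \<kappa> z * g (x + t *\<^sub>R z))"
    by (rule continuous_on_cong[THEN iffD2, OF refl _ continuous_on_const[of _ 0]]) (use bump_supp[OF k] in auto)
  ultimately have "continuous_on (?A \<union> ?B) (\<lambda>z. \<kappa> z * g (x + t *\<^sub>R z))"
    using oA by (intro continuous_on_open_Un) auto
  moreover have "x + t *\<^sub>R z \<in> U" if "norm z \<le> 1" for z
    using that sub t by (auto simp: subset_eq dist_norm mult_left_le)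
  then have "?A \<union> ?B = UNIV" by auto
  ultimately show ?thesis by simp
qed

text \<open>Integration by parts: the derivative of \<kappa>(z) g(x + t z) has integral zero, and
  the chain rule gives the factor \<open>t\<close>. The open set around the closed ball makes
  \<open>g\<close> differentiable also at the points with |z| = 1, where the product extended by
  zero still has to be differentiated.\<close>

lemma av_partial:
  fixes g :: "real^'n::finite \<Rightarrow> real"
  assumes k: "\<kappa> \<in> bump (Suc N)" and U: "open U" and sub: "cball x t \<subseteq> U" and t: "0 \<le> t"
    and pd: "\<And>p. p \<in> U \<Longrightarrow> has_pd i g p (D p)" and g: "continuous_on U g" and D: "continuous_on U D"
  shows "av (partial_deriv i \<kappa>) t g x = - t * av \<kappa> t D x"
proof -
  let ?E = "\<lambda>z. partial_deriv i \<kappa> z * g (x + t *\<^sub>R z) + t * (\<kappa> z * D (x + t *\<^sub>R z))"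
  have inU: "x + t *\<^sub>R z \<in> U" if "norm z \<le> 1" for z
    using that sub t by (auto simp: subset_eq dist_norm mult_left_le)
  have cE: "continuous_on UNIV ?E"
    by (intro continuous_on_add continuous_on_mult_left bump_mult_continuous[OF bump_pd[OF k] U sub g t] bump_mult_continuous[OF k U sub D t])
  obtain B where B: "B > 0" "\<And>z. z \<in> cball 0 1 \<Longrightarrow> \<bar>?E z\<bar> \<le> B"
    using continuous_cball_bounded[OF continuous_on_subset[OF cE subset_UNIV]] by blast
  have int: "integrable lborel (\<lambda>z. \<kappa> z * g (x + t *\<^sub>R z))" "integrable lborel (\<lambda>z. \<kappa> z * D (x + t *\<^sub>R z))"
       "integrable lborel (\<lambda>z. partial_deriv i \<kappa> z * g (x + t *\<^sub>R z))"
    using sub t by (auto intro!: integrable_bump_mult[OF k] integrable_bump_mult[OF bump_pd[OF k]] intro: continuous_on_subset[OF g] continuous_on_subset[OF D])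
  have "(\<integral>z. ?E z \<partial>lborel) = 0"
  proof (rule integral_pd_zero[OF int(1)])
    fix z
    show "has_pd i (\<lambda>z. \<kappa> z * g (x + t *\<^sub>R z)) z (?E z)"
    proof (cases "norm z \<le> 1")
      case True
      have "((\<lambda>h. g ((x + t *\<^sub>R z) + h *\<^sub>R axis i 1)) has_real_derivative D (x + t *\<^sub>R z)) (at (t * 0))"
        using pd[OF inU[OF True]] by simp
      moreover have "((\<lambda>h. t * h) has_real_derivative t) (at 0)"
        by (auto intro!: derivative_eq_intros)
      ultimately have "((\<lambda>h. g ((x + t *\<^sub>R z) + (t * h) *\<^sub>R axis i 1)) has_real_derivative D (x + t *\<^sub>R z) * t) (at 0)"
        by (rule DERIV_chain2)
      then have "((\<lambda>h. g (x + t *\<^sub>R (z + h *\<^sub>R axis i 1))) has_real_derivative D (x + t *\<^sub>R z) * t) (at 0)"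
        by (simp add: algebra_simps)
      from DERIV_mult[OF bump_has_pd[OF k] this] show ?thesis by (simp add: algebra_simps)
    next
      case False
      have "has_pd i (\<lambda>z. 0) z 0" by simp
      then have "has_pd i (\<lambda>z. \<kappa> z * g (x + t *\<^sub>R z)) z 0"
        by (rule has_pd_cong_open[of _ _ _ _ "- cball 0 1"]) (use bump_supp[OF k] False in auto)
      then show ?thesis using False bump_supp[OF k] bump_supp[OF bump_pd[OF k]] by simp
    qed
    show "\<bar>?E z\<bar> \<le> B * indicator (cball 0 1) z"
      using B bump_supp[OF k, of z] bump_supp[OF bump_pd[OF k], of z i] by (auto simp: indicator_def)
  qed (use B in simp)
  then show ?thesis using int by (simp add: av_def)
qed

lemma C_open_has_pd:
  assumes "g \<in> C_open k U" "length is < k" "x \<in> U"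
  shows "has_pd i (D_multi is g) x (D_multi (i # is) g x)"
  using assms by (simp add: C_open_def has_partial_at_iff_has_pd)

lemma C_open_continuous: "g \<in> C_open k U \<Longrightarrow> length is \<le> k \<Longrightarrow> continuous_on U (D_multi is g)"
  by (simp add: C_open_def)

lemma D_multi_append: "D_multi (js @ is) g = D_multi js (D_multi is g)"
  by (induction js) auto

lemma C_open_pd: "g \<in> C_open (Suc k) U \<Longrightarrow> partial_deriv i g \<in> C_open k U"
proof -
  assume g: "g \<in> C_open (Suc k) U"
  have "D_multi is (partial_deriv i g) = D_multi (is @ [i]) g" for "is"
    by (simp add: D_multi_append)
  then show ?thesis using g by (auto simp: C_open_def)
qed

lemma av_sum:
  assumes "\<And>i. i \<in> S \<Longrightarrow> integrable lborel (\<lambda>z. \<kappa> i z * g (x + t *\<^sub>R z))"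
  shows "av (\<lambda>z. \<Sum>i\<in>S. \<kappa> i z) t g x = (\<Sum>i\<in>S. av (\<kappa> i) t g x)"
  using assms by (simp add: av_def sum_distrib_right Bochner_Integration.integral_sum)

lemma av_sum_right:
  assumes "\<And>i. i \<in> S \<Longrightarrow> integrable lborel (\<lambda>z. \<kappa> z * g i (x + t *\<^sub>R z))"
  shows "av \<kappa> t (\<lambda>z. \<Sum>i\<in>S. g i z) x = (\<Sum>i\<in>S. av \<kappa> t (g i) x)"
  using assms by (simp add: av_def sum_distrib_left Bochner_Integration.integral_sum)

lemma av_diff_right:
  assumes "integrable lborel (\<lambda>z. \<kappa> z * g (x + t *\<^sub>R z))" "integrable lborel (\<lambda>z. \<kappa> z * h (x + t *\<^sub>R z))"
  shows "av \<kappa> t (\<lambda>z. g z - h z) x = av \<kappa> t g x - av \<kappa> t h x"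
  using assms by (simp add: av_def right_diff_distrib)

lemma av_scale_left: "av (\<lambda>z. c * \<kappa> z) t g x = c * av \<kappa> t g x"
  by (simp add: av_def mult.assoc)

lemma av_laplacian:
  fixes g :: "real^'n::finite \<Rightarrow> real"
  assumes k: "\<kappa> \<in> bump (Suc (Suc N))" and U: "open U" and sub: "cball x t \<subseteq> U" and t: "0 \<le> t"
    and g: "g \<in> C_open 2 U"
  shows "av (laplacian \<kappa>) t g x = t\<^sup>2 * av \<kappa> t (laplacian g) x"
proof -
  have k1: "\<kappa> \<in> bump (Suc N)" using bump_antimono[OF _ k] by simp
  have c: "continuous_on (cball x t) (D_multi is g)" if "length is \<le> 2" for "is"
    by (rule continuous_on_subset[OF C_open_continuous[OF g that] sub])
  have "av (partial_deriv i (partial_deriv i \<kappa>)) t g x = t\<^sup>2 * av \<kappa> t (partial_deriv i (partial_deriv i g)) x" for i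
  proof -
    have "av (partial_deriv i (partial_deriv i \<kappa>)) t g x = - t * av (partial_deriv i \<kappa>) t (partial_deriv i g) x"
      using C_open_has_pd[OF g, of "[]"] C_open_continuous[OF g, of "[]"] C_open_continuous[OF g, of "[i]"]
      by (intro av_partial[OF bump_pd[OF k] U sub t]) auto
    also have "av (partial_deriv i \<kappa>) t (partial_deriv i g) x = - t * av \<kappa> t (partial_deriv i (partial_deriv i g)) x"
      using C_open_has_pd[OF g, of "[i]"] C_open_continuous[OF g, of "[i]"] C_open_continuous[OF g, of "[i, i]"]
      by (intro av_partial[OF k1 U sub t]) auto
    finally show ?thesis by (simp add: power2_eq_square)
  qed
  moreover have "av (laplacian \<kappa>) t g x = (\<Sum>i\<in>UNIV. av (partial_deriv i (partial_deriv i \<kappa>)) t g x)"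
    unfolding laplacian_eq using c[of "[]"] t
    by (intro av_sum integrable_bump_mult[OF bump_pd[OF bump_pd[OF k]]]) auto
  moreover have "av \<kappa> t (laplacian g) x = (\<Sum>i\<in>UNIV. av \<kappa> t (partial_deriv i (partial_deriv i g)) x)"
    unfolding laplacian_eq using c[of "[i, i]" for i] t
    by (intro av_sum_right integrable_bump_mult[OF k]) auto
  ultimately show ?thesis by (simp add: sum_distrib_left)
qed

text \<open>Both sides are iterated integrals of \<kappa>(z) \<psi>(y) v(x + \<tau> z + t y), so
  this is Fubini. The bound \<open>?K\<close> holds uniformly for |z| <= 1, because all inner
  averages see \<open>v\<close> inside one ball of radius |x| + \<tau> + t.\<close>

lemma av_commute:
  fixes v :: "real^'n::finite \<Rightarrow> real"
  assumes k: "\<kappa> \<in> bump N" and p: "\<psi> \<in> bump N'" and v: "loc_int v" and t: "0 < \<tau>" "0 < t"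
  shows "av \<kappa> \<tau> (av \<psi> t v) x = av \<psi> t (av \<kappa> \<tau> v) x"
proof -
  have [measurable]: "\<kappa> \<in> borel_measurable borel" "\<psi> \<in> borel_measurable borel" "v \<in> borel_measurable borel" using k p v by auto
  obtain C where C: "C > 0" "\<And>z. \<bar>\<kappa> z\<bar> \<le> C * indicator (cball 0 1) z" using bump_bounded[OF k] by blast
  obtain B where B: "B > 0" "\<And>z. \<bar>\<psi> z\<bar> \<le> B * indicator (cball 0 1) z" using bump_bounded[OF p] by blast
  let ?f = "\<lambda>z y. \<kappa> z * (\<psi> y * v (x + \<tau> *\<^sub>R z + t *\<^sub>R y))"
  have int: "integrable (lborel \<Otimes>\<^sub>M lborel) (case_prod ?f)"
  proof (rule lborel_pair.Fubini_integrable)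
    show meas: "case_prod ?f \<in> borel_measurable (lborel \<Otimes>\<^sub>M lborel)" by measurable
    show "AE z in lborel. integrable lborel (\<lambda>y. case_prod ?f (z, y))"
      by (intro AE_I2) (auto intro!: integrable_mult_right integrable_bump_mult_loc[OF p v t(2)])
    let ?K = "C * (B * (inverse t ^ CARD('n) * mass v (norm x + \<tau> + t)))"
    have "\<bar>\<integral>y. norm (case_prod ?f (z, y)) \<partial>lborel\<bar> \<le> ?K * indicator (cball 0 1) z" for z
    proof (cases "norm z \<le> 1")
      case True
      have nz: "norm (x + \<tau> *\<^sub>R z) + t \<le> norm x + \<tau> + t"
      proof -
        have "\<tau> * norm z \<le> \<tau>" using True t by (simp add: mult_left_le)
        moreover have "norm (x + \<tau> *\<^sub>R z) \<le> norm x + \<tau> * norm z"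
          using t norm_triangle_ineq[of x "\<tau> *\<^sub>R z"] by simp
        ultimately show ?thesis by linarith
      qed
      have m: "(\<lambda>y. \<bar>\<psi> y\<bar>) \<in> borel_measurable borel" "(\<lambda>y. \<bar>v y\<bar>) \<in> borel_measurable borel" by measurable
      have "(\<integral>y. \<bar>\<psi> y\<bar> * \<bar>v (x + \<tau> *\<^sub>R z + t *\<^sub>R y)\<bar> \<partial>lborel) =
         inverse t ^ CARD('n) * (\<integral>q. \<bar>\<psi> (inverse t *\<^sub>R (q - (x + \<tau> *\<^sub>R z)))\<bar> * \<bar>v q\<bar> \<partial>lborel)"
        using av_kernel(1)[OF m t(2), of "x + \<tau> *\<^sub>R z"] by (simp add: av_def)
      also have "\<bar>\<integral>q. \<bar>\<psi> (inverse t *\<^sub>R (q - (x + \<tau> *\<^sub>R z)))\<bar> * \<bar>v q\<bar> \<partial>lborel\<bar> \<le> (\<integral>q. B * (indicator (cball 0 (norm x + \<tau> + t)) q * \<bar>v q\<bar>) \<partial>lborel)"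
        using bump_kernel_supp[OF p t(2) B(2) nz, where g=v]
        by (intro abs_integral_le integrable_mult_right loc_int_abs[OF v]) (simp add: abs_mult)
      then have "inverse t ^ CARD('n) * (\<integral>q. \<bar>\<psi> (inverse t *\<^sub>R (q - (x + \<tau> *\<^sub>R z)))\<bar> * \<bar>v q\<bar> \<partial>lborel) \<le> inverse t ^ CARD('n) * (B * mass v (norm x + \<tau> + t))"
        using t by (intro mult_left_mono) (auto simp: mass_def)
      finally have "(\<integral>y. \<bar>\<psi> y\<bar> * \<bar>v (x + \<tau> *\<^sub>R z + t *\<^sub>R y)\<bar> \<partial>lborel) \<le> B * (inverse t ^ CARD('n) * mass v (norm x + \<tau> + t))"
        by (simp add: mult_ac)
      moreover have "0 \<le> (\<integral>y. \<bar>\<psi> y\<bar> * \<bar>v (x + \<tau> *\<^sub>R z + t *\<^sub>R y)\<bar> \<partial>lborel)" by simp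
      moreover have "\<bar>\<kappa> z\<bar> \<le> C" using C(2)[of z] True by simp
      ultimately have "\<bar>\<kappa> z\<bar> * (\<integral>y. \<bar>\<psi> y\<bar> * \<bar>v (x + \<tau> *\<^sub>R z + t *\<^sub>R y)\<bar> \<partial>lborel) \<le> ?K"
        using C(1) by (intro mult_mono) auto
      then show ?thesis using True by (simp add: abs_mult)
    next
      case False
      then show ?thesis using bump_supp[OF k, of z] by simp
    qed
    then show "integrable lborel (\<lambda>z. \<integral>y. norm (case_prod ?f (z, y)) \<partial>lborel)"
      using meas by (intro integrable_bounded_compact_support) (auto intro!: lborel.borel_measurable_lebesgue_integral)
  qed
  have "av \<kappa> \<tau> (av \<psi> t v) x = (\<integral>z. \<integral>y. ?f z y \<partial>lborel \<partial>lborel)"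
    by (simp add: av_def)
  also have "\<dots> = (\<integral>y. \<integral>z. ?f z y \<partial>lborel \<partial>lborel)"
    by (rule lborel_pair.Fubini_integral[OF int, symmetric])
  also have "\<dots> = av \<psi> t (av \<kappa> \<tau> v) x"
  proof -
    have "(\<integral>z. ?f z y \<partial>lborel) = \<psi> y * (\<integral>z. \<kappa> z * v (x + t *\<^sub>R y + \<tau> *\<^sub>R z) \<partial>lborel)" for y
      by (subst integral_mult_right_zero[symmetric]) (simp add: algebra_simps)
    then show ?thesis by (simp add: av_def)
  qed
  finally show ?thesis .
qed

lemma pd_av:
  assumes "\<kappa> \<in> bump (Suc N)" "loc_int g" "0 < t"
  shows "partial_deriv i (\<lambda>x. c * av \<kappa> t g x) = (\<lambda>x. c * - (1 / t) * av (partial_deriv i \<kappa>) t g x)"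
  using DERIV_cmult[OF av_has_pd[OF assms]] by (intro ext has_pd_imp_partial_deriv) (simp add: mult.assoc)

lemma D_multi_av:
  assumes "\<kappa> \<in> bump (N + length is)" "loc_int g" "0 < t"
  shows "D_multi is (av \<kappa> t g) = (\<lambda>x. (- (1 / t)) ^ length is * av (D_multi is \<kappa>) t g x)"
  using assms(1)
proof (induction "is" arbitrary: N)
  case (Cons i js)
  have k: "D_multi js \<kappa> \<in> bump (Suc N)" using Cons.prems by (intro D_multi_bump) simp
  show ?case using Cons.IH[of "Suc N"] Cons.prems pd_av[OF k assms(2,3), of i "(- (1 / t)) ^ length js"]
    by (simp add: mult_ac)
qed simp

lemma av_C_open:
  assumes "\<kappa> \<in> bump (N + k)" "loc_int g" "0 < t"
  shows "av \<kappa> t g \<in> C_open k U"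
proof -
  have m: "\<kappa> \<in> bump (N' + length is)" if "N' + length is \<le> N + k" for N' and "is" :: "'a list"
    using bump_antimono[OF that assms(1)] .
  have eq: "D_multi is (av \<kappa> t g) = (\<lambda>x. (- (1 / t)) ^ length is * av (D_multi is \<kappa>) t g x)" if "length is \<le> k" for "is"
    by (rule D_multi_av[OF m[where N'=0] assms(2,3)]) (use that in simp)
  have "has_pd i (D_multi is (av \<kappa> t g)) x ((- (1 / t)) ^ length is * (- (1 / t) * av (partial_deriv i (D_multi is \<kappa>)) t g x))"
    if "length is < k" for i "is" x
    unfolding eq[OF less_imp_le[OF that]]
    by (intro DERIV_cmult av_has_pd[OF D_multi_bump[OF m[where N'="Suc 0"], unfolded One_nat_def] assms(2,3)]) (use that in simp)
  moreover have "continuous_on U (D_multi is (av \<kappa> t g))" if "length is \<le> k" for "is"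
    unfolding eq[OF that]
    by (intro continuous_on_mult_left continuous_on_subset[OF av_continuous[OF D_multi_bump[OF m[where N'=0]] assms(2,3)]]) (use that in auto)
  ultimately show ?thesis
    unfolding C_open_def using has_pd_imp_has_partial_at by blast
qed

lemma laplacian_av:
  assumes k: "\<kappa> \<in> bump (Suc (Suc N))" and g: "loc_int g" and t: "0 < t"
  shows "laplacian (av \<kappa> t g) = (\<lambda>x. (1 / t)\<^sup>2 * av (laplacian \<kappa>) t g x)"
proof
  fix x
  have "D_multi [i, i] (av \<kappa> t g) x = (1 / t)\<^sup>2 * av (partial_deriv i (partial_deriv i \<kappa>)) t g x" for i
    using D_multi_av[of \<kappa> N "[i, i]" g t] assms by (simp add: power2_eq_square)
  moreover have "av (laplacian \<kappa>) t g x = (\<Sum>i\<in>UNIV. av (partial_deriv i (partial_deriv i \<kappa>)) t g x)"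
    unfolding laplacian_eq
    by (intro av_sum integrable_bump_mult_loc[OF bump_pd[OF bump_pd[OF k]] g t])
  ultimately show "laplacian (av \<kappa> t g) x = (1 / t)\<^sup>2 * av (laplacian \<kappa>) t g x"
    unfolding laplacian_def by (simp add: sum_distrib_left)
qed

text \<open>The Laplacian of the double average is computed twice, by \<open>av_commute\<close> with
  either kernel outermost. It falls on the outer kernel and produces the inverse square of that
  kernel's scale.\<close>

lemma av_shift_laplacian:
  assumes k: "\<kappa> \<in> bump (Suc (Suc N))" and p: "\<psi> \<in> bump (Suc (Suc N'))" and v: "loc_int v" and t: "0 < \<tau>" "0 < t"
  shows "av (laplacian \<kappa>) \<tau> (av \<psi> t v) x = (\<tau> / t)\<^sup>2 * av (laplacian \<psi>) t (av \<kappa> \<tau> v) x"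
proof -
  have "av \<kappa> \<tau> (av \<psi> t v) = av \<psi> t (av \<kappa> \<tau> v)" by (intro ext av_commute[OF k p v t])
  then have "laplacian (av \<kappa> \<tau> (av \<psi> t v)) x = laplacian (av \<psi> t (av \<kappa> \<tau> v)) x" by simp
  then have "(1 / \<tau>)\<^sup>2 * av (laplacian \<kappa>) \<tau> (av \<psi> t v) x = (1 / t)\<^sup>2 * av (laplacian \<psi>) t (av \<kappa> \<tau> v) x"
    by (simp add: laplacian_av[OF k av_loc_int[OF p v t(2)] t(1)] laplacian_av[OF p av_loc_int[OF k v t(1)] t(2)])
  then show ?thesis using t by (simp add: power_divide field_simps)
qed

text \<open>Each Laplacian moved from scale \<tau> to scale t gains the factor (\<tau>/t)^2. For t
  bounded below the total is of order \<tau>^(2 M), whatever the function is.\<close>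

lemma av_shift_laplacian_pow:
  assumes k: "\<kappa> \<in> bump (N + 2 * M)" and p: "\<psi> \<in> bump (N' + 2 * M)" and v: "loc_int v" and t: "0 < \<tau>" "0 < t"
  shows "av ((laplacian ^^ M) \<kappa>) \<tau> (av \<psi> t v) x = (\<tau> / t) ^ (2 * M) * av \<kappa> \<tau> (av ((laplacian ^^ M) \<psi>) t v) x"
  using k p
proof (induction M arbitrary: N N' \<psi>)
  case (Suc M)
  have k1: "(laplacian ^^ M) \<kappa> \<in> bump (Suc (Suc N))" using Suc.prems(1) by (intro bump_laplacian_pow) simp
  have p1: "\<psi> \<in> bump (Suc (Suc (N' + 2 * M)))" using Suc.prems(2) by simp
  have "av ((laplacian ^^ Suc M) \<kappa>) \<tau> (av \<psi> t v) x = av (laplacian ((laplacian ^^ M) \<kappa>)) \<tau> (av \<psi> t v) x" by simp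
  also have "\<dots> = (\<tau> / t)\<^sup>2 * av (laplacian \<psi>) t (av ((laplacian ^^ M) \<kappa>) \<tau> v) x"
    by (rule av_shift_laplacian[OF k1 p1 v t])
  also have "av (laplacian \<psi>) t (av ((laplacian ^^ M) \<kappa>) \<tau> v) x = av ((laplacian ^^ M) \<kappa>) \<tau> (av (laplacian \<psi>) t v) x"
    by (rule av_commute[OF bump_laplacian[OF p1] k1 v t(2,1)])
  also have "\<dots> = (\<tau> / t) ^ (2 * M) * av \<kappa> \<tau> (av ((laplacian ^^ M) (laplacian \<psi>)) t v) x"
    using Suc.prems bump_laplacian[OF p1] by (intro Suc.IH[of "Suc (Suc N)" _ N']) auto
  finally show ?case by (simp add: funpow_swap1 power_add[symmetric] mult.assoc[symmetric] del: funpow.simps(2)) (simp add: funpow_swap1)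
qed simp

text \<open>The endpoint 0 is included: the mean value theorem and the fundamental theorem of
  calculus are applied on the whole interval to recover \<open>w x\<close> from averages.\<close>

lemma av_continuous_scale:
  assumes p: "\<psi> \<in> bump N" and w: "continuous_on (cball x t) w"
  shows "continuous_on {0..t} (\<lambda>\<theta>. av \<psi> \<theta> w x)"
  unfolding av_def
proof (cases "0 \<le> t")
  case t: True
  have inc: "x + \<theta> *\<^sub>R z \<in> cball x t" if "norm z \<le> 1" "\<theta> \<in> {0..t}" for z \<theta>
    using mult_mono[of \<theta> t "norm z" 1] that by (simp add: dist_norm)
  obtain B where B: "B > 0" "\<And>z. z \<in> cball x t \<Longrightarrow> \<bar>w z\<bar> \<le> B"
    using continuous_cball_bounded[OF w] by blast
  show "continuous_on {0..t} (\<lambda>\<theta>. \<integral>z. \<psi> z * w (x + \<theta> *\<^sub>R z) \<partial>lborel)"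
  proof (rule continuous_on_integral_dominated[where w="\<lambda>z. \<bar>\<psi> z\<bar> * B"])
    show "(\<lambda>z. \<psi> z * w (x + \<theta> *\<^sub>R z)) \<in> borel_measurable lborel" if "\<theta> \<in> {0..t}" for \<theta>
      using that by (intro borel_measurable_integrable integrable_bump_mult[OF p] continuous_on_subset[OF w]) auto
    show "continuous_on {0..t} (\<lambda>\<theta>. \<psi> z * w (x + \<theta> *\<^sub>R z))" for z
    proof (cases "norm z \<le> 1")
      case True
      then show ?thesis using inc
        by (intro continuous_intros continuous_on_compose2[OF w]) auto
    qed (use bump_supp[OF p, of z] in simp)
    show "\<bar>\<psi> z * w (x + \<theta> *\<^sub>R z)\<bar> \<le> \<bar>\<psi> z\<bar> * B" if "\<theta> \<in> {0..t}" for \<theta> z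
      using inc[of z \<theta>] that B bump_supp[OF p, of z] by (cases "norm z \<le> 1") (auto simp: abs_mult intro!: mult_left_mono)
    show "integrable lborel (\<lambda>z. \<bar>\<psi> z\<bar> * B)"
      by (intro integrable_mult_left integrable_abs bump_integrable[OF p])
  qed
qed simp

lemma av_zero: "av \<psi> 0 w x = (\<integral>z. \<psi> z \<partial>lborel) * w x"
  by (simp add: av_def)

text \<open>Since \<open>euler \<psi>\<close> is a Laplacian, the derivative of the average in the
  scale \<theta> equals -c \<theta> times an average of the Laplacian of \<open>w\<close>, hence is
  linear in \<theta>. The mean value theorem adds the second factor \<open>t\<close>.\<close>

lemma av_second_order:
  fixes w :: "real^'n::finite \<Rightarrow> real"
  assumes p: "\<psi> \<in> bump (Suc N)" and e: "euler \<psi> = (\<lambda>z. c * laplacian \<eta> z)" and eta: "\<eta> \<in> bump (Suc (Suc N'))"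
    and w: "loc_int w" and U: "open U" "cball x t \<subseteq> U" and C2: "w \<in> C_open 2 U" and t: "0 \<le> t"
    and K: "\<And>y. y \<in> cball x t \<Longrightarrow> \<bar>laplacian w y\<bar> \<le> K"
  shows "\<bar>(\<integral>z. \<psi> z \<partial>lborel) * w x - av \<psi> t w x\<bar> \<le> \<bar>c\<bar> * (\<integral>z. \<bar>\<eta> z\<bar> \<partial>lborel) * K * t\<^sup>2"
proof (cases "t = 0")
  case False
  with t have t: "0 < t" by simp
  have cw: "continuous_on (cball x t) w"
    using C_open_continuous[OF C2, of "[]"] U(2) by (auto intro: continuous_on_subset)
  let ?L = "\<bar>c\<bar> * (\<integral>z. \<bar>\<eta> z\<bar> \<partial>lborel) * K"
  have bd: "\<bar>- (1 / \<theta>) * av (euler \<psi>) \<theta> w x\<bar> \<le> ?L * t" if "0 < \<theta>" "\<theta> \<le> t" for \<theta>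
  proof -
    have sub: "cball x \<theta> \<subseteq> cball x t" using that by (intro cball_subset_cball_iff[THEN iffD2]) auto
    have "av (euler \<psi>) \<theta> w x = c * (\<theta>\<^sup>2 * av \<eta> \<theta> (laplacian w) x)"
      using av_laplacian[OF eta U(1) order_trans[OF sub U(2)] _ C2] that by (simp add: e av_scale_left)
    then have "- (1 / \<theta>) * av (euler \<psi>) \<theta> w x = - (c * \<theta> * av \<eta> \<theta> (laplacian w) x)"
      using that by (simp add: power2_eq_square)
    moreover have "\<bar>av \<eta> \<theta> (laplacian w) x\<bar> \<le> (\<integral>z. \<bar>\<eta> z\<bar> \<partial>lborel) * K"
      using that K sub by (intro av_bound[OF eta]) auto
    moreover have "0 \<le> K" using K[of x] t by force
    ultimately have "\<bar>- (1 / \<theta>) * av (euler \<psi>) \<theta> w x\<bar> \<le> \<bar>c\<bar> * t * ((\<integral>z. \<bar>\<eta> z\<bar> \<partial>lborel) * K)"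
      using that by (simp add: abs_mult) (intro mult_mono mult_left_mono; simp)
    then show ?thesis by (simp add: mult_ac)
  qed
  obtain \<xi> where xi: "0 < \<xi>" "\<xi> < t" "av \<psi> t w x - av \<psi> 0 w x = (- (1 / \<xi>) * av (euler \<psi>) \<xi> w x) * (t - 0)"
    by (rule mvt[OF t av_continuous_scale[OF p cw], where f'="\<lambda>\<xi>. (*) (- (1 / \<xi>) * av (euler \<psi>) \<xi> w x)"])
       (use av_scale_derivative[OF p w] in \<open>auto simp: has_field_derivative_def\<close>)
  then have "\<bar>av \<psi> t w x - av \<psi> 0 w x\<bar> = \<bar>- (1 / \<xi>) * av (euler \<psi>) \<xi> w x\<bar> * t"
    using t by (simp add: abs_mult)
  also have "\<dots> \<le> (?L * t) * t"
    using bd[of \<xi>] xi t by (intro mult_right_mono) auto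
  finally show ?thesis by (simp add: av_zero power2_eq_square abs_minus_commute mult_ac)
qed (simp add: av_zero)

section \<open>Kernels that are iterated Laplacians\<close>

text \<open>Iteration of \<open>laplacian_euler\<close>, with 2 added for each Laplacian.\<close>

lemma laplacian_pow_euler:
  assumes "\<kappa> \<in> bump (Suc N + 2 * M)"
  shows "(laplacian ^^ M) (euler \<kappa>) = (\<lambda>z. euler ((laplacian ^^ M) \<kappa>) z + 2 * real M * (laplacian ^^ M) \<kappa> z)"
  using assms
proof (induction M arbitrary: N)
  case (Suc M)
  have k: "(laplacian ^^ M) \<kappa> \<in> bump (Suc (Suc (Suc N)))"
    using Suc.prems by (intro bump_laplacian_pow) simp
  have k2: "(laplacian ^^ M) \<kappa> \<in> bump (Suc (Suc N))" using bump_antimono[OF _ k] by simp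
  have "(laplacian ^^ Suc M) (euler \<kappa>) = laplacian (\<lambda>z. euler ((laplacian ^^ M) \<kappa>) z + 2 * real M * (laplacian ^^ M) \<kappa> z)"
    using Suc.IH[of "Suc (Suc N)"] Suc.prems by simp
  also have "\<dots> = (\<lambda>z. laplacian (euler ((laplacian ^^ M) \<kappa>)) z + 2 * real M * laplacian ((laplacian ^^ M) \<kappa>) z)"
    by (rule laplacian_add_scale[OF bump_euler[OF k] k2])
  finally show ?case by (simp add: laplacian_euler[OF k] algebra_simps)
qed simp

lemma integral_base_pos: "0 < integral\<^sup>L lborel (\<lambda>z::real^'n::finite. (max 0 (1 - z \<bullet> z)) ^ k)" if "0 < k"
proof -
  let ?B = "\<lambda>z::real^'n. (max 0 (1 - z \<bullet> z)) ^ k"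
  have b: "?B \<in> bump 0" by (rule bump.base[OF that])
  have m: "0 < measure lborel (cball (0::real^'n) (1/2))"
    using content_cball_pos[of "1/2" "0::real^'n"] by simp
  have "integral\<^sup>L lborel (\<lambda>z::real^'n. (3 / 4 :: real) ^ k * indicator (cball 0 (1/2)) z) \<le> (\<integral>z. ?B z \<partial>lborel)"
  proof (rule integral_mono[OF _ bump_integrable[OF b]])
    show "integrable lborel (\<lambda>z::real^'n. (3 / 4) ^ k * indicator (cball 0 (1/2)) z :: real)"
      using emeasure_lborel_cball_finite[of "0::real^'n" "1/2"] by (intro integrable_mult_right integrable_real_indicator) auto
    show "(3 / 4) ^ k * indicator (cball 0 (1/2)) z \<le> ?B z" for z :: "real^'n"
    proof (cases "norm z \<le> 1/2")
      case True
      then have "z \<bullet> z \<le> 1/4" using power_mono[OF True, of 2] by (simp add: dot_square_norm power2_eq_square)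
      then have "(3/4) ^ k \<le> ?B z" by (intro power_mono) auto
      then show ?thesis using True by simp
    qed simp
  qed
  moreover have "0 < integral\<^sup>L lborel (\<lambda>z::real^'n. (3 / 4 :: real) ^ k * indicator (cball 0 (1/2)) z)"
    using m by simp
  ultimately show ?thesis by linarith
qed

lemma laplacian_pow_scale: "\<kappa> \<in> bump (N + 2 * M) \<Longrightarrow> (laplacian ^^ M) (\<lambda>z. c * \<kappa> z) = (\<lambda>z. c * (laplacian ^^ M) \<kappa> z)"
  using laplacian_pow_add_scale[of \<kappa> N M \<kappa> "c - 1"] by (simp add: algebra_simps)

lemma euler_scale: "\<kappa> \<in> bump (Suc N) \<Longrightarrow> euler (\<lambda>z. c * \<kappa> z) = (\<lambda>z. c * euler \<kappa> z)"
  using euler_add_scale[of \<kappa> N \<kappa> "c - 1"] by (simp add: algebra_simps)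

text \<open>If \<open>E \<phi>\<close> is a multiple of \<open>\<Delta>^M B_K\<close>, then so is \<open>E (E + 2 M) \<phi>\<close> of \<open>\<Delta>^(M+1) B_(K+1)\<close>, because
  \<open>(E + 2 M) \<Delta>^M = \<Delta>^M E\<close> and \<open>E B_K\<close> is a multiple of \<open>\<Delta> B_(K+1)\<close>. The integral is only multiplied by
  \<open>2 M\<close>.\<close>

lemma euler_iterated_laplacian:
  assumes "N + 2 * M + 10 \<le> K"
  shows "\<exists>\<phi>\<in>bump N. \<exists>c. integral\<^sup>L lborel (\<phi> :: real^'n::finite \<Rightarrow> real) \<noteq> 0 \<and>
     euler \<phi> = (\<lambda>z. c * (laplacian ^^ Suc M) (\<lambda>z. (max 0 (1 - z \<bullet> z)) ^ K) z)"
  using assms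
proof (induction M arbitrary: N K)
  case 0
  then obtain k where k: "K = Suc k" "1 < k" "N < k" by (cases K) auto
  have "euler (\<lambda>z::real^'n. (max 0 (1 - z \<bullet> z)) ^ k) = (\<lambda>z. (- 1 / (2 * real (Suc k))) * laplacian (\<lambda>z. (max 0 (1 - z \<bullet> z)) ^ Suc k) z)"
    unfolding laplacian_base[OF k(2)] by (simp del: of_nat_Suc)
  then have "euler (\<lambda>z::real^'n. (max 0 (1 - z \<bullet> z)) ^ k) = (\<lambda>z. (- 1 / (2 * real (Suc k))) * (laplacian ^^ Suc 0) (\<lambda>z. (max 0 (1 - z \<bullet> z)) ^ K) z)"
    by (simp add: k(1) del: power_Suc)
  moreover have "integral\<^sup>L lborel (\<lambda>z::real^'n. (max 0 (1 - z \<bullet> z)) ^ k) \<noteq> 0"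
    using integral_base_pos[of k, where 'n='n] k by simp
  ultimately show ?case by (intro bexI[OF _ bump.base[OF k(3)]] exI conjI)
next
  case (Suc M)
  obtain K' where K': "K = Suc K'" using Suc.prems by (cases K) auto
  let ?B = "\<lambda>k z. (max 0 (1 - z \<bullet> z :: real)) ^ k :: real"
  let ?B' = "\<lambda>z::real^'n. ?B K' z"
  \<comment> \<open>One order more than \<open>N\<close> is requested, because the new kernel
    contains \<open>euler \<phi>\<close> and thereby loses one.\<close>
  have le: "Suc N + 2 * M + 10 \<le> K'" using Suc.prems K' by simp
  obtain \<phi> :: "real^'n \<Rightarrow> real" and c where phi: "\<phi> \<in> bump (Suc N)" "(\<integral>z. \<phi> z \<partial>lborel) \<noteq> 0"
    and e: "euler \<phi> = (\<lambda>z. c * (laplacian ^^ Suc M) ?B' z)"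
    using Suc.IH[OF le] by blast
  have b: "?B' \<in> bump (Suc N + 2 * Suc M)" by (rule bump.base) (use le in simp)
  have bL: "(laplacian ^^ Suc M) ?B' \<in> bump (Suc N)" by (rule bump_laplacian_pow[OF b])
  have bK: "(\<lambda>z::real^'n. ?B K z) \<in> bump (N + 2 * Suc (Suc M))" by (rule bump.base) (use Suc.prems in simp)
  have bK2: "laplacian (\<lambda>z::real^'n. ?B K z) \<in> bump (N + 2 * Suc M)" by (rule bump_laplacian) (use bK in simp)
  have pN: "\<phi> \<in> bump N" using bump_antimono[OF _ phi(1)] by simp
  let ?\<phi> = "\<lambda>z. euler \<phi> z + 2 * real (Suc M) * \<phi> z"
  have "euler ?\<phi> = (\<lambda>z. euler (euler \<phi>) z + 2 * real (Suc M) * euler \<phi> z)"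
    by (rule euler_add_scale[OF _ phi(1)]) (simp only: e, rule bump.scale[OF bL])
  also have "\<dots> = (\<lambda>z. c * (euler ((laplacian ^^ Suc M) ?B') z + 2 * real (Suc M) * (laplacian ^^ Suc M) ?B' z))"
    by (simp only: e euler_scale[OF bL]) (simp only: distrib_left mult_ac)
  also have "\<dots> = (\<lambda>z. c * (laplacian ^^ Suc M) (euler ?B') z)"
    using laplacian_pow_euler[OF b] by simp
  also have "euler ?B' = (\<lambda>z. (- 1 / (2 * real K)) * laplacian (\<lambda>z. ?B K z) z)"
    unfolding K' using laplacian_base[of K', where 'n='n] le by (simp del: of_nat_Suc power_Suc)
  also have "(laplacian ^^ Suc M) (\<lambda>z. (- 1 / (2 * real K)) * laplacian (\<lambda>z::real^'n. ?B K z) z) =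
     (\<lambda>z. (- 1 / (2 * real K)) * (laplacian ^^ Suc M) (laplacian (\<lambda>z. ?B K z)) z)"
    by (rule laplacian_pow_scale[OF bK2])
  also have "(laplacian ^^ Suc M) (laplacian (\<lambda>z::real^'n. ?B K z)) = (laplacian ^^ Suc (Suc M)) (\<lambda>z. ?B K z)"
    by (simp add: funpow_swap1)
  finally have 1: "euler ?\<phi> = (\<lambda>z. (c * (- 1 / (2 * real K))) * (laplacian ^^ Suc (Suc M)) (\<lambda>z. ?B K z) z)"
    by (simp only: mult.assoc)
  have "(\<integral>z. ?\<phi> z \<partial>lborel) = 2 * real (Suc M) * (\<integral>z. \<phi> z \<partial>lborel)"
    using integral_euler_zero[OF phi(1)] bump_integrable[OF bump_euler[OF phi(1)]] bump_integrable[OF phi(1)] by simp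
  then have 2: "(\<integral>z. ?\<phi> z \<partial>lborel) \<noteq> 0" using phi(2) by simp
  have 3: "?\<phi> \<in> bump N" by (intro bump.add bump_euler phi bump.scale pN)
  show ?case using 1 2 3 by blast
qed

lemma mollifier_exists:
  obtains \<phi> \<kappa> :: "real^'n::finite \<Rightarrow> real"
  where "\<phi> \<in> bump N" "\<kappa> \<in> bump (N + 2 * Suc M)" "(\<integral>z. \<phi> z \<partial>lborel) = 1" "euler \<phi> = (laplacian ^^ Suc M) \<kappa>"
proof -
  let ?K = "Suc N + 2 * M + 10"
  let ?B = "\<lambda>z::real^'n. (max 0 (1 - z \<bullet> z)) ^ ?K"
  obtain \<phi> :: "real^'n \<Rightarrow> real" and c where phi: "\<phi> \<in> bump (Suc N)" "(\<integral>z. \<phi> z \<partial>lborel) \<noteq> 0"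
    and e: "euler \<phi> = (\<lambda>z. c * (laplacian ^^ Suc M) ?B z)"
    using euler_iterated_laplacian[of "Suc N" M ?K] by blast
  let ?J = "\<integral>z. \<phi> z \<partial>lborel"
  have b: "?B \<in> bump (N + 2 * Suc M)" by (rule bump.base) simp
  show ?thesis
  proof (rule that[of "\<lambda>z. (1 / ?J) * \<phi> z" "\<lambda>z. (1 / ?J * c) * ?B z"])
    show "(\<lambda>z. (1 / ?J) * \<phi> z) \<in> bump N" using bump_antimono[OF _ phi(1), of N] by (intro bump.scale) simp
    show "(\<lambda>z. (1 / ?J * c) * ?B z) \<in> bump (N + 2 * Suc M)" by (rule bump.scale[OF b])
    show "(\<integral>z. (1 / ?J) * \<phi> z \<partial>lborel) = 1" using phi by simp
    show "euler (\<lambda>z. (1 / ?J) * \<phi> z) = (laplacian ^^ Suc M) (\<lambda>z. (1 / ?J * c) * ?B z)"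
      by (simp only: euler_scale[OF phi(1)] e laplacian_pow_scale[OF b]) (simp only: mult.assoc)
  qed
qed

section \<open>Averages against derivatives of kernels\<close>

primrec deriv_bump :: "nat \<Rightarrow> nat \<Rightarrow> (real^'n::finite \<Rightarrow> real) set" where
  "deriv_bump 0 N = bump N"
| "deriv_bump (Suc k) N = {\<lambda>z. \<Sum>i\<in>UNIV. partial_deriv i (\<eta> i) z | \<eta>. \<forall>i. \<eta> i \<in> deriv_bump k (Suc N)}"

lemma deriv_bump_subset: "deriv_bump k N \<subseteq> bump N"
proof (induction k arbitrary: N)
  case (Suc k)
  then show ?case by (auto intro!: bump_sum bump_pd)
qed simp

lemma deriv_bump_zero: "(\<lambda>z. 0) \<in> deriv_bump k N"
proof (induction k arbitrary: N)
  case 0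
  then show ?case by (simp add: bump_zero)
next
  case (Suc k)
  have z: "partial_deriv i (\<lambda>z. 0) z = 0" for i :: 'a and z by (rule has_pd_imp_partial_deriv) simp
  show ?case using Suc by (auto intro!: exI[of _ "\<lambda>i z. 0"] simp: z)
qed

lemma deriv_bump_Suc_subset: "deriv_bump (Suc k) N \<subseteq> deriv_bump k N"
proof (induction k arbitrary: N)
  case 0
  then show ?case by (auto intro!: bump_sum bump_pd)
next
  case (Suc k)
  show ?case
  proof
    fix \<xi> assume "\<xi> \<in> (deriv_bump (Suc (Suc k)) N :: (real^'a \<Rightarrow> real) set)"
    then obtain \<eta> where "\<xi> = (\<lambda>z. \<Sum>i\<in>UNIV. partial_deriv i (\<eta> i) z)" "\<forall>i. \<eta> i \<in> deriv_bump (Suc k) (Suc N)"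
      unfolding deriv_bump.simps(2)[of "Suc k"] by blast
    then show "\<xi> \<in> deriv_bump (Suc k) N" using Suc[of "Suc N"] unfolding deriv_bump.simps(2)[of k N] by blast
  qed
qed

lemma deriv_bump_antimono: "j \<le> k \<Longrightarrow> deriv_bump k N \<subseteq> deriv_bump j N"
  by (induction k rule: dec_induct) (use deriv_bump_Suc_subset in blast)+

lemma pd_deriv_bump:
  assumes "\<xi> \<in> deriv_bump k (Suc N)" shows "partial_deriv i \<xi> \<in> deriv_bump (Suc k) N"
proof -
  have z: "partial_deriv i (\<lambda>z. 0) z = 0" for i :: 'a and z by (rule has_pd_imp_partial_deriv) simp
  have "partial_deriv i \<xi> = (\<lambda>z. \<Sum>j\<in>UNIV. partial_deriv j (if j = i then \<xi> else (\<lambda>z. 0)) z)"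
    by (rule ext, subst sum.remove[of UNIV i]) (auto simp: z)
  moreover have "\<forall>j. (if j = i then \<xi> else (\<lambda>z. 0)) \<in> deriv_bump k (Suc N)" using assms deriv_bump_zero by auto
  ultimately show ?thesis unfolding deriv_bump.simps mem_Collect_eq
    by (intro exI[of _ "\<lambda>j. if j = i then \<xi> else (\<lambda>z. 0)"] conjI)
qed

lemma laplacian_deriv_bump: "\<xi> \<in> deriv_bump k (Suc (Suc N)) \<Longrightarrow> laplacian \<xi> \<in> deriv_bump (Suc (Suc k)) N"
  unfolding laplacian_eq deriv_bump.simps(2)[of "Suc k"] mem_Collect_eq
  by (intro exI[of _ "\<lambda>i. partial_deriv i \<xi>"] conjI refl allI pd_deriv_bump)

lemma laplacian_pow_deriv_bump: "\<kappa> \<in> bump (N + 2 * M) \<Longrightarrow> (laplacian ^^ M) \<kappa> \<in> deriv_bump (2 * M) N"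
proof (induction M arbitrary: N)
  case (Suc M)
  then show ?case using laplacian_deriv_bump[of "(laplacian ^^ M) \<kappa>" "2 * M" N] Suc.IH[of "Suc (Suc N)"] by simp
qed simp

text \<open>Of the m + 1 derivatives on the kernel, m are moved to \<open>g\<close>, each giving a
  factor \<open>t\<close>. The last one makes the kernel of integral zero, so the value at
  \<open>x\<close> can be subtracted and only the oscillation of the m-th derivatives remains. The
  constant depends on the kernel alone.\<close>

lemma av_deriv_bump_bound:
  assumes "\<xi> \<in> deriv_bump (Suc m) N"
  shows "\<exists>C\<ge>0. \<forall>g U x t \<omega>. open U \<longrightarrow> cball x t \<subseteq> U \<longrightarrow> 0 \<le> t \<longrightarrow> g \<in> C_open m U \<longrightarrow>
     (\<forall>is y. length is = m \<longrightarrow> y \<in> cball x t \<longrightarrow> \<bar>D_multi is g y - D_multi is g x\<bar> \<le> \<omega>) \<longrightarrow> \<bar>av \<xi> t g x\<bar> \<le> C * t ^ m * \<omega>"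
  using assms
proof (induction m arbitrary: \<xi> N)
  case 0
  then obtain \<eta> where eta: "\<xi> = (\<lambda>z. \<Sum>i\<in>UNIV. partial_deriv i (\<eta> i) z)" "\<And>i. \<eta> i \<in> bump (Suc N)" by auto
  have b: "\<xi> \<in> bump N" using 0 deriv_bump_subset by blast
  have z: "(\<integral>z. \<xi> z \<partial>lborel) = 0"
    using integral_pd_bump[OF eta(2)] by (simp add: eta(1) Bochner_Integration.integral_sum[OF bump_integrable[OF bump_pd[OF eta(2)]]])
  show ?case
  proof (intro exI[of _ "\<integral>z. \<bar>\<xi> z\<bar> \<partial>lborel"] conjI allI impI)
    fix g :: "real^'a \<Rightarrow> real" and U x t \<omega>
    assume U: "open U" "cball x t \<subseteq> U" "0 \<le> t" "g \<in> C_open 0 U"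
      and w: "\<forall>is y. length is = 0 \<longrightarrow> y \<in> cball x t \<longrightarrow> \<bar>D_multi is g y - D_multi is g x\<bar> \<le> \<omega>"
    have cg: "continuous_on (cball x t) g" using U C_open_continuous[of g 0 U "[]"] by (auto intro: continuous_on_subset)
    have "av \<xi> t (\<lambda>y. g y - g x) x = av \<xi> t g x - av \<xi> t (\<lambda>y. g x) x"
      by (intro av_diff_right integrable_bump_mult[OF b] cg U integrable_mult_left bump_integrable[OF b])
    also have "av \<xi> t (\<lambda>y. g x) x = 0" using z by (simp add: av_def)
    finally have "av \<xi> t g x = av \<xi> t (\<lambda>y. g y - g x) x" by simp
    moreover have "\<bar>av \<xi> t (\<lambda>y. g y - g x) x\<bar> \<le> (\<integral>z. \<bar>\<xi> z\<bar> \<partial>lborel) * \<omega>"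
      using w by (intro av_bound[OF b U(3)]) auto
    ultimately show "\<bar>av \<xi> t g x\<bar> \<le> (\<integral>z. \<bar>\<xi> z\<bar> \<partial>lborel) * t ^ 0 * \<omega>" by simp
  qed simp
next
  case (Suc m)
  then obtain \<eta> where eta: "\<xi> = (\<lambda>z. \<Sum>i\<in>UNIV. partial_deriv i (\<eta> i) z)" "\<And>i. \<eta> i \<in> deriv_bump (Suc m) (Suc N)"
    unfolding deriv_bump.simps(2)[of "Suc m"] by blast
  have b: "\<eta> i \<in> bump (Suc N)" for i using eta(2)[of i] deriv_bump_subset by blast
  have "\<forall>i. \<exists>C\<ge>0. \<forall>g U x t \<omega>. open U \<longrightarrow> cball x t \<subseteq> U \<longrightarrow> 0 \<le> t \<longrightarrow> g \<in> C_open m U \<longrightarrow>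
     (\<forall>is y. length is = m \<longrightarrow> y \<in> cball x t \<longrightarrow> \<bar>D_multi is g y - D_multi is g x\<bar> \<le> \<omega>) \<longrightarrow> \<bar>av (\<eta> i) t g x\<bar> \<le> C * t ^ m * \<omega>"
    using Suc.IH[OF eta(2)] by blast
  then obtain C where C0: "\<And>i. 0 \<le> C i" and C: "\<And>i g U x t \<omega>. open U \<Longrightarrow> cball x t \<subseteq> U \<Longrightarrow> 0 \<le> t \<Longrightarrow> g \<in> C_open m U \<Longrightarrow>
     (\<forall>is y. length is = m \<longrightarrow> y \<in> cball x t \<longrightarrow> \<bar>D_multi is g y - D_multi is g x\<bar> \<le> \<omega>) \<Longrightarrow> \<bar>av (\<eta> i) t g x\<bar> \<le> C i * t ^ m * \<omega>"
    by metis
  show ?case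
  proof (intro exI[of _ "\<Sum>i\<in>UNIV. C i"] conjI allI impI)
    show "0 \<le> (\<Sum>i\<in>UNIV. C i)" by (intro sum_nonneg C0)
    fix g :: "real^'a \<Rightarrow> real" and U x t \<omega>
    assume U: "open U" "cball x t \<subseteq> U" "0 \<le> t" "g \<in> C_open (Suc m) U"
      and w: "\<forall>is y. length is = Suc m \<longrightarrow> y \<in> cball x t \<longrightarrow> \<bar>D_multi is g y - D_multi is g x\<bar> \<le> \<omega>"
    have cg: "continuous_on U g" using U C_open_continuous[of g "Suc m" U "[]"] by auto
    have "av \<xi> t g x = (\<Sum>i\<in>UNIV. av (partial_deriv i (\<eta> i)) t g x)"
      unfolding eta(1) by (intro av_sum integrable_bump_mult[OF bump_pd[OF b]] continuous_on_subset[OF cg] U)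
    also have "\<dots> = (\<Sum>i\<in>UNIV. - t * av (\<eta> i) t (partial_deriv i g) x)"
      using C_open_has_pd[OF U(4), of "[]"] C_open_continuous[OF U(4), of "[_]"]
      by (intro sum.cong refl av_partial[OF b U(1-3) _ cg]) auto
    also have "\<bar>\<dots>\<bar> \<le> (\<Sum>i\<in>UNIV. t * (C i * t ^ m * \<omega>))"
    proof (rule order_trans[OF sum_abs sum_mono])
      fix i
      have "\<bar>D_multi is (partial_deriv i g) y - D_multi is (partial_deriv i g) x\<bar> \<le> \<omega>" if "length is = m" "y \<in> cball x t" for "is" y
        using w[rule_format, of "is @ [i]" y] that by (simp add: D_multi_append)
      then have "\<bar>av (\<eta> i) t (partial_deriv i g) x\<bar> \<le> C i * t ^ m * \<omega>"
        by (intro C[OF U(1-3) C_open_pd[OF U(4)]]) auto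
      then show "\<bar>- t * av (\<eta> i) t (partial_deriv i g) x\<bar> \<le> t * (C i * t ^ m * \<omega>)"
        using U(3) by (simp add: abs_mult mult_left_mono)
    qed
    finally show "\<bar>av \<xi> t g x\<bar> \<le> (\<Sum>i\<in>UNIV. C i) * t ^ Suc m * \<omega>"
      by (simp add: sum_distrib_left sum_distrib_right mult_ac)
  qed
qed

lemma Lipschitz_from_partials:
  fixes h :: "real^'n::finite \<Rightarrow> real"
  assumes U: "open U" and S: "convex S" "S \<subseteq> U" and pd: "\<And>i p. p \<in> U \<Longrightarrow> has_pd i h p (D i p)"
    and cont: "\<And>i. continuous_on U (D i)" and B: "\<And>i p. p \<in> S \<Longrightarrow> \<bar>D i p\<bar> \<le> B" and pq: "p \<in> S" "q \<in> S"
  shows "\<bar>h p - h q\<bar> \<le> real CARD('n) * B * norm (p - q)"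
proof -
  let ?p = "\<lambda>\<theta>. q + \<theta> *\<^sub>R (p - q)"
  have inS: "?p \<theta> \<in> S" if "\<theta> \<in> {0..1}" for \<theta>
    using convexD_alt[OF S(1) pq(2,1), of \<theta>] that by (simp add: algebra_simps)
  have "norm (h (?p 1) - h (?p 0)) \<le> (real CARD('n) * B * norm (p - q)) * norm (1 - 0 :: real)"
  proof (rule field_differentiable_bound[where S="{0..1}" and f="\<lambda>\<theta>. h (?p \<theta>)" and f'="\<lambda>\<theta>. \<Sum>i\<in>UNIV. (p - q) $ i * D i (?p \<theta>)"])
    fix \<theta> :: real assume th: "\<theta> \<in> {0..1}"
    show "((\<lambda>\<theta>. h (?p \<theta>)) has_field_derivative (\<Sum>i\<in>UNIV. (p - q) $ i * D i (?p \<theta>))) (at \<theta> within {0..1})"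
      by (rule has_field_derivative_at_within, rule DERIV_along_line[OF U _ pd cont]) (use inS[OF th] S in auto)
    have "norm (\<Sum>i\<in>UNIV. (p - q) $ i * D i (?p \<theta>)) \<le> (\<Sum>i\<in>(UNIV::'n set). norm (p - q) * B)"
      unfolding real_norm_def
      by (rule order_trans[OF sum_abs sum_mono])
         (use B inS[OF th] component_le_norm_cart[of "p - q"] in \<open>auto simp: abs_mult intro!: mult_mono\<close>)
    then show "norm (\<Sum>i\<in>UNIV. (p - q) $ i * D i (?p \<theta>)) \<le> real CARD('n) * B * norm (p - q)"
      by (simp add: mult_ac)
  qed auto
  then show ?thesis by simp
qed

text \<open>The function g(x + \<theta> y) + g(x - \<theta> y) is differentiated once in \<theta>.
  Its derivative pairs \<open>y\<close> with the difference of the gradient at two points at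
  distance 2 \<theta> |y|, and a bound on the second derivatives makes that difference
  Lipschitz.\<close>

lemma second_difference_bound:
  fixes g :: "real^'n::finite \<Rightarrow> real"
  assumes U: "open U" "cball x d \<subseteq> U" and g: "g \<in> C_open 2 U"
    and B: "\<And>i j p. p \<in> cball x d \<Longrightarrow> \<bar>D_multi [i, j] g p\<bar> \<le> B" and y: "norm y \<le> d"
  shows "\<bar>2 * g x - g (x + y) - g (x - y)\<bar> \<le> 2 * (real CARD('n))\<^sup>2 * B * (norm y)\<^sup>2"
proof -
  let ?f = "\<lambda>\<theta>. g (x + \<theta> *\<^sub>R y) + g (x + \<theta> *\<^sub>R (- y))"
  let ?D = "\<lambda>i. D_multi [i] g"
  have inb: "x + \<theta> *\<^sub>R y \<in> cball x d" "x + \<theta> *\<^sub>R (- y) \<in> cball x d" if "\<theta> \<in> {0..1}" for \<theta>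
    using mult_mono[of \<theta> 1 "norm y" d] that y by (auto simp: dist_norm)
  have pd: "has_pd i g p (?D i p)" if "p \<in> U" for i p
    using C_open_has_pd[OF g, of "[]" p i] that by simp
  have cont: "continuous_on U (?D i)" for i using C_open_continuous[OF g, of "[i]"] by simp
  have "norm (?f 1 - ?f 0) \<le> (2 * (real CARD('n))\<^sup>2 * B * (norm y)\<^sup>2) * norm (1 - 0 :: real)"
  proof (rule field_differentiable_bound[where S="{0..1}" and f="?f" and
      f'="\<lambda>\<theta>. (\<Sum>i\<in>UNIV. y $ i * ?D i (x + \<theta> *\<^sub>R y)) + (\<Sum>i\<in>UNIV. (- y) $ i * ?D i (x + \<theta> *\<^sub>R (- y)))"])
    fix \<theta> :: real assume th: "\<theta> \<in> {0..1}"
    show "(?f has_field_derivative (\<Sum>i\<in>UNIV. y $ i * ?D i (x + \<theta> *\<^sub>R y)) + (\<Sum>i\<in>UNIV. (- y) $ i * ?D i (x + \<theta> *\<^sub>R (- y)))) (at \<theta> within {0..1})"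
      by (rule has_field_derivative_at_within, intro DERIV_add; rule DERIV_along_line[OF U(1) _ pd cont]) (use inb[OF th] U(2) in auto)
    have lip: "\<bar>?D i (x + \<theta> *\<^sub>R y) - ?D i (x + \<theta> *\<^sub>R (- y))\<bar> \<le> real CARD('n) * B * (2 * norm y)" for i
    proof -
      have "\<bar>?D i (x + \<theta> *\<^sub>R y) - ?D i (x + \<theta> *\<^sub>R (- y))\<bar> \<le> real CARD('n) * B * norm ((x + \<theta> *\<^sub>R y) - (x + \<theta> *\<^sub>R (- y)))"
        by (rule Lipschitz_from_partials[OF U(1) convex_cball U(2), where D="\<lambda>j. D_multi [j, i] g"])
           (use C_open_has_pd[OF g, of "[i]"] C_open_continuous[OF g, of "[_, i]"] B inb[OF th] in auto)
      also have "(x + \<theta> *\<^sub>R y) - (x + \<theta> *\<^sub>R (- y)) = (2 * \<theta>) *\<^sub>R y" by (simp add: algebra_simps flip: scaleR_2)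
      also have "norm ((2 * \<theta>) *\<^sub>R y) \<le> 2 * norm y" using th by (simp add: mult_left_le_one_le)
      moreover have "0 \<le> B" using B[of x] y norm_ge_zero[of y] by (force intro: order_trans[OF abs_ge_zero])
      ultimately show ?thesis by (meson mult_left_mono mult_nonneg_nonneg of_nat_0_le_iff order_trans)
    qed
    have "(\<Sum>i\<in>UNIV. y $ i * ?D i (x + \<theta> *\<^sub>R y)) + (\<Sum>i\<in>UNIV. (- y) $ i * ?D i (x + \<theta> *\<^sub>R (- y)))
      = (\<Sum>i\<in>UNIV. y $ i * (?D i (x + \<theta> *\<^sub>R y) - ?D i (x + \<theta> *\<^sub>R (- y))))"
      by (simp add: algebra_simps sum_negf sum_subtractf)
    also have "\<bar>\<dots>\<bar> \<le> (\<Sum>i\<in>(UNIV::'n set). norm y * (real CARD('n) * B * (2 * norm y)))"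
      by (rule order_trans[OF sum_abs sum_mono])
         (unfold abs_mult, intro mult_mono lip component_le_norm_cart norm_ge_zero abs_ge_zero)
    also have "\<dots> = 2 * (real CARD('n))\<^sup>2 * B * (norm y)\<^sup>2" by (simp add: power2_eq_square)
    finally show "norm ((\<Sum>i\<in>UNIV. y $ i * ?D i (x + \<theta> *\<^sub>R y)) + (\<Sum>i\<in>UNIV. (- y) $ i * ?D i (x + \<theta> *\<^sub>R (- y)))) \<le> 2 * (real CARD('n))\<^sup>2 * B * (norm y)\<^sup>2"
      by simp
  qed auto
  then show ?thesis by (simp add: abs_minus_commute algebra_simps)
qed

section \<open>The fractional Laplacian as a superposition of averages\<close>

lemma has_bochner_integral_powr_to_inf:
  fixes A b :: real
  assumes "0 < A" "0 < b"
  shows "has_bochner_integral lborel (\<lambda>t. indicator {A..} t * t powr (- 1 - b)) (A powr (- b) / b)"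
proof (rule has_bochner_integral_nn_integral)
  have "((\<lambda>t. t powr (- 1 - b)) has_integral - (A powr (- 1 - b + 1)) / (- 1 - b + 1)) {A..}"
    by (rule has_integral_powr_to_inf) (use assms in auto)
  then show "(\<integral>\<^sup>+ t. ennreal (indicator {A..} t * t powr (- 1 - b)) \<partial>lborel) = ennreal (A powr (- b) / b)"
    by (subst nn_integral_has_integral_lebesgue[where \<Omega>="{A..}"]) auto
qed (use assms in auto)

lemma has_bochner_integral_powr_from_0:
  fixes A b :: real
  assumes "0 \<le> A" "0 < b"
  shows "has_bochner_integral lborel (\<lambda>t. indicator {0..A} t * t powr (b - 1)) (A powr b / b)"
proof (rule has_bochner_integral_nn_integral)
  have "((\<lambda>t. t powr (b - 1)) has_integral (A powr (b - 1 + 1)) / (b - 1 + 1)) {0..A}"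
    by (rule has_integral_powr_from_0) (use assms in auto)
  then show "(\<integral>\<^sup>+ t. ennreal (indicator {0..A} t * t powr (b - 1)) \<partial>lborel) = ennreal (A powr b / b)"
    by (subst nn_integral_has_integral_lebesgue[where \<Omega>="{0..A}"]) auto
qed (use assms in auto)

lemma lborel_integral_reflect:
  fixes f :: "'a::euclidean_space \<Rightarrow> real"
  assumes "f \<in> borel_measurable borel"
  shows "(\<integral>y. f (- y) \<partial>lborel) = (\<integral>y. f y \<partial>lborel)"
    and "integrable lborel (\<lambda>y. f (- y)) \<longleftrightarrow> integrable lborel f"
  using lborel_integral_affine[OF assms, of "-1" 0] by auto

lemma loc_int_absI: "loc_int v \<Longrightarrow> loc_int (\<lambda>q. \<bar>v q\<bar>)"
  using loc_int_abs[of v] by (auto simp: loc_int_def)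

lemma weighted_imp_loc_int:
  fixes v :: "real^'n::finite \<Rightarrow> real"
  assumes [measurable]: "v \<in> borel_measurable borel" and w: "integrable lborel (\<lambda>y. \<bar>v y\<bar> / (1 + norm y powr a))" and a: "0 \<le> a"
  shows "loc_int v"
  unfolding loc_int_def
proof (intro conjI allI)
  fix R :: real
  show "integrable lborel (\<lambda>q. indicator (cball 0 R) q * v q)"
  proof (rule Bochner_Integration.integrable_bound[OF integrable_mult_right[OF w, of "1 + \<bar>R\<bar> powr a"]])
    show "AE q in lborel. norm (indicator (cball 0 R) q * v q) \<le> norm ((1 + \<bar>R\<bar> powr a) * (\<bar>v q\<bar> / (1 + norm q powr a)))"
    proof (intro AE_I2)
      fix q :: "real^'n"
      show "norm (indicator (cball 0 R) q * v q) \<le> norm ((1 + \<bar>R\<bar> powr a) * (\<bar>v q\<bar> / (1 + norm q powr a)))"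
      proof (cases "norm q \<le> R")
        case True
        then have "norm q powr a \<le> \<bar>R\<bar> powr a" using a by (intro powr_mono2) auto
        then have "\<bar>v q\<bar> * (1 + norm q powr a) \<le> \<bar>v q\<bar> * (1 + \<bar>R\<bar> powr a)" by (intro mult_left_mono) auto
        moreover have "0 < 1 + norm q powr a" by (simp add: add_pos_nonneg)
        ultimately have "\<bar>v q\<bar> \<le> (1 + \<bar>R\<bar> powr a) * (\<bar>v q\<bar> / (1 + norm q powr a))" by (simp add: field_simps)
        then show ?thesis using True by (simp add: abs_mult)
      qed simp
    qed
    have "(\<lambda>q. indicator (cball 0 R) q * v q) \<in> borel_measurable borel"
      by (intro borel_measurable_times borel_measurable_indicator assms(1)) simp
    then show "(\<lambda>q. indicator (cball 0 R) q * v q) \<in> borel_measurable lborel" by simp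
  qed
qed simp

text \<open>Fubini: a point \<open>q\<close> enters the ball of radius 1 + t when t >= |q| - 1, so
  for fixed \<open>q\<close> the integral in \<open>t\<close> runs over t >= \<open>?A q\<close> and
  equals \<open>?A q\<close> to the power -a, divided by \<open>a\<close>. This is comparable to 1 /
  (1 + |q|^a).\<close>

lemma mass_weight_integrable:
  fixes v :: "real^'n::finite \<Rightarrow> real"
  assumes [measurable]: "v \<in> borel_measurable borel" and w: "integrable lborel (\<lambda>y. \<bar>v y\<bar> / (1 + norm y powr a))"
    and a: "0 < a" and d: "0 < d"
  shows "integrable lborel (\<lambda>t. indicator {d..} t * (t powr (- 1 - a) * mass v (1 + t)))"
proof -
  let ?f = "\<lambda>q t. indicator {d..} t * (t powr (- 1 - a) * ((if norm q \<le> 1 + t then 1 else 0) * \<bar>v q\<bar>))"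
  let ?A = "\<lambda>q::real^'n. max d (norm q - 1)"
  have A: "0 < ?A q" for q using d by simp
  have eq: "?f q t = \<bar>v q\<bar> * (indicator {?A q..} t * t powr (- 1 - a))" for q t
    by (auto simp: indicator_def)
  have val: "has_bochner_integral lborel (?f q) (\<bar>v q\<bar> * (?A q powr (- a) / a))" for q
    unfolding eq by (intro has_bochner_integral_mult_right has_bochner_integral_powr_to_inf A a)
  \<comment> \<open>The two summands come from |q| <= (1 + 1/d) \<open>?A q\<close> and 1 <= (1/d)
    \<open>?A q\<close>, each raised to the power \<open>a\<close>.\<close>
  let ?C = "((1 + 1 / d) powr a + (1 / d) powr a) / a"
  have int: "integrable (lborel \<Otimes>\<^sub>M lborel) (case_prod ?f)"
  proof (rule lborel_pair.Fubini_integrable)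
    show "case_prod ?f \<in> borel_measurable (lborel \<Otimes>\<^sub>M lborel)" by measurable
    show "AE q in lborel. integrable lborel (\<lambda>t. case_prod ?f (q, t))"
      using val by (auto simp: has_bochner_integral_iff)
    have "(\<integral>t. norm (case_prod ?f (q, t)) \<partial>lborel) = \<bar>v q\<bar> * (?A q powr (- a) / a)" for q
      using has_bochner_integral_integral_eq[OF val[of q]] by simp
    moreover have "integrable lborel (\<lambda>q. \<bar>v q\<bar> * (?A q powr (- a) / a))"
    proof (rule Bochner_Integration.integrable_bound[OF integrable_mult_right[OF w, of ?C]])
      show "AE q in lborel. norm (\<bar>v q\<bar> * (?A q powr (- a) / a)) \<le> norm (?C * (\<bar>v q\<bar> / (1 + norm q powr a)))"
      proof (intro AE_I2)
        fix q :: "real^'n"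
        have "norm q \<le> ?A q + 1" by simp
        also have "\<dots> \<le> (1 + 1 / d) * ?A q" using d by (simp add: field_simps)
        finally have "norm q powr a \<le> ((1 + 1 / d) * ?A q) powr a" using a by (intro powr_mono2) auto
        then have 1: "norm q powr a \<le> (1 + 1 / d) powr a * ?A q powr a" using d A[of q] by (subst (asm) powr_mult) auto
        have "1 powr a \<le> ((1 / d) * ?A q) powr a" using d a by (intro powr_mono2) (auto simp: field_simps)
        then have 2: "1 \<le> (1 / d) powr a * ?A q powr a" using d A[of q] by (subst (asm) powr_mult) auto
        have "1 + norm q powr a \<le> ((1 + 1 / d) powr a + (1 / d) powr a) * ?A q powr a" using 1 2 by (simp add: distrib_right)
        moreover have "0 < 1 + norm q powr a" by (simp add: add_pos_nonneg)
        ultimately have "?A q powr (- a) \<le> ((1 + 1 / d) powr a + (1 / d) powr a) / (1 + norm q powr a)"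
          using A[of q] by (simp add: powr_minus field_simps)
        then have "\<bar>v q\<bar> / a * ?A q powr (- a) \<le> \<bar>v q\<bar> / a * (((1 + 1 / d) powr a + (1 / d) powr a) / (1 + norm q powr a))"
          using a by (intro mult_left_mono) auto
        then have "\<bar>v q\<bar> * (?A q powr (- a) / a) \<le> ?C * (\<bar>v q\<bar> / (1 + norm q powr a))"
          by (simp add: mult_ac)
        then show "norm (\<bar>v q\<bar> * (?A q powr (- a) / a)) \<le> norm (?C * (\<bar>v q\<bar> / (1 + norm q powr a)))"
          using a by (simp add: abs_mult)
      qed
    qed measurable
    ultimately show "integrable lborel (\<lambda>q. \<integral>t. norm (case_prod ?f (q, t)) \<partial>lborel)" by simp
  qed
  have "integrable lborel (\<lambda>t. \<integral>q. ?f q t \<partial>lborel)"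
    by (rule lborel_pair.integrable_snd[OF int])
  moreover have "(\<integral>q. ?f q t \<partial>lborel) = indicator {d..} t * (t powr (- 1 - a) * mass v (1 + t))" for t
  proof -
    have "(\<integral>q. (if norm q \<le> 1 + t then 1 else 0) * \<bar>v q\<bar> \<partial>lborel) = mass v (1 + t)"
      unfolding mass_def by (intro Bochner_Integration.integral_cong) (auto simp: indicator_def)
    then show ?thesis by simp
  qed
  ultimately show ?thesis by (simp only:)
qed

text \<open>The integral over all scales of t^(-1-a) times the bump dilated by \<open>t\<close>,
  taken at a point of norm 1. By homogeneity this single value determines the integral at every
  nonzero point.\<close>

definition riesz_const :: "real \<Rightarrow> nat \<Rightarrow> real" where
  "riesz_const a k = (\<integral>t. indicator {0<..} t * (t powr (- 1 - a) * (max 0 (1 - 1 / t\<^sup>2)) ^ k) \<partial>lborel)"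

lemma riesz_const:
  assumes a: "0 < a" and k: "0 < k"
  shows "integrable lborel (\<lambda>t. indicator {0<..} t * (t powr (- 1 - a) * (max 0 (1 - 1 / t\<^sup>2)) ^ k))" (is "integrable _ ?f")
    and "0 < riesz_const a k"
proof -
  have le: "?f t \<le> indicator {1..} t * t powr (- 1 - a)" for t
  proof (cases "1 \<le> t")
    case True
    then have "(max 0 (1 - 1 / t\<^sup>2)) ^ k \<le> 1" by (intro power_le_one) auto
    then show ?thesis using True by (simp add: mult_left_le)
  next
    case False
    have "(max 0 (1 - 1 / t\<^sup>2)) ^ k = 0" if "0 < t"
    proof -
      have "t\<^sup>2 \<le> 1" using that False by (intro power_le_one) auto
      then have "1 - 1 / t\<^sup>2 \<le> 0" using that by (simp add: field_simps)
      then show ?thesis using k by (simp add: max_def)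
    qed
    then show ?thesis using False k by (auto simp: indicator_def power_0_left)
  qed
  show int: "integrable lborel ?f"
    by (rule Bochner_Integration.integrable_bound[where f="\<lambda>t. indicator {1..} t * t powr (- 1 - a)"])
       (use has_bochner_integral_powr_to_inf[of 1 a] a le in \<open>auto simp: has_bochner_integral_iff abs_mult intro!: AE_I2\<close>)
  have "(\<integral>t. (3 / 4) ^ k * (indicator {2..} t * t powr (- 1 - a)) \<partial>lborel) \<le> riesz_const a k"
    unfolding riesz_const_def
  proof (rule integral_mono[OF _ int])
    show "integrable lborel (\<lambda>t. (3 / 4) ^ k * (indicator {2..} t * t powr (- 1 - a)) :: real)"
      using has_bochner_integral_powr_to_inf[of 2 a] a by (intro integrable_mult_right) (auto simp: has_bochner_integral_iff)
    show "(3 / 4) ^ k * (indicator {2..} t * t powr (- 1 - a)) \<le> ?f t" for t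
    proof (cases "2 \<le> t")
      case True
      have "4 \<le> t\<^sup>2" using power_mono[OF True, of 2] by simp
      then have "3 / 4 \<le> 1 - 1 / t\<^sup>2" using True by (simp add: field_simps)
      then have "(3 / 4) ^ k \<le> (max 0 (1 - 1 / t\<^sup>2)) ^ k" by (intro power_mono) auto
      then show ?thesis using True by (simp add: mult.commute mult_left_mono)
    qed simp
  qed
  moreover have "(\<integral>t. (3 / 4) ^ k * (indicator {2..} t * t powr (- 1 - a)) \<partial>lborel) = (3 / 4) ^ k * (2 powr (- a) / a)"
    using has_bochner_integral_integral_eq[OF has_bochner_integral_powr_to_inf[of 2 a]] a by simp
  moreover have "0 < (3 / 4) ^ k * (2 powr (- a) / a)" using a by simp
  ultimately show "0 < riesz_const a k" by linarith
qed

text \<open>The substitution t = |y| t' reduces everything to the case |y| = 1.\<close>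

lemma riesz_scaling:
  fixes y :: "real^'n::finite"
  assumes a: "0 < a" and k: "0 < k" and y: "y \<noteq> 0"
  shows "has_bochner_integral lborel (\<lambda>t. indicator {0<..} t * (t powr (- 1 - a) * (max 0 (1 - (inverse t *\<^sub>R y) \<bullet> (inverse t *\<^sub>R y))) ^ k))
     (norm y powr (- a) * riesz_const a k)"
proof -
  let ?f = "\<lambda>t. indicator {0<..} t * (t powr (- 1 - a) * (max 0 (1 - (inverse t *\<^sub>R y) \<bullet> (inverse t *\<^sub>R y))) ^ k) :: real"
  let ?g = "\<lambda>t. indicator {0<..} t * (t powr (- 1 - a) * (max 0 (1 - 1 / t\<^sup>2)) ^ k) :: real"
  have n: "0 < norm y" using y by simp
  have eq: "?f (0 + norm y * t) = norm y powr (- 1 - a) * ?g t" for t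
  proof (cases "0 < t")
    case True
    have "(inverse (norm y * t) *\<^sub>R y) \<bullet> (inverse (norm y * t) *\<^sub>R y) = (inverse (norm y * t))\<^sup>2 * (y \<bullet> y)"
      by (simp add: power2_eq_square)
    also have "\<dots> = 1 / t\<^sup>2" using n True by (simp add: dot_square_norm power_mult_distrib field_simps)
    finally show ?thesis using True n by (simp add: powr_mult)
  next
    case False
    then have "\<not> 0 < norm y * t" using n by (simp add: zero_less_mult_iff)
    then show ?thesis using False by simp
  qed
  have "integrable lborel (\<lambda>t. ?f (0 + norm y * t))"
    unfolding eq by (intro integrable_mult_right riesz_const(1) a k)
  then have "integrable lborel ?f" using lborel_integrable_real_affine_iff[of "norm y" ?f 0] n by simp
  moreover have "(\<integral>t. ?f t \<partial>lborel) = norm y powr (- a) * riesz_const a k"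
  proof -
    have "(\<integral>t. ?f t \<partial>lborel) = \<bar>norm y\<bar> *\<^sub>R (\<integral>t. ?f (0 + norm y * t) \<partial>lborel)"
      by (rule lborel_integral_real_affine) (use n in simp)
    also have "(\<integral>t. ?f (0 + norm y * t) \<partial>lborel) = norm y powr (- 1 - a) * riesz_const a k"
      unfolding eq riesz_const_def by simp
    also have "\<bar>norm y\<bar> *\<^sub>R (norm y powr (- 1 - a) * riesz_const a k) = (norm y powr 1 * norm y powr (- 1 - a)) * riesz_const a k"
      using n by simp
    also have "norm y powr 1 * norm y powr (- 1 - a) = norm y powr (- a)"
      by (subst powr_add[symmetric]) simp
    finally show ?thesis .
  qed
  ultimately show ?thesis by (simp add: has_bochner_integral_iff)
qed

text \<open>\<open>|y|^(-a)\<close> is, up to a constant, the integral over \<open>t\<close> of \<open>t^(-1-a)\<close> times the bump dilated by \<open>t\<close>.\<close>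

lemma riesz_representation:
  fixes q :: "real^'n::finite \<Rightarrow> real"
  assumes a: "0 < a" and k: "0 < k" and [measurable]: "q \<in> borel_measurable borel" and q0: "q 0 = 0"
    and int: "\<And>t. 0 < t \<Longrightarrow> integrable lborel (\<lambda>y. (max 0 (1 - (inverse t *\<^sub>R y) \<bullet> (inverse t *\<^sub>R y))) ^ k * q y)"
    and D: "integrable lborel D" "\<And>t. 0 < t \<Longrightarrow> t powr (- 1 - a) * (\<integral>y. \<bar>(max 0 (1 - (inverse t *\<^sub>R y) \<bullet> (inverse t *\<^sub>R y))) ^ k * q y\<bar> \<partial>lborel) \<le> D t"
  shows "integrable lborel (\<lambda>y. q y * norm y powr (- a))"
    and "riesz_const a k * (\<integral>y. q y * norm y powr (- a) \<partial>lborel) =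
      (\<integral>t. indicator {0<..} t * (t powr (- 1 - a) * (\<integral>y. (max 0 (1 - (inverse t *\<^sub>R y) \<bullet> (inverse t *\<^sub>R y))) ^ k * q y \<partial>lborel)) \<partial>lborel)"
proof -
  let ?p = "\<lambda>t y. (max 0 (1 - (inverse t *\<^sub>R y) \<bullet> (inverse t *\<^sub>R y))) ^ k :: real"
  let ?f = "\<lambda>t y. indicator {0<..} t * (t powr (- 1 - a) * (?p t y * q y))"
  have meas: "case_prod ?f \<in> borel_measurable (lborel \<Otimes>\<^sub>M lborel)" by measurable
  have fint: "integrable (lborel \<Otimes>\<^sub>M lborel) (case_prod ?f)"
  proof (rule lborel_pair.Fubini_integrable[OF meas])
    show "AE t in lborel. integrable lborel (\<lambda>y. case_prod ?f (t, y))"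
    proof (intro AE_I2)
      fix t :: real
      show "integrable lborel (\<lambda>y. case_prod ?f (t, y))"
        using int[of t] by (cases "0 < t") auto
    qed
    show "integrable lborel (\<lambda>t. \<integral>y. norm (case_prod ?f (t, y)) \<partial>lborel)"
    proof (rule Bochner_Integration.integrable_bound[OF D(1)])
      show "(\<lambda>t. \<integral>y. norm (case_prod ?f (t, y)) \<partial>lborel) \<in> borel_measurable lborel"
        using meas by (intro lborel.borel_measurable_lebesgue_integral) auto
      show "AE t in lborel. norm (\<integral>y. norm (case_prod ?f (t, y)) \<partial>lborel) \<le> norm (D t)"
      proof (intro AE_I2)
        fix t :: real
        have nn: "0 \<le> (\<integral>y. \<bar>?p t y * q y\<bar> \<partial>lborel)" by simp
        show "norm (\<integral>y. norm (case_prod ?f (t, y)) \<partial>lborel) \<le> norm (D t)"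
        proof (cases "0 < t")
          case True
          have "(\<integral>y. norm (case_prod ?f (t, y)) \<partial>lborel) = t powr (- 1 - a) * (\<integral>y. \<bar>?p t y * q y\<bar> \<partial>lborel)"
            using True by (simp add: abs_mult)
          then show ?thesis using D(2)[OF True] nn by simp
        qed simp
      qed
    qed
  qed
  have eq: "(\<integral>t. ?f t y \<partial>lborel) = riesz_const a k * (q y * norm y powr (- a))" for y
  proof (cases "y = 0")
    case False
    have "(\<integral>t. ?f t y \<partial>lborel) = (\<integral>t. (indicator {0<..} t * (t powr (- 1 - a) * ?p t y)) * q y \<partial>lborel)"
      by (simp add: mult_ac)
    also have "\<dots> = (norm y powr (- a) * riesz_const a k) * q y"
      using has_bochner_integral_integral_eq[OF riesz_scaling[OF a k False]] by simp
    finally show ?thesis by (simp add: mult_ac)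
  qed (simp add: q0)
  have K: "0 < riesz_const a k" by (rule riesz_const(2)[OF a k])
  have "integrable lborel (\<lambda>y. \<integral>t. ?f t y \<partial>lborel)" by (rule lborel_pair.integrable_snd[OF fint])
  then show "integrable lborel (\<lambda>y. q y * norm y powr (- a))" unfolding eq using K by simp
  have "(\<integral>y. \<integral>t. ?f t y \<partial>lborel \<partial>lborel) = (\<integral>t. \<integral>y. ?f t y \<partial>lborel \<partial>lborel)"
    by (rule lborel_pair.Fubini_integral[OF fint])
  then show "riesz_const a k * (\<integral>y. q y * norm y powr (- a) \<partial>lborel) =
      (\<integral>t. indicator {0<..} t * (t powr (- 1 - a) * (\<integral>y. ?p t y * q y \<partial>lborel)) \<partial>lborel)"
    unfolding eq by simp
qed

lemma integral_kernel_translate: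
  fixes g :: "real^'n::finite \<Rightarrow> real"
  assumes k: "\<kappa> \<in> bump N" and g: "loc_int g" and t: "0 < t"
  shows "has_bochner_integral lborel (\<lambda>y. \<kappa> (inverse t *\<^sub>R y) * g (x + y)) (t ^ CARD('n) * av \<kappa> t g x)"
proof -
  have [measurable]: "\<kappa> \<in> borel_measurable borel" "g \<in> borel_measurable borel" using k g by auto
  have m: "(\<lambda>y. \<kappa> (inverse t *\<^sub>R y) * g (x + y)) \<in> borel_measurable borel" by measurable
  show ?thesis
    using lborel_integral_affine[OF m, of t 0] integrable_bump_mult_loc[OF k g t, of x] t
    by (simp add: has_bochner_integral_iff av_def)
qed

lemma integral_kernel_reflect:
  fixes g :: "real^'n::finite \<Rightarrow> real"
  assumes k: "\<kappa> \<in> bump N" and even: "\<And>z. \<kappa> (- z) = \<kappa> z" and g: "loc_int g" and t: "0 < t"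
  shows "has_bochner_integral lborel (\<lambda>y. \<kappa> (inverse t *\<^sub>R y) * g (x - y)) (t ^ CARD('n) * av \<kappa> t g x)"
proof -
  have [measurable]: "\<kappa> \<in> borel_measurable borel" "g \<in> borel_measurable borel" using k g by auto
  have m: "(\<lambda>y. \<kappa> (inverse t *\<^sub>R y) * g (x + y)) \<in> borel_measurable borel" by measurable
  have "(\<lambda>y. \<kappa> (inverse t *\<^sub>R - y) * g (x + - y)) = (\<lambda>y. \<kappa> (inverse t *\<^sub>R y) * g (x - y))"
    using even by (simp add: fun_eq_iff)
  then show ?thesis
    using lborel_integral_reflect[OF m] integral_kernel_translate[OF k g t, of x]
    by (simp add: has_bochner_integral_iff)
qed

lemma C_open_bounded:
  assumes g: "g \<in> C_open k U" and sub: "cball x d \<subseteq> U"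
  obtains B where "0 < B" "\<And>is p. length is \<le> k \<Longrightarrow> p \<in> cball x d \<Longrightarrow> \<bar>D_multi is g p\<bar> \<le> B"
proof -
  let ?L = "{is :: 'a list. length is \<le> k}"
  have fin: "finite ?L" using finite_lists_length_le[of "UNIV :: 'a set" k] by simp
  have ex: "\<forall>is\<in>?L. \<exists>B. 0 < B \<and> (\<forall>p\<in>cball x d. \<bar>D_multi is g p\<bar> \<le> B)"
  proof
    fix "is" :: "'a list" assume "is \<in> ?L"
    then have "continuous_on (cball x d) (D_multi is g)"
      using continuous_on_subset[OF C_open_continuous[OF g] sub] by simp
    from continuous_cball_bounded[OF this] show "\<exists>B. 0 < B \<and> (\<forall>p\<in>cball x d. \<bar>D_multi is g p\<bar> \<le> B)"
      by metis
  qed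
  obtain B where "\<forall>is\<in>?L. 0 < B is \<and> (\<forall>p\<in>cball x d. \<bar>D_multi is g p\<bar> \<le> B is)"
    using bchoice[OF ex] by blast
  then have B: "\<And>is. is \<in> ?L \<Longrightarrow> 0 < B is" "\<And>is p. is \<in> ?L \<Longrightarrow> p \<in> cball x d \<Longrightarrow> \<bar>D_multi is g p\<bar> \<le> B is"
    by blast+
  have "\<bar>D_multi is g p\<bar> \<le> sum B ?L + 1" if "length is \<le> k" "p \<in> cball x d" for "is" p
  proof -
    have "B is \<le> sum B ?L" using that B fin by (intro member_le_sum) (auto intro: less_imp_le)
    then show ?thesis using B(2)[of "is" p] that by simp
  qed
  moreover have "0 \<le> sum B ?L" using B(1) by (intro sum_nonneg) (auto intro: less_imp_le)
  ultimately show ?thesis by (intro that[of "sum B ?L + 1"]) auto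
qed

lemma powr_mult_power: "0 < t \<Longrightarrow> t powr (- 1 - (real n + b)) * t ^ n = t powr (- 1 - b)"
  by (simp add: powr_realpow[symmetric] powr_add[symmetric])

text \<open>Symmetrising in y turns the principal value into half the absolutely convergent integral
  of the second difference S(y) against |y|^(-a). By \<open>riesz_representation\<close> this
  becomes an integral over scales of the bump tested against S, which is 2 t^n (I v(x) - av(x)),
  where I is the integral of the bump. The factor t^n lowers the exponent from a = n + 2 s to 2 s,
  and the 2 cancels the half. The exponent \<open>k\<close> stays free so that the smoothness of the
  bump can be chosen later.\<close>

lemma frac_laplacian_averages:
  fixes v :: "real^'n::finite \<Rightarrow> real"
  assumes a_def: "a = real CARD('n) + 2 * s"
    and s: "0 < s" "s < 1" and v[measurable]: "v \<in> borel_measurable borel"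
    and w: "integrable lborel (\<lambda>y. \<bar>v y\<bar> / (1 + norm y powr a))"
    and C2: "v \<in> C_open 2 U" and U: "open U" "x \<in> U" "norm x \<le> 1" and k: "0 < k"
  shows "frac_laplacian s v x = C_ns CARD('n) s / riesz_const a k *
    (\<integral>t. indicator {0<..} t * (t powr (- 1 - 2 * s) *
      (integral\<^sup>L lborel (\<lambda>z::real^'n. (max 0 (1 - z \<bullet> z)) ^ k) * v x - av (\<lambda>z. (max 0 (1 - z \<bullet> z)) ^ k) t v x)) \<partial>lborel)"
proof -
  let ?\<psi> = "\<lambda>z::real^'n. (max 0 (1 - z \<bullet> z)) ^ k :: real"
  let ?I = "integral\<^sup>L lborel ?\<psi>"
  have a: "0 < a" using s unfolding a_def by (simp add: add_pos_pos)
  have psi: "?\<psi> \<in> bump 0" by (rule bump.base[OF k])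
  have even: "?\<psi> (- z) = ?\<psi> z" for z by simp
  have psi_nn: "0 \<le> ?\<psi> z" for z by simp
  have psi1: "\<bar>?\<psi> z\<bar> \<le> 1 * indicator (cball 0 1) z" for z
  proof (cases "norm z \<le> 1")
    case True then show ?thesis by (auto intro!: power_le_one)
  qed (use bump_supp[OF psi, of z] k in \<open>simp add: power_0_left\<close>)
  have I0: "0 \<le> ?I" by simp
  have li: "loc_int v" using weighted_imp_loc_int[OF v w] a by simp
  have lia: "loc_int (\<lambda>q. \<bar>v q\<bar>)" by (rule loc_int_absI[OF li])
  have one: "loc_int (\<lambda>q::real^'n. 1 :: real)" by (intro continuous_imp_loc_int continuous_on_const)
  have I_t: "has_bochner_integral lborel (\<lambda>y. ?\<psi> (inverse t *\<^sub>R y)) (t ^ CARD('n) * ?I)" if "0 < t" for t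
    using integral_kernel_translate[OF psi one that, of 0] by (simp add: av_def)
  have vt: "\<bar>av ?\<psi> t (\<lambda>q. \<bar>v q\<bar>) x\<bar> \<le> 1 * inverse t ^ CARD('n) * mass (\<lambda>q. \<bar>v q\<bar>) (1 + t)" if "0 < t" for t
    using U(3) by (intro av_mass_bound[OF psi lia that psi1]) simp
  have abs_part: "t ^ CARD('n) * av ?\<psi> t (\<lambda>q. \<bar>v q\<bar>) x \<le> mass v (1 + t)" if "0 < t" for t
    using mult_left_mono[OF order_trans[OF abs_ge_self vt[OF that]], of "t ^ CARD('n)"] that
    by (simp add: mass_def power_inverse field_simps)
  \<comment> \<open>Near y = 0 the second difference is of order |y|^2, which suffices against
    |y|^(-n-2s) because s < 1; a first difference alone would not suffice for all s.\<close>
  define S where "S y = 2 * v x - v (x + y) - v (x - y)" for y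
  have Sm[measurable]: "S \<in> borel_measurable borel" unfolding S_def by measurable
  have Sint: "has_bochner_integral lborel (\<lambda>y. ?\<psi> (inverse t *\<^sub>R y) * S y) (2 * t ^ CARD('n) * (?I * v x - av ?\<psi> t v x))" if "0 < t" for t
  proof -
    have "has_bochner_integral lborel (\<lambda>y. 2 * v x * ?\<psi> (inverse t *\<^sub>R y) - ?\<psi> (inverse t *\<^sub>R y) * v (x + y) - ?\<psi> (inverse t *\<^sub>R y) * v (x - y))
       (2 * v x * (t ^ CARD('n) * ?I) - t ^ CARD('n) * av ?\<psi> t v x - t ^ CARD('n) * av ?\<psi> t v x)"
      by (intro has_bochner_integral_diff has_bochner_integral_mult_right I_t that integral_kernel_translate[OF psi li] integral_kernel_reflect[OF psi even li])
    then show ?thesis unfolding S_def by (simp add: algebra_simps)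
  qed
  obtain d where d: "0 < d" "cball x d \<subseteq> U" using U open_contains_cball by blast
  obtain B where B: "0 < B" "\<And>is p. length is \<le> 2 \<Longrightarrow> p \<in> cball x d \<Longrightarrow> \<bar>D_multi is v p\<bar> \<le> B"
    using C_open_bounded[OF C2 d(2)] by blast
  let ?K = "2 * (real CARD('n))\<^sup>2 * B"
  have Sb: "\<bar>S y\<bar> \<le> ?K * (norm y)\<^sup>2" if "norm y \<le> d" for y
    unfolding S_def by (rule second_difference_bound[OF U(1) d(2) C2 B(2) that]) auto
  have wl: "integrable lborel (\<lambda>t. indicator {\<epsilon>..} t * (t powr (- 1 - a) * mass v (1 + t)))" if "0 < \<epsilon>" for \<epsilon>
    by (rule mass_weight_integrable[OF v w a that])
  have pl: "integrable lborel (\<lambda>t. indicator {\<epsilon>..} t * t powr (- 1 - 2 * s))" if "0 < \<epsilon>" for \<epsilon>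
    using has_bochner_integral_powr_to_inf[OF that, of "2 * s"] s by (simp add: has_bochner_integral_iff)
  have p0: "integrable lborel (\<lambda>t. indicator {0..d} t * t powr (1 - 2 * s))"
    using has_bochner_integral_powr_from_0[of d "2 - 2 * s"] s d by (simp add: has_bochner_integral_iff)
  have tt: "t powr (- 1 - a) * t ^ CARD('n) = t powr (- 1 - 2 * s)" if "0 < t" for t
    unfolding a_def by (rule powr_mult_power[OF that])
  let ?p = "\<lambda>t (y::real^'n). (max 0 (1 - (inverse t *\<^sub>R y) \<bullet> (inverse t *\<^sub>R y))) ^ k :: real"
  have psi0: "?p t y = 0" if "0 < t" "t < norm y" for t and y :: "real^'n"
  proof -
    have "1 \<le> inverse t * norm y" using that by (simp add: field_simps)
    then show ?thesis using bump_supp[OF psi, of "inverse t *\<^sub>R y"] that by simp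
  qed
  \<comment> \<open>The majorant demanded by \<open>riesz_representation\<close>. Scales up to
    \<open>d\<close> use the quadratic bound on \<open>S\<close>, integrable since 1 - 2 s > -1.
    Larger scales use only the value \<open>v x\<close> and the weighted integrability of
    \<open>v\<close>.\<close>
  define D1 where "D1 t = ?K * ?I * (indicator {0..d} t * t powr (1 - 2 * s)) +
     2 * \<bar>v x\<bar> * ?I * (indicator {d..} t * t powr (- 1 - 2 * s)) + 2 * (indicator {d..} t * (t powr (- 1 - a) * mass v (1 + t)))" for t
  have D1i: "integrable lborel D1"
    unfolding D1_def using d by (intro Bochner_Integration.integrable_add integrable_mult_right p0 pl wl)
  have D1b: "t powr (- 1 - a) * (\<integral>y. \<bar>?p t y * S y\<bar> \<partial>lborel) \<le> D1 t" if t: "0 < t" for t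
  proof (cases "t \<le> d")
    case True
    have "(\<integral>y. \<bar>?p t y * S y\<bar> \<partial>lborel) \<le> (\<integral>y. ?p t y * (?K * t\<^sup>2) \<partial>lborel)"
    proof (rule integral_mono)
      show "integrable lborel (\<lambda>y. \<bar>?p t y * S y\<bar>)" using Sint[OF t] by (simp add: has_bochner_integral_iff)
      show "integrable lborel (\<lambda>y. ?p t y * (?K * t\<^sup>2))" using I_t[OF t] by (simp add: has_bochner_integral_iff)
      show "\<bar>?p t y * S y\<bar> \<le> ?p t y * (?K * t\<^sup>2)" for y
      proof (cases "norm y \<le> t")
        case y: True
        have "\<bar>S y\<bar> \<le> ?K * (norm y)\<^sup>2" using Sb y True by simp
        also have "\<dots> \<le> ?K * t\<^sup>2" using y B by (intro mult_left_mono power_mono) auto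
        finally show ?thesis by (simp add: abs_mult mult_left_mono)
      qed (use psi0[OF t, of y] k in \<open>simp add: power_0_left\<close>)
    qed
    also have "\<dots> = (t ^ CARD('n) * ?I) * (?K * t\<^sup>2)"
      using has_bochner_integral_integral_eq[OF I_t[OF t]] by simp
    finally have "t powr (- 1 - a) * (\<integral>y. \<bar>?p t y * S y\<bar> \<partial>lborel) \<le> t powr (- 1 - a) * ((t ^ CARD('n) * ?I) * (?K * t\<^sup>2))"
      by (intro mult_left_mono) auto
    also have "\<dots> = ?K * ?I * (t powr (- 1 - 2 * s) * t powr 2)"
      using tt[OF t] t by (simp add: mult_ac powr_numeral)
    also have "t powr (- 1 - 2 * s) * t powr 2 = t powr (1 - 2 * s)" by (simp add: powr_add[symmetric])
    also have "?K * ?I * t powr (1 - 2 * s) \<le> D1 t"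
      using True t I0 mass_nonneg[of v "1 + t"] by (simp add: D1_def)
    finally show ?thesis .
  next
    case False
    have i1: "has_bochner_integral lborel (\<lambda>y. 2 * \<bar>v x\<bar> * ?p t y + ?p t y * \<bar>v (x + y)\<bar> + ?p t y * \<bar>v (x - y)\<bar>)
       (2 * \<bar>v x\<bar> * (t ^ CARD('n) * ?I) + t ^ CARD('n) * av ?\<psi> t (\<lambda>q. \<bar>v q\<bar>) x + t ^ CARD('n) * av ?\<psi> t (\<lambda>q. \<bar>v q\<bar>) x)"
      by (intro has_bochner_integral_add has_bochner_integral_mult_right I_t t integral_kernel_translate[OF psi lia] integral_kernel_reflect[OF psi even lia])
    have "(\<integral>y. \<bar>?p t y * S y\<bar> \<partial>lborel) \<le> (\<integral>y. 2 * \<bar>v x\<bar> * ?p t y + ?p t y * \<bar>v (x + y)\<bar> + ?p t y * \<bar>v (x - y)\<bar> \<partial>lborel)"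
    proof (rule integral_mono)
      show "integrable lborel (\<lambda>y. \<bar>?p t y * S y\<bar>)" using Sint[OF t] by (simp add: has_bochner_integral_iff)
      show "integrable lborel (\<lambda>y. 2 * \<bar>v x\<bar> * ?p t y + ?p t y * \<bar>v (x + y)\<bar> + ?p t y * \<bar>v (x - y)\<bar>)" using i1 by (simp add: has_bochner_integral_iff)
      fix y
      have "\<bar>S y\<bar> \<le> 2 * \<bar>v x\<bar> + \<bar>v (x + y)\<bar> + \<bar>v (x - y)\<bar>" unfolding S_def by linarith
      then have "?p t y * \<bar>S y\<bar> \<le> ?p t y * (2 * \<bar>v x\<bar> + \<bar>v (x + y)\<bar> + \<bar>v (x - y)\<bar>)" by (intro mult_left_mono) auto
      then show "\<bar>?p t y * S y\<bar> \<le> 2 * \<bar>v x\<bar> * ?p t y + ?p t y * \<bar>v (x + y)\<bar> + ?p t y * \<bar>v (x - y)\<bar>"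
        by (simp add: abs_mult algebra_simps)
    qed
    also have "\<dots> \<le> 2 * \<bar>v x\<bar> * (t ^ CARD('n) * ?I) + 2 * mass v (1 + t)"
      using has_bochner_integral_integral_eq[OF i1] abs_part[OF t] by simp
    finally have "t powr (- 1 - a) * (\<integral>y. \<bar>?p t y * S y\<bar> \<partial>lborel) \<le> t powr (- 1 - a) * (2 * \<bar>v x\<bar> * (t ^ CARD('n) * ?I) + 2 * mass v (1 + t))"
      by (intro mult_left_mono) auto
    also have "\<dots> = 2 * \<bar>v x\<bar> * ?I * t powr (- 1 - 2 * s) + 2 * (t powr (- 1 - a) * mass v (1 + t))"
      unfolding tt[OF t, symmetric] by (simp add: algebra_simps)
    also have "\<dots> = D1 t" using False t by (simp add: D1_def)
    finally show ?thesis .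
  qed
  have S0: "S 0 = 0" by (simp add: S_def)
  note R1 = riesz_representation[OF a k Sm S0 _ D1i D1b]
  have Si: "integrable lborel (\<lambda>y. S y * norm y powr (- a))"
    by (rule R1(1)) (use Sint in \<open>auto simp: has_bochner_integral_iff\<close>)
  have "riesz_const a k * (\<integral>y. S y * norm y powr (- a) \<partial>lborel) =
      (\<integral>t. indicator {0<..} t * (t powr (- 1 - a) * (\<integral>y. ?p t y * S y \<partial>lborel)) \<partial>lborel)"
    by (rule R1(2)) (use Sint in \<open>auto simp: has_bochner_integral_iff\<close>)
  also have "\<dots> = (\<integral>t. 2 * (indicator {0<..} t * (t powr (- 1 - 2 * s) * (?I * v x - av ?\<psi> t v x))) \<partial>lborel)"
  proof (intro Bochner_Integration.integral_cong refl)
    fix t :: real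
    show "indicator {0<..} t * (t powr (- 1 - a) * (\<integral>y. ?p t y * S y \<partial>lborel)) = 2 * (indicator {0<..} t * (t powr (- 1 - 2 * s) * (?I * v x - av ?\<psi> t v x)))"
    proof (cases "0 < t")
      case True
      show ?thesis using True has_bochner_integral_integral_eq[OF Sint[OF True]] unfolding tt[OF True, symmetric] by simp
    qed simp
  qed
  finally have rep: "riesz_const a k * (\<integral>y. S y * norm y powr (- a) \<partial>lborel) =
     2 * (\<integral>t. indicator {0<..} t * (t powr (- 1 - 2 * s) * (?I * v x - av ?\<psi> t v x)) \<partial>lborel)"
    by (simp only: integral_mult_right_zero)
  let ?T = "\<lambda>\<epsilon>. LINT y:(- ball x \<epsilon>)|lebesgue. (v x - v y) / norm (x - y) powr a"
  have trunc: "?T \<epsilon> = (\<integral>y. indicator (- ball 0 \<epsilon>) y * (S y * norm y powr (- a)) \<partial>lborel) / 2" if e: "0 < \<epsilon>" for \<epsilon>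
  proof -
    \<comment> \<open>The first difference cut off below \<epsilon> vanishes on every dilated bump
      of scale below \<epsilon>, so \<open>riesz_representation\<close> applies and gives
      integrability of the truncated integrand. Only that part of it is used here; adding the
      reflection in y then produces \<open>S\<close>.\<close>
    define q where "q y = indicator (- ball 0 \<epsilon>) y * (v x - v (x + y))" for y
    have qm[measurable]: "q \<in> borel_measurable borel" unfolding q_def by measurable
    have q0: "q 0 = 0" using e by (simp add: q_def)
    define D2 where "D2 t = \<bar>v x\<bar> * ?I * (indicator {\<epsilon>..} t * t powr (- 1 - 2 * s)) + indicator {\<epsilon>..} t * (t powr (- 1 - a) * mass v (1 + t))" for t
    have D2i: "integrable lborel D2"
      unfolding D2_def using e by (intro Bochner_Integration.integrable_add integrable_mult_right pl wl)
    have i2: "has_bochner_integral lborel (\<lambda>y. \<bar>v x\<bar> * ?p t y + ?p t y * \<bar>v (x + y)\<bar>)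
       (\<bar>v x\<bar> * (t ^ CARD('n) * ?I) + t ^ CARD('n) * av ?\<psi> t (\<lambda>q. \<bar>v q\<bar>) x)" if t: "0 < t" for t
      by (intro has_bochner_integral_add has_bochner_integral_mult_right I_t t integral_kernel_translate[OF psi lia])
    have qb: "\<bar>?p t y * q y\<bar> \<le> \<bar>v x\<bar> * ?p t y + ?p t y * \<bar>v (x + y)\<bar>" for t y
    proof -
      have "\<bar>q y\<bar> \<le> \<bar>v x\<bar> + \<bar>v (x + y)\<bar>" unfolding q_def by (auto simp: indicator_def)
      then have "?p t y * \<bar>q y\<bar> \<le> ?p t y * (\<bar>v x\<bar> + \<bar>v (x + y)\<bar>)" by (intro mult_left_mono) auto
      then show ?thesis by (simp add: abs_mult algebra_simps)
    qed
    have qi: "integrable lborel (\<lambda>y. ?p t y * q y)" if t: "0 < t" for t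
    proof (rule Bochner_Integration.integrable_bound)
      show "integrable lborel (\<lambda>y. \<bar>v x\<bar> * ?p t y + ?p t y * \<bar>v (x + y)\<bar>)" using i2[OF t] by (simp add: has_bochner_integral_iff)
      show "AE y in lborel. norm (?p t y * q y) \<le> norm (\<bar>v x\<bar> * ?p t y + ?p t y * \<bar>v (x + y)\<bar>)"
        using qb by (intro AE_I2) (simp add: order_trans[OF qb abs_ge_self])
    qed measurable
    have D2b: "t powr (- 1 - a) * (\<integral>y. \<bar>?p t y * q y\<bar> \<partial>lborel) \<le> D2 t" if t: "0 < t" for t
    proof (cases "t < \<epsilon>")
      case True
      have "?p t y * q y = 0" for y
      proof (cases "norm y < \<epsilon>")
        case False then show ?thesis using psi0[OF t, of y] True by simp
      qed (simp add: q_def)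
      then have "(\<integral>y. \<bar>?p t y * q y\<bar> \<partial>lborel) = 0" by (simp only: abs_zero integral_zero)
      then show ?thesis using True by (simp add: D2_def)
    next
      case False
      have "(\<integral>y. \<bar>?p t y * q y\<bar> \<partial>lborel) \<le> (\<integral>y. \<bar>v x\<bar> * ?p t y + ?p t y * \<bar>v (x + y)\<bar> \<partial>lborel)"
        using i2[OF t] qi[OF t] qb by (intro integral_mono) (auto simp: has_bochner_integral_iff)
      also have "\<dots> \<le> \<bar>v x\<bar> * (t ^ CARD('n) * ?I) + mass v (1 + t)"
        using has_bochner_integral_integral_eq[OF i2[OF t]] abs_part[OF t] by simp
      finally have "t powr (- 1 - a) * (\<integral>y. \<bar>?p t y * q y\<bar> \<partial>lborel) \<le> t powr (- 1 - a) * (\<bar>v x\<bar> * (t ^ CARD('n) * ?I) + mass v (1 + t))"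
        by (intro mult_left_mono) auto
      also have "\<dots> = \<bar>v x\<bar> * ?I * t powr (- 1 - 2 * s) + t powr (- 1 - a) * mass v (1 + t)"
        unfolding tt[OF t, symmetric] by (simp add: algebra_simps)
      also have "\<dots> = D2 t" using False by (simp add: D2_def)
      finally show ?thesis .
    qed
    have qint: "integrable lborel (\<lambda>y. q y * norm y powr (- a))"
      by (rule riesz_representation(1)[OF a k qm q0 qi D2i D2b])
    let ?h = "\<lambda>y. q y * norm y powr (- a)"
    have hm: "?h \<in> borel_measurable borel" by measurable
    have "?T \<epsilon> = (\<integral>y. indicator (- ball x \<epsilon>) y * ((v x - v y) / norm (x - y) powr a) \<partial>lborel)"
      unfolding set_lebesgue_integral_def real_scaleR_def by (rule integral_completion) measurable
    also have "\<dots> = (\<integral>y. indicator (- ball x \<epsilon>) (x + y) * ((v x - v (x + y)) / norm (x - (x + y)) powr a) \<partial>lborel)"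
      by (rule lborel_integral_translate[symmetric])
    also have "\<dots> = (\<integral>y. ?h y \<partial>lborel)"
      by (intro Bochner_Integration.integral_cong refl) (auto simp: q_def indicator_def powr_minus divide_inverse dist_norm)
    finally have T: "?T \<epsilon> = (\<integral>y. ?h y \<partial>lborel)" .
    have "(\<integral>y. ?h y + ?h (- y) \<partial>lborel) = (\<integral>y. ?h y \<partial>lborel) + (\<integral>y. ?h (- y) \<partial>lborel)"
      using qint lborel_integral_reflect(2)[OF hm] by (intro Bochner_Integration.integral_add) auto
    also have "\<dots> = 2 * ?T \<epsilon>" unfolding T using lborel_integral_reflect(1)[OF hm] by simp
    also have "(\<integral>y. ?h y + ?h (- y) \<partial>lborel) = (\<integral>y. indicator (- ball 0 \<epsilon>) y * (S y * norm y powr (- a)) \<partial>lborel)"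
      by (intro Bochner_Integration.integral_cong refl) (auto simp: q_def S_def indicator_def algebra_simps)
    finally show ?thesis by simp
  qed
  have "((\<lambda>\<epsilon>. \<integral>y. indicator (- ball 0 \<epsilon>) y * (S y * norm y powr (- a)) \<partial>lborel) \<longlongrightarrow> (\<integral>y. S y * norm y powr (- a) \<partial>lborel)) (at_right 0)"
    unfolding tendsto_at_iff_sequentially comp_def
  proof (intro allI impI)
    fix X :: "nat \<Rightarrow> real" assume X: "\<forall>i. X i \<in> {0<..} - {0}" and X0: "X \<longlonglongrightarrow> 0"
    show "(\<lambda>n. \<integral>y. indicator (- ball 0 (X n)) y * (S y * norm y powr (- a)) \<partial>lborel) \<longlonglongrightarrow> (\<integral>y. S y * norm y powr (- a) \<partial>lborel)"
    proof (rule integral_dominated_convergence[where w="\<lambda>y. \<bar>S y * norm y powr (- a)\<bar>"])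
      show "AE y in lborel. (\<lambda>n. indicator (- ball 0 (X n)) y * (S y * norm y powr (- a))) \<longlonglongrightarrow> S y * norm y powr (- a)"
      proof (intro AE_I2)
        fix y :: "real^'n"
        show "(\<lambda>n. indicator (- ball 0 (X n)) y * (S y * norm y powr (- a))) \<longlonglongrightarrow> S y * norm y powr (- a)"
        proof (cases "y = 0")
          case True
          then show ?thesis by (simp add: S0)
        next
          case False
          then have "eventually (\<lambda>n. X n < norm y) sequentially" using order_tendstoD(2)[OF X0] by simp
          then have "eventually (\<lambda>n. indicator (- ball 0 (X n)) y * (S y * norm y powr (- a)) = S y * norm y powr (- a)) sequentially"
            by eventually_elim simp
          then show ?thesis by (rule tendsto_eventually)
        qed
      qed
      show "AE y in lborel. norm (indicator (- ball 0 (X n)) y * (S y * norm y powr (- a))) \<le> \<bar>S y * norm y powr (- a)\<bar>" for n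
        by (auto simp: indicator_def)
    qed (use Si in auto)
  qed
  then have "((\<lambda>\<epsilon>. (\<integral>y. indicator (- ball 0 \<epsilon>) y * (S y * norm y powr (- a)) \<partial>lborel) / 2) \<longlongrightarrow> (\<integral>y. S y * norm y powr (- a) \<partial>lborel) / 2) (at_right 0)"
    by (intro tendsto_intros) auto
  then have "(?T \<longlongrightarrow> (\<integral>y. S y * norm y powr (- a) \<partial>lborel) / 2) (at_right 0)"
    by (rule Lim_transform_eventually) (auto simp: eventually_at_filter trunc)
  then have "Lim (at_right 0) ?T = (\<integral>y. S y * norm y powr (- a) \<partial>lborel) / 2"
    by (intro tendsto_Lim) auto
  then have "frac_laplacian s v x = C_ns CARD('n) s * ((\<integral>y. S y * norm y powr (- a) \<partial>lborel) / 2)"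
    by (simp add: frac_laplacian_def a_def)
  also have "(\<integral>y. S y * norm y powr (- a) \<partial>lborel) = 2 * (\<integral>t. indicator {0<..} t * (t powr (- 1 - 2 * s) * (?I * v x - av ?\<psi> t v x)) \<partial>lborel) / riesz_const a k"
    using rep riesz_const(2)[OF a k] by (simp add: field_simps)
  finally show ?thesis by simp
qed

section \<open>Decay of averages and the bootstrap\<close>

text \<open>Uniform in \<open>x\<close> on each smaller ball, with constant and range of scales
  depending on that ball. Every radius below \<open>r\<close> is quantified over, so an estimate
  that uses a slightly larger ball in its hypothesis can be iterated without loss.\<close>

definition decay :: "real \<Rightarrow> (real^'n::finite \<Rightarrow> real) \<Rightarrow> (real^'n \<Rightarrow> real) \<Rightarrow> (real \<Rightarrow> real) \<Rightarrow> bool" where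
  "decay r \<kappa> g b \<longleftrightarrow> (\<forall>\<rho><r. \<exists>C\<ge>0. \<forall>\<^sub>F t in at_right 0. \<forall>x\<in>ball 0 \<rho>. \<bar>av \<kappa> t g x\<bar> \<le> C * b t)"

lemma decayI:
  fixes \<kappa> g :: "real^'n::finite \<Rightarrow> real"
  assumes "\<And>\<rho>. 0 < \<rho> \<Longrightarrow> \<rho> < r \<Longrightarrow> \<exists>C\<ge>0. \<exists>d>0. \<forall>t x. 0 < t \<longrightarrow> t < d \<longrightarrow> norm x < \<rho> \<longrightarrow> \<bar>av \<kappa> t g x\<bar> \<le> C * b t"
  shows "decay r \<kappa> g b"
  unfolding decay_def
proof (intro allI impI)
  fix \<rho> assume "\<rho> < r"
  show "\<exists>C\<ge>0. \<forall>\<^sub>F t in at_right 0. \<forall>x\<in>ball 0 \<rho>. \<bar>av \<kappa> t g x\<bar> \<le> C * b t"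
  proof (cases "0 < \<rho>")
    case True
    from assms[OF this \<open>\<rho> < r\<close>] show ?thesis
      unfolding eventually_at_right_field by (force simp: mem_ball)
  next
    case False
    then have "ball (0 :: real^'n) \<rho> = {}" by (simp add: ball_empty)
    then show ?thesis by (intro exI[of _ 0]) (simp only: ball_simps order_refl always_eventually simp_thms)
  qed
qed

lemma decayE:
  assumes "decay r \<kappa> g b" "\<rho> < r"
  obtains C d where "0 \<le> C" "0 < d" "\<And>t x. 0 < t \<Longrightarrow> t < d \<Longrightarrow> norm x < \<rho> \<Longrightarrow> \<bar>av \<kappa> t g x\<bar> \<le> C * b t"
proof -
  from assms obtain C where C: "0 \<le> C" "\<forall>\<^sub>F t in at_right 0. \<forall>x\<in>ball 0 \<rho>. \<bar>av \<kappa> t g x\<bar> \<le> C * b t"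
    unfolding decay_def by blast
  then obtain d where "0 < d" "\<forall>t>0. t < d \<longrightarrow> (\<forall>x\<in>ball 0 \<rho>. \<bar>av \<kappa> t g x\<bar> \<le> C * b t)"
    unfolding eventually_at_right_field by blast
  with C(1) show ?thesis by (intro that[of C d]) auto
qed

lemma decay_mono:
  assumes "decay r \<kappa> g b" and "\<And>t. 0 < t \<Longrightarrow> t < 1 \<Longrightarrow> b t \<le> b' t"
  shows "decay r \<kappa> g b'"
proof (rule decayI)
  fix \<rho> assume "\<rho> < r"
  then obtain C d where C: "0 \<le> C" "0 < d" "\<And>t x. 0 < t \<Longrightarrow> t < d \<Longrightarrow> norm x < \<rho> \<Longrightarrow> \<bar>av \<kappa> t g x\<bar> \<le> C * b t"
    using decayE[OF assms(1)] by blast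
  have "\<bar>av \<kappa> t g x\<bar> \<le> C * b' t" if "0 < t" "t < min d 1" "norm x < \<rho>" for t x
    using C(3)[of t x] mult_left_mono[OF assms(2)[of t] C(1)] that by simp
  then show "\<exists>C\<ge>0. \<exists>d>0. \<forall>t x. 0 < t \<longrightarrow> t < d \<longrightarrow> norm x < \<rho> \<longrightarrow> \<bar>av \<kappa> t g x\<bar> \<le> C * b' t"
    using C(1,2) by (intro exI[of _ C] conjI exI[of _ "min d 1"]) auto
qed

text \<open>\<open>v\<close> is a Borel function, a setting in which Fubini applies; the passage
  from a Lebesgue measurable solution is made at the end. Only continuity of \<open>f\<close> is
  fixed here, because its finer regularity differs between the three conclusions.\<close>

locale mixed_equation =
  fixes v f :: "real^'n::finite \<Rightarrow> real" and s r :: real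
  assumes s: "0 < s" "s < 1" and r: "0 < r" "r \<le> 1"
    and v_meas: "v \<in> borel_measurable borel"
    and v_weight: "integrable lborel (\<lambda>y. \<bar>v y\<bar> / (1 + norm y powr (real CARD('n) + 2 * s)))"
    and v_C2: "v \<in> C_open 2 (ball 0 r)"
    and equation: "\<And>x. x \<in> ball 0 r \<Longrightarrow> frac_laplacian s v x - laplacian v x = f x"
    and f_cont: "continuous_on (ball 0 r) f"
begin

lemma v_loc_int: "loc_int v"
  using weighted_imp_loc_int[OF v_meas v_weight] s by simp

lemma laplacian_v_continuous: "continuous_on (ball 0 r) (laplacian v)"
  unfolding laplacian_def using C_open_continuous[OF v_C2, of "[_, _]"] by (intro continuous_on_sum) simp

text \<open>Read off from the equation, whose other two terms are continuous, rather than from the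
  singular integral. Continuity is needed to average the fractional Laplacian by itself.\<close>

lemma frac_continuous: "continuous_on (ball 0 r) (frac_laplacian s v)"
proof -
  have "continuous_on (ball 0 r) (\<lambda>x. f x + laplacian v x)"
    by (intro continuous_on_add f_cont laplacian_v_continuous)
  then show ?thesis
    by (rule continuous_on_cong[THEN iffD1, OF refl, rotated]) (use equation in \<open>fastforce\<close>)
qed

text \<open>With \<open>w = av \<kappa> \<tau> v\<close>, the integrand in \<open>t\<close> is estimated by the second-order bound for \<open>t \<le> \<tau>\<close>, by the
  decay of \<open>w\<close> for \<open>\<tau> < t \<le> d\<close>, and for \<open>t > d\<close> by moving the \<open>M\<close> Laplacians from \<open>\<kappa>\<close> to the kernel
  of scale \<open>t\<close>, where only the weighted integrability of \<open>v\<close> at infinity is needed.\<close>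

lemma frac_decay:
  assumes k0: "\<kappa>\<^sub>0 \<in> bump (4 + 2 * M)" and sig: "0 \<le> \<sigma>" "\<sigma> \<le> 2 * real M"
    and d1: "decay r ((laplacian ^^ M) \<kappa>\<^sub>0) v (\<lambda>t. t powr \<sigma>)"
    and d2: "decay r (laplacian ((laplacian ^^ M) \<kappa>\<^sub>0)) v (\<lambda>t. t powr \<sigma>)"
  shows "decay r ((laplacian ^^ M) \<kappa>\<^sub>0) (frac_laplacian s v) (\<lambda>t. t powr (\<sigma> - 2 * s))"
proof (rule decayI)
  let ?\<kappa> = "(laplacian ^^ M) \<kappa>\<^sub>0"
  have k: "?\<kappa> \<in> bump 4" by (rule bump_laplacian_pow[OF k0])
  have k2: "?\<kappa> \<in> bump (Suc (Suc 0))" by (rule bump_antimono[OF _ k]) simp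
  fix \<rho> :: real assume rho: "0 < \<rho>" "\<rho> < r"
  \<comment> \<open>A radius halfway to \<open>r\<close>: for a centre of norm below \<rho>,
    averages of \<open>?w\<close> up to scale \<open>d\<close> must stay where the rates are
    available. The gap divided by 8 in the choice of \<open>d\<close> gives \<rho> + 2 d < \<rho>',
    room for two successive averages.\<close>
  define \<rho>' where "\<rho>' = (\<rho> + r) / 2"
  have rho': "\<rho>' < r" using rho by (simp add: \<rho>'_def)
  obtain C1 d1 where C1: "0 \<le> C1" "0 < d1" "\<And>t x. 0 < t \<Longrightarrow> t < d1 \<Longrightarrow> norm x < \<rho>' \<Longrightarrow> \<bar>av ?\<kappa> t v x\<bar> \<le> C1 * t powr \<sigma>"
    using decayE[OF d1 rho'] by blast
  obtain C2 d2 where C2: "0 \<le> C2" "0 < d2" "\<And>t x. 0 < t \<Longrightarrow> t < d2 \<Longrightarrow> norm x < \<rho>' \<Longrightarrow> \<bar>av (laplacian ?\<kappa>) t v x\<bar> \<le> C2 * t powr \<sigma>"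
    using decayE[OF d2 rho'] by blast
  define d where "d = min (min d1 d2) ((r - \<rho>) / 8)"
  have d: "0 < d" "d \<le> d1" "d \<le> d2" "\<rho> + 2 * d < \<rho>'" "d \<le> 1"
    using C1(2) C2(2) rho r by (auto simp: d_def \<rho>'_def min_def field_simps)
  \<comment> \<open>Smooth enough for \<open>?\<psi>\<close> to carry the M Laplacians that are
    moved onto it at large scales.\<close>
  define k where "k = 2 * M + 3"
  let ?\<psi> = "\<lambda>z::real^'n. (max 0 (1 - z \<bullet> z)) ^ k :: real"
  let ?\<eta> = "\<lambda>z::real^'n. (max 0 (1 - z \<bullet> z)) ^ Suc k :: real"
  let ?I = "integral\<^sup>L lborel ?\<psi>"
  have psi: "?\<psi> \<in> bump (Suc 0)" "?\<psi> \<in> bump (0 + 2 * M)" by (rule bump.base; simp add: k_def)+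
  have eta: "?\<eta> \<in> bump (Suc (Suc 0))" by (rule bump.base) (simp add: k_def)
  have eul: "euler ?\<psi> = (\<lambda>z. (- 1 / (2 * real (Suc k))) * laplacian ?\<eta> z)"
  proof -
    have "1 < k" by (simp add: k_def)
    show ?thesis unfolding laplacian_base[OF \<open>1 < k\<close>] by (simp del: of_nat_Suc)
  qed
  have I0: "0 \<le> ?I" by simp
  have Iabs: "(\<integral>z. \<bar>?\<psi> z\<bar> \<partial>lborel) = ?I" by simp
  define L where "L = \<bar>- 1 / (2 * real (Suc k))\<bar> * (\<integral>z. \<bar>?\<eta> z\<bar> \<partial>lborel)"
  have L0: "0 \<le> L" by (simp add: L_def)
  let ?a = "real CARD('n) + 2 * s"
  define c where "c = C_ns CARD('n) s / riesz_const ?a k"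
  have a0: "0 < ?a" using s by (simp add: add_pos_pos)
  let ?G = "frac_laplacian s v"
  have rep: "?G p = c * (\<integral>t. indicator {0<..} t * (t powr (- 1 - 2 * s) * (?I * v p - av ?\<psi> t v p)) \<partial>lborel)" if "norm p < r" for p
    unfolding c_def
    by (rule frac_laplacian_averages[OF refl s v_meas v_weight v_C2]) (use that r in \<open>auto simp: k_def\<close>)
  have cb: "cball 0 (\<rho> + 2 * d) \<subseteq> ball 0 r" using d rho' by auto
  obtain Bv where Bv: "0 < Bv" "\<And>p. p \<in> cball 0 (\<rho> + 2 * d) \<Longrightarrow> \<bar>v p\<bar> \<le> Bv"
  proof -
    have "continuous_on (cball 0 (\<rho> + 2 * d)) v" using C_open_continuous[OF v_C2, of "[]"] cb by (auto intro: continuous_on_subset)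
    then show ?thesis using continuous_cball_bounded that by blast
  qed
  obtain Bl where Bl: "0 < Bl" "\<And>p. p \<in> cball 0 (\<rho> + 2 * d) \<Longrightarrow> \<bar>laplacian v p\<bar> \<le> Bl"
    using continuous_cball_bounded[OF continuous_on_subset[OF laplacian_v_continuous cb]] by blast
  have psi1: "\<bar>?\<psi> z\<bar> \<le> 1 * indicator (cball 0 1) z" for z
  proof (cases "norm z \<le> 1")
    case True then show ?thesis by (auto intro!: power_le_one)
  next
    case False then show ?thesis using bump_supp[OF psi(1), of z] by (simp add: power_0_left)
  qed
  define W where "W t = indicator {d..} t * (t powr (- 1 - ?a) * mass v (1 + t))" for t
  have Wi: "integrable lborel W" unfolding W_def by (rule mass_weight_integrable[OF v_meas v_weight a0 d(1)])
  have W0: "0 \<le> W t" for t unfolding W_def using mass_nonneg[of v] by simp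
  have tW: "t powr (- 1 - 2 * s) * (inverse t ^ CARD('n) * mass v (1 + t)) = W t" if "d \<le> t" for t
  proof -
    have "t powr (- 1 - ?a) = t powr (- 1 - 2 * s) * inverse t ^ CARD('n)"
      using powr_mult_power[of t "CARD('n)" "2 * s"] that d(1) by (simp add: power_inverse field_simps)
    then show ?thesis using that by (simp add: W_def)
  qed
  \<comment> \<open>A crude majorant without any decay in \<tau>. It only justifies exchanging the
    average with the integral over scales; the quantitative bound is \<open>H\<close>.\<close>
  define D where "D t = L * Bl * (indicator {0..d} t * t powr (1 - 2 * s)) + ?I * Bv * (indicator {d..} t * t powr (- 1 - 2 * s)) + W t" for t
  have pl: "integrable lborel (\<lambda>t. indicator {\<epsilon>..} t * t powr (- 1 - 2 * s))" "(\<integral>t. indicator {\<epsilon>..} t * t powr (- 1 - 2 * s) \<partial>lborel) = \<epsilon> powr (- (2 * s)) / (2 * s)" if "0 < \<epsilon>" for \<epsilon>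
    using has_bochner_integral_powr_to_inf[OF that, of "2 * s"] s by (simp_all add: has_bochner_integral_iff)
  have p0: "integrable lborel (\<lambda>t. indicator {0..\<epsilon>} t * t powr (1 - 2 * s))" "(\<integral>t. indicator {0..\<epsilon>} t * t powr (1 - 2 * s) \<partial>lborel) = \<epsilon> powr (2 - 2 * s) / (2 - 2 * s)" if "0 \<le> \<epsilon>" for \<epsilon>
    using has_bochner_integral_powr_from_0[OF that, of "2 - 2 * s"] s by (simp_all add: has_bochner_integral_iff)
  have Di: "integrable lborel D"
    unfolding D_def using d(1) by (intro Bochner_Integration.integrable_add integrable_mult_right p0 pl Wi) auto
  have far: "\<bar>av ?\<psi> t v p\<bar> \<le> inverse t ^ CARD('n) * mass v (1 + t)" if "0 < t" "norm p \<le> 1" for t p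
    using av_mass_bound[OF psi(1) v_loc_int that(1) psi1, of p "1 + t"] that by simp
  have t2: "t powr (- 1 - 2 * s) * t\<^sup>2 = t powr (1 - 2 * s)" if "0 < t" for t
  proof -
    have "t\<^sup>2 = t powr 2" using that by (simp add: powr_numeral)
    then have "t powr (- 1 - 2 * s) * t\<^sup>2 = t powr (- 1 - 2 * s + 2)" by (simp only: powr_add)
    then show ?thesis by simp
  qed
  have Db: "\<bar>indicator {0<..} t * (t powr (- 1 - 2 * s) * (?I * v p - av ?\<psi> t v p))\<bar> \<le> D t" if p: "norm p \<le> \<rho> + d" for t p
  proof -
    have D0: "0 \<le> D t" unfolding D_def using L0 Bl(1) I0 Bv(1) W0 by (auto intro!: add_nonneg_nonneg mult_nonneg_nonneg)
    consider "t \<le> 0" | "0 < t" "t \<le> d" | "d < t" by linarith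
    then show ?thesis
    proof cases
      case 1
      then show ?thesis using D0 by simp
    next
      case 2
      have "cball p t \<subseteq> cball 0 (\<rho> + 2 * d)" using p 2 by (intro cball_subset_cball_iff[THEN iffD2]) (auto simp: dist_norm)
      then have "\<bar>?I * v p - av ?\<psi> t v p\<bar> \<le> L * Bl * t\<^sup>2"
        unfolding L_def using 2 cb Bl(2)
        by (intro av_second_order[OF psi(1) eul eta v_loc_int open_ball _ v_C2]) auto
      then have "t powr (- 1 - 2 * s) * \<bar>?I * v p - av ?\<psi> t v p\<bar> \<le> t powr (- 1 - 2 * s) * (L * Bl * t\<^sup>2)"
        by (rule mult_left_mono) simp
      also have "\<dots> = L * Bl * t powr (1 - 2 * s)" using t2[OF 2(1)] by (simp add: mult_ac)
      also have "\<dots> \<le> D t" unfolding D_def using 2 I0 Bv(1) W0[of t] by simp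
      finally show ?thesis using 2 by (simp add: abs_mult)
    next
      case 3
      then have t0: "0 < t" using d(1) by simp
      have "norm p \<le> 1" using p d rho' r by simp
      have "\<bar>?I * v p\<bar> \<le> ?I * Bv" using Bv(2)[of p] p d(1) I0 by (simp add: abs_mult mult_left_mono)
      then have "\<bar>?I * v p - av ?\<psi> t v p\<bar> \<le> ?I * Bv + inverse t ^ CARD('n) * mass v (1 + t)"
        using far[OF t0 \<open>norm p \<le> 1\<close>] by linarith
      then have "t powr (- 1 - 2 * s) * \<bar>?I * v p - av ?\<psi> t v p\<bar> \<le> t powr (- 1 - 2 * s) * (?I * Bv + inverse t ^ CARD('n) * mass v (1 + t))"
        by (rule mult_left_mono) simp
      also have "\<dots> = ?I * Bv * t powr (- 1 - 2 * s) + W t" using tW[of t] 3 by (simp add: algebra_simps)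
      also have "\<dots> = D t" unfolding D_def using 3 t0 by simp
      finally show ?thesis using t0 by (simp add: abs_mult)
    qed
  qed
  obtain Ck where Ck: "Ck > 0" "\<And>z. \<bar>?\<kappa> z\<bar> \<le> Ck * indicator (cball 0 1) z" using bump_bounded[OF k2] by blast
  obtain CL where CL: "CL > 0" "\<And>z. \<bar>(laplacian ^^ M) ?\<psi> z\<bar> \<le> CL * indicator (cball 0 1) z"
    using bump_bounded[OF bump_laplacian_pow[OF psi(2)]] by blast
  define A where "A = L * C2 + 2 * ?I * C1"
  define A' where "A' = (1 / d) ^ (2 * M) * ((\<integral>z. \<bar>\<kappa>\<^sub>0 z\<bar> \<partial>lborel) * CL)"
  have A0: "0 \<le> A" "0 \<le> A'" using L0 C1 C2 I0 CL d by (auto simp: A_def A'_def)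
  define C where "C = \<bar>c\<bar> * (A * (1 / (2 - 2 * s) + 1 / (2 * s)) + A' * (\<integral>t. W t \<partial>lborel))"
  have main: "\<bar>av ?\<kappa> \<tau> ?G x\<bar> \<le> C * \<tau> powr (\<sigma> - 2 * s)" if tau: "0 < \<tau>" "\<tau> < d" and x: "norm x < \<rho>" for \<tau> x
  proof -
    let ?w = "av ?\<kappa> \<tau> v"
    have nz: "norm (x + \<tau> *\<^sub>R z) \<le> \<rho> + d" if "norm z \<le> 1" for z
    proof -
      have "norm (x + \<tau> *\<^sub>R z) \<le> norm x + \<tau> * norm z" using norm_triangle_ineq[of x "\<tau> *\<^sub>R z"] tau by simp
      moreover have "\<tau> * norm z \<le> \<tau>" using that tau by (simp add: mult_left_le)
      ultimately show ?thesis using x tau by linarith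
    qed
    let ?F = "\<lambda>z t. ?\<kappa> z * (indicator {0<..} t * (t powr (- 1 - 2 * s) * (?I * v (x + \<tau> *\<^sub>R z) - av ?\<psi> t v (x + \<tau> *\<^sub>R z))))"
    have [measurable]: "?\<kappa> \<in> borel_measurable borel" "v \<in> borel_measurable borel" using k2 v_meas by auto
    have meas: "case_prod ?F \<in> borel_measurable (lborel \<Otimes>\<^sub>M lborel)"
      unfolding av_def by measurable
    have Fb: "\<bar>?F z t\<bar> \<le> Ck * indicator (cball 0 1) z * D t" for z t
    proof (cases "norm z \<le> 1")
      case True
      show ?thesis unfolding abs_mult[of "?\<kappa> z"]
        by (rule mult_mono[OF Ck(2) Db[OF nz[OF True]]]) (use Ck in auto)
    next
      case False
      then show ?thesis using bump_supp[OF k2, of z] by simp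
    qed
    have fint: "integrable (lborel \<Otimes>\<^sub>M lborel) (case_prod ?F)"
    proof (rule lborel_pair.Fubini_integrable[OF meas])
      have i: "integrable lborel (?F z)" for z
      proof (rule Bochner_Integration.integrable_bound[OF integrable_mult_right[OF Di, of "Ck * indicator (cball 0 1) z"]])
        have "Pair z \<in> measurable lborel (lborel \<Otimes>\<^sub>M lborel)" by (rule measurable_Pair1') simp
        from measurable_compose[OF this meas] show "?F z \<in> borel_measurable lborel" by (simp only: prod.case)
        show "AE t in lborel. norm (?F z t) \<le> norm (Ck * indicator (cball 0 1) z * D t)"
          using Fb by (intro AE_I2) (auto intro: order_trans[OF _ abs_ge_self])
      qed
      then show "AE z in lborel. integrable lborel (\<lambda>t. case_prod ?F (z, t))" by simp
      have "\<bar>\<integral>t. norm (case_prod ?F (z, t)) \<partial>lborel\<bar> \<le> (Ck * (\<integral>t. D t \<partial>lborel)) * indicator (cball 0 1) z" for z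
      proof -
        have "\<bar>\<integral>t. norm (case_prod ?F (z, t)) \<partial>lborel\<bar> \<le> (\<integral>t. Ck * indicator (cball 0 1) z * D t \<partial>lborel)"
          using Fb by (intro abs_integral_le integrable_mult_right Di) auto
        then show ?thesis by (simp add: mult_ac)
      qed
      then show "integrable lborel (\<lambda>z. \<integral>t. norm (case_prod ?F (z, t)) \<partial>lborel)"
        using meas by (intro integrable_bounded_compact_support) (auto intro!: lborel.borel_measurable_lebesgue_integral)
    qed
    let ?E = "\<lambda>t. ?I * ?w x - av ?\<kappa> \<tau> (av ?\<psi> t v) x"
    have inner: "(\<integral>z. ?F z t \<partial>lborel) = indicator {0<..} t * (t powr (- 1 - 2 * s) * ?E t)" for t
    proof (cases "0 < t")
      case True
      have "(\<integral>z. ?F z t \<partial>lborel) = (\<integral>z. t powr (- 1 - 2 * s) * (?I * (?\<kappa> z * v (x + \<tau> *\<^sub>R z)) - ?\<kappa> z * av ?\<psi> t v (x + \<tau> *\<^sub>R z)) \<partial>lborel)"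
        using True by (intro Bochner_Integration.integral_cong) (auto simp: algebra_simps)
      also have "\<dots> = t powr (- 1 - 2 * s) * ?E t"
        using integrable_bump_mult_loc[OF k2 v_loc_int tau(1), of x]
          integrable_bump_mult_loc[OF k2 av_loc_int[OF psi(1) v_loc_int True] tau(1), of x]
        by (simp add: av_def)
      finally show ?thesis using True by simp
    qed simp
    have "av ?\<kappa> \<tau> ?G x = (\<integral>z. c * (\<integral>t. ?F z t \<partial>lborel) \<partial>lborel)"
      unfolding av_def
    proof (intro Bochner_Integration.integral_cong refl)
      fix z
      show "?\<kappa> z * ?G (x + \<tau> *\<^sub>R z) = c * (\<integral>t. ?\<kappa> z * (indicator {0<..} t * (t powr (- 1 - 2 * s) * (?I * v (x + \<tau> *\<^sub>R z) - (\<integral>y. ?\<psi> y * v (x + \<tau> *\<^sub>R z + t *\<^sub>R y) \<partial>lborel)))) \<partial>lborel)"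
      proof (cases "norm z \<le> 1")
        case True
        have "norm (x + \<tau> *\<^sub>R z) < r" using nz[OF True] d rho' by simp
        show ?thesis unfolding rep[OF \<open>norm (x + \<tau> *\<^sub>R z) < r\<close>] av_def integral_mult_right_zero
          by (rule mult.left_commute)
      next
        case False
        then show ?thesis using bump_supp[OF k2, of z] by simp
      qed
    qed
    also have "\<dots> = c * (\<integral>z. \<integral>t. ?F z t \<partial>lborel \<partial>lborel)" by simp
    also have "(\<integral>z. \<integral>t. ?F z t \<partial>lborel \<partial>lborel) = (\<integral>t. \<integral>z. ?F z t \<partial>lborel \<partial>lborel)"
      by (rule lborel_pair.Fubini_integral[OF fint, symmetric])
    finally have GE: "av ?\<kappa> \<tau> ?G x = c * (\<integral>t. indicator {0<..} t * (t powr (- 1 - 2 * s) * ?E t) \<partial>lborel)"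
      unfolding inner .
    \<comment> \<open>The factor \<open>inverse \<tau> ^ 2\<close> is the cost of the Laplacian of
      \<open>?w\<close> at scale \<tau>. All scales beyond \<tau> share the second term, and only
      the mass of \<open>v\<close> seen at scales beyond \<open>d\<close> carries
      \<open>\<tau> ^ (2 * M)\<close>.\<close>
    define H where "H t = A * \<tau> powr \<sigma> * (inverse \<tau> ^ 2 * (indicator {0..\<tau>} t * t powr (1 - 2 * s)) + indicator {\<tau>..} t * t powr (- 1 - 2 * s)) + A' * \<tau> ^ (2 * M) * W t" for t
    have Hi: "integrable lborel H"
      unfolding H_def using tau by (intro Bochner_Integration.integrable_add integrable_mult_right p0 pl Wi) auto
    have H0: "0 \<le> H t" for t
      unfolding H_def using A0 W0 tau by (intro add_nonneg_nonneg mult_nonneg_nonneg) auto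
    have wb: "\<bar>?w p\<bar> \<le> C1 * \<tau> powr \<sigma>" if "norm p < \<rho>'" for p
      by (rule C1(3)) (use tau d that in auto)
    \<comment> \<open>The Laplacian falls on the kernel; for this reason a rate is assumed for
      \<open>laplacian ?\<kappa>\<close> as well as for \<open>?\<kappa>\<close>.\<close>
    have lw: "\<bar>laplacian ?w p\<bar> \<le> inverse \<tau> ^ 2 * (C2 * \<tau> powr \<sigma>)" if "norm p < \<rho>'" for p
      unfolding laplacian_av[OF k2 v_loc_int tau(1)] using C2(3)[of \<tau> p] tau d that
      by (simp add: abs_mult inverse_eq_divide power_divide divide_right_mono)
    have wE: "\<bar>?I * ?w x\<bar> \<le> ?I * (C1 * \<tau> powr \<sigma>)" using wb[of x] x d I0 by (simp add: abs_mult mult_left_mono)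
    have wC: "?w \<in> C_open 2 UNIV"
      by (rule av_C_open[OF _ v_loc_int tau(1), where N=0]) (use k2 in \<open>simp add: numeral_2_eq_2\<close>)
    have Eb: "t powr (- 1 - 2 * s) * \<bar>?E t\<bar> \<le> H t" if t: "0 < t" for t
    proof -
      have inb: "norm p < \<rho>'" if "p \<in> cball x t" "t \<le> d" for p
      proof -
        have "norm p \<le> norm x + norm (p - x)" by (metis add.commute diff_add_cancel norm_triangle_ineq)
        then show ?thesis using that x d by (simp add: dist_norm norm_minus_commute)
      qed
      consider "t \<le> \<tau>" | "\<tau> < t" "t \<le> d" | "d < t" by linarith
      then show ?thesis
      proof cases
        case 1
        have "\<bar>?I * ?w x - av ?\<psi> t ?w x\<bar> \<le> L * (inverse \<tau> ^ 2 * (C2 * \<tau> powr \<sigma>)) * t\<^sup>2"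
          unfolding L_def
          by (rule av_second_order[OF psi(1) eul eta av_loc_int[OF k2 v_loc_int tau(1)] open_UNIV _ wC])
             (use t 1 tau lw inb in auto)
        then have "\<bar>?E t\<bar> \<le> L * (inverse \<tau> ^ 2 * (C2 * \<tau> powr \<sigma>)) * t\<^sup>2"
          using av_commute[OF k2 psi(1) v_loc_int tau(1) t] by simp
        then have "t powr (- 1 - 2 * s) * \<bar>?E t\<bar> \<le> t powr (- 1 - 2 * s) * (L * (inverse \<tau> ^ 2 * (C2 * \<tau> powr \<sigma>)) * t\<^sup>2)"
          by (rule mult_left_mono) simp
        also have "\<dots> = (L * C2) * (\<tau> powr \<sigma> * (inverse \<tau> ^ 2 * t powr (1 - 2 * s)))"
          using t2[OF t] by (simp add: mult_ac)
        also have "\<dots> \<le> A * (\<tau> powr \<sigma> * (inverse \<tau> ^ 2 * t powr (1 - 2 * s)))"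
          unfolding A_def using I0 C1(1) tau by (intro mult_right_mono) auto
        also have "\<dots> \<le> H t" unfolding H_def using 1 t A0 W0[of t] tau by (simp add: distrib_left mult_ac)
        finally show ?thesis .
      next
        case 2
        have "\<bar>av ?\<psi> t ?w x\<bar> \<le> ?I * (C1 * \<tau> powr \<sigma>)"
          unfolding Iabs[symmetric] using t wb inb 2 by (intro av_bound[OF psi(1)]) auto
        moreover have "2 * ?I * C1 * \<tau> powr \<sigma> = 2 * (?I * (C1 * \<tau> powr \<sigma>))" by (simp only: mult.assoc)
        ultimately have "\<bar>?E t\<bar> \<le> 2 * ?I * C1 * \<tau> powr \<sigma>"
          using av_commute[OF k2 psi(1) v_loc_int tau(1) t, of x] wE by linarith
        then have "t powr (- 1 - 2 * s) * \<bar>?E t\<bar> \<le> t powr (- 1 - 2 * s) * (2 * ?I * C1 * \<tau> powr \<sigma>)"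
          by (rule mult_left_mono) simp
        also have "\<dots> \<le> t powr (- 1 - 2 * s) * (A * \<tau> powr \<sigma>)"
          unfolding A_def using L0 C2(1) by (intro mult_left_mono mult_right_mono) auto
        also have "\<dots> \<le> H t" unfolding H_def using 2 t A0 W0[of t] tau by (simp add: mult_ac)
        finally show ?thesis .
      next
        case 3
        have "\<bar>av \<kappa>\<^sub>0 \<tau> (av ((laplacian ^^ M) ?\<psi>) t v) x\<bar> \<le> (\<integral>z. \<bar>\<kappa>\<^sub>0 z\<bar> \<partial>lborel) * (CL * inverse t ^ CARD('n) * mass v (1 + t))"
        proof (rule av_bound[OF k0])
          fix p assume "p \<in> cball x \<tau>"
          then have "norm p \<le> norm x + \<tau>" using norm_triangle_ineq[of x "p - x"] by (simp add: dist_norm norm_minus_commute)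
          then have "norm p + t \<le> 1 + t" using x tau d rho' r by linarith
          then show "\<bar>av ((laplacian ^^ M) ?\<psi>) t v p\<bar> \<le> CL * inverse t ^ CARD('n) * mass v (1 + t)"
            by (rule av_mass_bound[OF bump_laplacian_pow[OF psi(2)] v_loc_int t CL(2)])
        qed (use tau in simp)
        then have "(\<tau> / t) ^ (2 * M) * \<bar>av \<kappa>\<^sub>0 \<tau> (av ((laplacian ^^ M) ?\<psi>) t v) x\<bar> \<le> (\<tau> * (1 / d)) ^ (2 * M) * ((\<integral>z. \<bar>\<kappa>\<^sub>0 z\<bar> \<partial>lborel) * (CL * inverse t ^ CARD('n) * mass v (1 + t)))"
          using 3 t tau d by (intro mult_mono power_mono) (auto simp: field_simps)
        then have "\<bar>av ?\<kappa> \<tau> (av ?\<psi> t v) x\<bar> \<le> A' * \<tau> ^ (2 * M) * (inverse t ^ CARD('n) * mass v (1 + t))"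
          unfolding av_shift_laplacian_pow[OF k0 psi(2) v_loc_int tau(1) t] abs_mult A'_def power_mult_distrib
          using t tau by (simp add: mult_ac)
        then have "\<bar>?E t\<bar> \<le> ?I * (C1 * \<tau> powr \<sigma>) + A' * \<tau> ^ (2 * M) * (inverse t ^ CARD('n) * mass v (1 + t))"
          using wE by linarith
        then have "t powr (- 1 - 2 * s) * \<bar>?E t\<bar> \<le> t powr (- 1 - 2 * s) * (?I * (C1 * \<tau> powr \<sigma>) + A' * \<tau> ^ (2 * M) * (inverse t ^ CARD('n) * mass v (1 + t)))"
          by (rule mult_left_mono) simp
        also have "\<dots> = (?I * C1) * (\<tau> powr \<sigma> * t powr (- 1 - 2 * s)) + A' * \<tau> ^ (2 * M) * W t"
          using tW[of t] 3 by (simp add: algebra_simps)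
        also have "\<dots> \<le> A * (\<tau> powr \<sigma> * t powr (- 1 - 2 * s)) + A' * \<tau> ^ (2 * M) * W t"
          unfolding A_def using L0 C2(1) C1(1) I0 by (intro add_right_mono mult_right_mono) auto
        also have "\<dots> = H t" unfolding H_def using 3 tau by (simp add: mult_ac)
        finally show ?thesis .
      qed
    qed
    have "\<bar>\<integral>t. indicator {0<..} t * (t powr (- 1 - 2 * s) * ?E t) \<partial>lborel\<bar> \<le> (\<integral>t. H t \<partial>lborel)"
      by (rule abs_integral_le[OF Hi]) (use Eb H0 in \<open>auto simp: abs_mult indicator_def\<close>)
    also have "\<dots> = A * \<tau> powr \<sigma> * (inverse \<tau> ^ 2 * (\<tau> powr (2 - 2 * s) / (2 - 2 * s)) + \<tau> powr (- (2 * s)) / (2 * s)) + A' * \<tau> ^ (2 * M) * (\<integral>t. W t \<partial>lborel)"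
      unfolding H_def using tau p0[of \<tau>] pl[of \<tau>] Wi by simp
    \<comment> \<open>Scales below and above \<tau> contribute the same power, -2 s. The conditions
      s < 1 and s > 0 are what make the respective integrals converge.\<close>
    also have "inverse \<tau> ^ 2 * (\<tau> powr (2 - 2 * s) / (2 - 2 * s)) = \<tau> powr (- (2 * s)) / (2 - 2 * s)"
      using tau by (simp add: powr_diff powr_minus powr_numeral field_simps)
    also have "A * \<tau> powr \<sigma> * (\<tau> powr (- (2 * s)) / (2 - 2 * s) + \<tau> powr (- (2 * s)) / (2 * s)) = A * (1 / (2 - 2 * s) + 1 / (2 * s)) * (\<tau> powr \<sigma> * \<tau> powr (- (2 * s)))"
      by (simp add: distrib_left distrib_right)
    also have "\<tau> powr \<sigma> * \<tau> powr (- (2 * s)) = \<tau> powr (\<sigma> - 2 * s)" by (simp add: powr_add[symmetric])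
    also have "A' * \<tau> ^ (2 * M) * (\<integral>t. W t \<partial>lborel) \<le> A' * \<tau> powr (\<sigma> - 2 * s) * (\<integral>t. W t \<partial>lborel)"
    proof (intro mult_right_mono mult_left_mono A0)
      \<comment> \<open>The bound \<sigma> <= 2 M enters here: as \<tau> is below 1, the exterior
        term is dominated by the target power.\<close>
      have "\<tau> ^ (2 * M) = \<tau> powr (2 * real M)" using tau by (simp add: powr_realpow[symmetric])
      also have "\<dots> \<le> \<tau> powr (\<sigma> - 2 * s)" using tau d sig s by (intro powr_mono') auto
      finally show "\<tau> ^ (2 * M) \<le> \<tau> powr (\<sigma> - 2 * s)" .
      show "0 \<le> (\<integral>t. W t \<partial>lborel)" using W0 by simp
    qed
    finally have "\<bar>\<integral>t. indicator {0<..} t * (t powr (- 1 - 2 * s) * ?E t) \<partial>lborel\<bar> \<le> A * (1 / (2 - 2 * s) + 1 / (2 * s)) * \<tau> powr (\<sigma> - 2 * s) + A' * \<tau> powr (\<sigma> - 2 * s) * (\<integral>t. W t \<partial>lborel)"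
      by simp
    then have "\<bar>c\<bar> * \<bar>\<integral>t. indicator {0<..} t * (t powr (- 1 - 2 * s) * ?E t) \<partial>lborel\<bar> \<le> \<bar>c\<bar> * (A * (1 / (2 - 2 * s) + 1 / (2 * s)) * \<tau> powr (\<sigma> - 2 * s) + A' * \<tau> powr (\<sigma> - 2 * s) * (\<integral>t. W t \<partial>lborel))"
      by (rule mult_left_mono) simp
    then show ?thesis unfolding GE abs_mult C_def by (simp add: algebra_simps)
  qed
  have "0 \<le> C" unfolding C_def using A0 s W0 by (intro mult_nonneg_nonneg add_nonneg_nonneg) auto
  then show "\<exists>C\<ge>0. \<exists>d>0. \<forall>t x. 0 < t \<longrightarrow> t < d \<longrightarrow> norm x < \<rho> \<longrightarrow> \<bar>av ?\<kappa> t ?G x\<bar> \<le> C * t powr (\<sigma> - 2 * s)"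
    using main d(1) by blast
qed

end

lemma decay_scale:
  assumes "decay r \<kappa> g (\<lambda>t. c * b t)" "0 \<le> c"
  shows "decay r \<kappa> g b"
proof (rule decayI)
  fix \<rho> assume "\<rho> < r"
  then obtain C d where C: "0 \<le> C" "0 < d" "\<And>t x. 0 < t \<Longrightarrow> t < d \<Longrightarrow> norm x < \<rho> \<Longrightarrow> \<bar>av \<kappa> t g x\<bar> \<le> C * (c * b t)"
    using decayE[OF assms(1)] by blast
  then show "\<exists>C\<ge>0. \<exists>d>0. \<forall>t x. 0 < t \<longrightarrow> t < d \<longrightarrow> norm x < \<rho> \<longrightarrow> \<bar>av \<kappa> t g x\<bar> \<le> C * b t"
    using assms(2) by (intro exI[of _ "C * c"] conjI exI[of _ d]) (auto simp: mult.assoc)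
qed

text \<open>The condition m < 2 M provides at least m + 1 derivatives on the kernel, as
  \<open>av_deriv_bump_bound\<close> requires; surplus derivatives are simply left on it.\<close>

lemma decay_of_C_open:
  fixes g :: "real^'n::finite \<Rightarrow> real"
  assumes g: "g \<in> C_open m (ball 0 r)" and M: "m < 2 * M" and k: "\<kappa> \<in> bump (N + 2 * M)"
    and w: "\<And>is p q t. length is = m \<Longrightarrow> p \<in> ball 0 r \<Longrightarrow> q \<in> ball 0 r \<Longrightarrow> 0 < t \<Longrightarrow> norm (p - q) \<le> t \<Longrightarrow>
      \<bar>D_multi is g p - D_multi is g q\<bar> \<le> \<omega> t"
  shows "decay r ((laplacian ^^ M) \<kappa>) g (\<lambda>t. t ^ m * \<omega> t)"
proof (rule decayI)
  have "(laplacian ^^ M) \<kappa> \<in> deriv_bump (Suc m) N"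
    using laplacian_pow_deriv_bump[OF k] deriv_bump_antimono[of "Suc m" "2 * M" N] M by auto
  then obtain C where C: "C \<ge> 0" "\<And>g U x t \<omega>. open U \<Longrightarrow> cball x t \<subseteq> U \<Longrightarrow> 0 \<le> t \<Longrightarrow> g \<in> C_open m U \<Longrightarrow>
     (\<forall>is y. length is = m \<longrightarrow> y \<in> cball x t \<longrightarrow> \<bar>D_multi is g y - D_multi is g x\<bar> \<le> \<omega>) \<Longrightarrow>
     \<bar>av ((laplacian ^^ M) \<kappa>) t g x\<bar> \<le> C * t ^ m * \<omega>"
    using av_deriv_bump_bound by metis
  fix \<rho> assume rho: "0 < \<rho>" "\<rho> < r"
  have "\<bar>av ((laplacian ^^ M) \<kappa>) t g x\<bar> \<le> C * (t ^ m * \<omega> t)" if t: "0 < t" "t < r - \<rho>" and x: "norm x < \<rho>" for t x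
  proof -
    have sub: "cball x t \<subseteq> ball 0 r"
    proof
      fix y assume "y \<in> cball x t"
      then show "y \<in> ball 0 r" using t x norm_triangle_ineq[of x "y - x"] by (simp add: dist_norm norm_minus_commute)
    qed
    have "\<bar>D_multi is g y - D_multi is g x\<bar> \<le> \<omega> t" if "length is = m" "y \<in> cball x t" for "is" y
      using w[OF that(1) subsetD[OF sub that(2)] _ t(1), of x] that x rho by (simp add: dist_norm norm_minus_commute)
    then have "\<bar>av ((laplacian ^^ M) \<kappa>) t g x\<bar> \<le> C * t ^ m * \<omega> t"
      using t by (intro C(2)[OF open_ball sub _ g]) auto
    then show ?thesis by (simp add: mult.assoc)
  qed
  then show "\<exists>C\<ge>0. \<exists>d>0. \<forall>t x. 0 < t \<longrightarrow> t < d \<longrightarrow> norm x < \<rho> \<longrightarrow> \<bar>av ((laplacian ^^ M) \<kappa>) t g x\<bar> \<le> C * (t ^ m * \<omega> t)"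
    using C(1) rho by (intro exI[of _ C] conjI exI[of _ "r - \<rho>"]) auto
qed

section \<open>Iteration of the decay estimates\<close>

context mixed_equation
begin

text \<open>Two Laplacian derivatives are moved from the kernel to \<open>v\<close>, where the
  equation replaces the Laplacian by the fractional Laplacian minus \<open>f\<close>. The two rates
  are kept as a sum, since in the Dini case neither dominates the other.\<close>

lemma laplacian_decay:
  assumes k: "\<kappa> \<in> bump (Suc (Suc N))"
    and G: "decay r \<kappa> (frac_laplacian s v) b1" and F: "decay r \<kappa> f b2"
    and nonneg: "\<And>t. 0 < t \<Longrightarrow> 0 \<le> b1 t" "\<And>t. 0 < t \<Longrightarrow> 0 \<le> b2 t"
  shows "decay r (laplacian \<kappa>) v (\<lambda>t. t\<^sup>2 * (b1 t + b2 t))"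
proof (rule decayI)
  fix \<rho> assume rho: "0 < \<rho>" "\<rho> < r"
  obtain C1 d1 where C1: "0 \<le> C1" "0 < d1" "\<And>t x. 0 < t \<Longrightarrow> t < d1 \<Longrightarrow> norm x < \<rho> \<Longrightarrow> \<bar>av \<kappa> t (frac_laplacian s v) x\<bar> \<le> C1 * b1 t"
    using decayE[OF G rho(2)] by blast
  obtain C2 d2 where C2: "0 \<le> C2" "0 < d2" "\<And>t x. 0 < t \<Longrightarrow> t < d2 \<Longrightarrow> norm x < \<rho> \<Longrightarrow> \<bar>av \<kappa> t f x\<bar> \<le> C2 * b2 t"
    using decayE[OF F rho(2)] by blast
  let ?d = "min (min d1 d2) (r - \<rho>)"
  have "\<bar>av (laplacian \<kappa>) t v x\<bar> \<le> (C1 + C2) * (t\<^sup>2 * (b1 t + b2 t))" if t: "0 < t" "t < ?d" and x: "norm x < \<rho>" for t x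
  proof -
    have sub: "cball x t \<subseteq> ball 0 r"
    proof
      fix y assume "y \<in> cball x t"
      then show "y \<in> ball 0 r" using t x norm_triangle_ineq[of x "y - x"] by (simp add: dist_norm norm_minus_commute)
    qed
    have "av (laplacian \<kappa>) t v x = t\<^sup>2 * av \<kappa> t (laplacian v) x"
      by (rule av_laplacian[OF k open_ball sub _ v_C2]) (use t in simp)
    also have "av \<kappa> t (laplacian v) x = av \<kappa> t (\<lambda>y. frac_laplacian s v y - f y) x"
      by (rule av_cong[OF k]) (use t sub equation in force)+
    also have "\<dots> = av \<kappa> t (frac_laplacian s v) x - av \<kappa> t f x"
      using t by (intro av_diff_right integrable_bump_mult[OF k] continuous_on_subset[OF frac_continuous sub] continuous_on_subset[OF f_cont sub]) auto
    finally have eq: "av (laplacian \<kappa>) t v x = t\<^sup>2 * (av \<kappa> t (frac_laplacian s v) x - av \<kappa> t f x)" .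
    have "\<bar>av \<kappa> t (frac_laplacian s v) x - av \<kappa> t f x\<bar> \<le> C1 * b1 t + C2 * b2 t"
      using C1(3)[of t x] C2(3)[of t x] t x by linarith
    also have "\<dots> \<le> (C1 + C2) * (b1 t + b2 t)"
      using C1(1) C2(1) nonneg[OF t(1)] by (simp add: distrib_left distrib_right)
    finally have "t\<^sup>2 * \<bar>av \<kappa> t (frac_laplacian s v) x - av \<kappa> t f x\<bar> \<le> t\<^sup>2 * ((C1 + C2) * (b1 t + b2 t))"
      by (rule mult_left_mono) simp
    then show ?thesis unfolding eq by (simp add: abs_mult mult_ac)
  qed
  then show "\<exists>C\<ge>0. \<exists>d>0. \<forall>t x. 0 < t \<longrightarrow> t < d \<longrightarrow> norm x < \<rho> \<longrightarrow> \<bar>av (laplacian \<kappa>) t v x\<bar> \<le> C * (t\<^sup>2 * (b1 t + b2 t))"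
    using C1(1,2) C2(1,2) rho by (intro exI[of _ "C1 + C2"] conjI exI[of _ ?d]) auto
qed

lemma bounded_decay: assumes k: "\<kappa> \<in> bump N" shows "decay r \<kappa> v (\<lambda>t. t powr 0)"
proof (rule decayI)
  fix \<rho> assume rho: "0 < \<rho>" "\<rho> < r"
  let ?R = "(\<rho> + r) / 2"
  have "cball 0 ?R \<subseteq> ball 0 r" using rho by auto
  then have "continuous_on (cball 0 ?R) v" using C_open_continuous[OF v_C2, of "[]"] by (auto intro: continuous_on_subset)
  then obtain B where B: "0 < B" "\<And>p. p \<in> cball 0 ?R \<Longrightarrow> \<bar>v p\<bar> \<le> B" using continuous_cball_bounded by blast
  have "\<bar>av \<kappa> t v x\<bar> \<le> (\<integral>z. \<bar>\<kappa> z\<bar> \<partial>lborel) * B" if t: "0 < t" "t < (r - \<rho>) / 2" and x: "norm x < \<rho>" for t x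
  proof (rule av_bound[OF k])
    fix y assume "y \<in> cball x t"
    then have "norm (y - x) \<le> t" by (simp add: dist_norm norm_minus_commute)
    moreover have "norm y \<le> norm x + norm (y - x)" using norm_triangle_ineq[of x "y - x"] by simp
    ultimately have "norm y \<le> \<rho> + (r - \<rho>) / 2" using t x by linarith
    then show "\<bar>v y\<bar> \<le> B" by (intro B(2)) (simp add: field_simps)
  qed (use t in simp)
  then show "\<exists>C\<ge>0. \<exists>d>0. \<forall>t x. 0 < t \<longrightarrow> t < d \<longrightarrow> norm x < \<rho> \<longrightarrow> \<bar>av \<kappa> t v x\<bar> \<le> C * t powr 0"
    using B(1) rho by (intro exI[of _ "(\<integral>z. \<bar>\<kappa> z\<bar> \<partial>lborel) * B"] conjI exI[of _ "(r - \<rho>) / 2"]) auto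
qed

text \<open>A round applies the previous rate both to \<kappa> and to its Laplacian, hence the
  quantification over all kernels in \<open>bump N\<close>, with \<open>N\<close> growing from round
  to round. Starting from m + 1 Laplacians leaves enough derivatives on the kernel to see the
  modulus of the m-th derivatives of \<open>f\<close>. One Laplacian is added per round while the
  exponent grows by less than 2, so the condition \<sigma> <= 2 M of \<open>frac_decay\<close>
  persists.\<close>

lemma bootstrap:
  assumes f: "f \<in> C_open m (ball 0 r)" and e: "0 \<le> e" and Cf: "0 \<le> Cf"
    and hold: "\<And>is p q t. length is = m \<Longrightarrow> p \<in> ball 0 r \<Longrightarrow> q \<in> ball 0 r \<Longrightarrow> 0 < t \<Longrightarrow> norm (p - q) \<le> t \<Longrightarrow>
      \<bar>D_multi is f p - D_multi is f q\<bar> \<le> Cf * t powr e"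
  shows "\<exists>N. \<forall>\<kappa>\<in>bump N. decay r ((laplacian ^^ (m + 1 + j)) \<kappa>) v (\<lambda>t. t powr (min (real j * (2 - 2 * s)) (real m + 2 + e)))"
proof (induction j)
  case 0
  have "decay r ((laplacian ^^ (m + 1)) \<kappa>) v (\<lambda>t. t powr 0)" if "\<kappa> \<in> bump (0 + 2 * (m + 1))" for \<kappa>
    by (rule bounded_decay[OF bump_laplacian_pow[OF that]])
  then show ?case using e by (intro exI[of _ "0 + 2 * (m + 1)"]) auto
next
  case (Suc j)
  let ?M = "m + 1 + j" and ?\<sigma> = "min (real j * (2 - 2 * s)) (real m + 2 + e)"
  let ?\<sigma>' = "min (real (Suc j) * (2 - 2 * s)) (real m + 2 + e)"
  from Suc.IH obtain N where N: "\<And>\<kappa>. \<kappa> \<in> bump N \<Longrightarrow> decay r ((laplacian ^^ ?M) \<kappa>) v (\<lambda>t. t powr ?\<sigma>)" by blast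
  have sig: "0 \<le> ?\<sigma>" "?\<sigma> \<le> 2 * real ?M"
  proof -
    show "0 \<le> ?\<sigma>" using s e by simp
    have "real j * (2 - 2 * s) \<le> real j * 2" using s by (intro mult_left_mono) auto
    then show "?\<sigma> \<le> 2 * real ?M" by simp
  qed
  show ?case
  proof (intro exI[of _ "N + 4 + 2 * ?M"] ballI)
    fix \<kappa> :: "real^'n \<Rightarrow> real" assume k: "\<kappa> \<in> bump (N + 4 + 2 * ?M)"
    have k1: "\<kappa> \<in> bump N" "laplacian \<kappa> \<in> bump N" "\<kappa> \<in> bump (4 + 2 * ?M)" "\<kappa> \<in> bump (0 + 2 * ?M)" "\<kappa> \<in> bump (Suc (Suc 0) + 2 * ?M)"
      by (auto intro!: bump_laplacian intro: bump_antimono[OF _ k])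
    have swap: "laplacian ((laplacian ^^ ?M) \<kappa>) = (laplacian ^^ ?M) (laplacian \<kappa>)" by (rule funpow_swap1)
    have G: "decay r ((laplacian ^^ ?M) \<kappa>) (frac_laplacian s v) (\<lambda>t. t powr (?\<sigma> - 2 * s))"
      by (rule frac_decay[OF k1(3) sig N[OF k1(1)]]) (simp only: swap N[OF k1(2)])
    have "decay r ((laplacian ^^ ?M) \<kappa>) f (\<lambda>t. t ^ m * (Cf * t powr e))"
      by (rule decay_of_C_open[OF f _ k1(4) hold]) auto
    then have F: "decay r ((laplacian ^^ ?M) \<kappa>) f (\<lambda>t. t ^ m * t powr e)"
      using Cf by (intro decay_scale[where c=Cf and b="\<lambda>t. t ^ m * t powr e"]) (simp add: mult.left_commute)
    have "decay r (laplacian ((laplacian ^^ ?M) \<kappa>)) v (\<lambda>t. t\<^sup>2 * (t powr (?\<sigma> - 2 * s) + t ^ m * t powr e))"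
      by (rule laplacian_decay[OF bump_laplacian_pow[OF k1(5)] G F]) auto
    then have "decay r (laplacian ((laplacian ^^ ?M) \<kappa>)) v (\<lambda>t. 2 * t powr ?\<sigma>')"
    proof (rule decay_mono)
      fix t :: real assume t: "0 < t" "t < 1"
      have p2: "t\<^sup>2 = t powr 2" "t ^ m = t powr (real m)" using t by (simp_all add: powr_realpow)
      have "t\<^sup>2 * t powr (?\<sigma> - 2 * s) = t powr (2 + (?\<sigma> - 2 * s))" by (simp only: p2 powr_add)
      also have "\<dots> \<le> t powr ?\<sigma>'" using t s by (intro powr_mono') (auto simp: algebra_simps min_def)
      finally have 1: "t\<^sup>2 * t powr (?\<sigma> - 2 * s) \<le> t powr ?\<sigma>'" .
      have "t\<^sup>2 * (t ^ m * t powr e) = t powr (2 + (real m + e))" by (simp only: p2 powr_add)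
      also have "\<dots> \<le> t powr ?\<sigma>'" using t by (intro powr_mono') auto
      finally show "t\<^sup>2 * (t powr (?\<sigma> - 2 * s) + t ^ m * t powr e) \<le> 2 * t powr ?\<sigma>'"
        using 1 by (simp add: distrib_left)
    qed
    then have "decay r (laplacian ((laplacian ^^ ?M) \<kappa>)) v (\<lambda>t. t powr ?\<sigma>')" by (rule decay_scale) simp
    then show "decay r ((laplacian ^^ (m + 1 + Suc j)) \<kappa>) v (\<lambda>t. t powr ?\<sigma>')" by simp
  qed
qed

text \<open>Since 2 - 2 s is positive, finitely many rounds reach the exponent set by
  \<open>f\<close>. The two inequalities for \<open>M\<close> are recorded because the Dini case
  performs one further round.\<close>

lemma full_decay:
  assumes f: "f \<in> C_open m (ball 0 r)" and e: "0 \<le> e" and Cf: "0 \<le> Cf"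
    and hold: "\<And>is p q t. length is = m \<Longrightarrow> p \<in> ball 0 r \<Longrightarrow> q \<in> ball 0 r \<Longrightarrow> 0 < t \<Longrightarrow> norm (p - q) \<le> t \<Longrightarrow>
      \<bar>D_multi is f p - D_multi is f q\<bar> \<le> Cf * t powr e"
  obtains M N where "m \<le> M" "real m + 2 + e \<le> 2 * real (Suc M)"
    "\<And>\<kappa>. \<kappa> \<in> bump N \<Longrightarrow> decay r ((laplacian ^^ Suc M) \<kappa>) v (\<lambda>t. t powr (real m + 2 + e))"
proof -
  obtain j :: nat where j: "real m + 2 + e \<le> real j * (2 - 2 * s)"
    using reals_Archimedean3[of "2 - 2 * s"] s by (metis diff_gt_0_iff_gt less_eq_real_def mult.right_neutral mult_less_cancel_left_pos zero_less_numeral)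
  obtain N where N: "\<forall>\<kappa>\<in>bump N. decay r ((laplacian ^^ (m + 1 + j)) \<kappa>) v (\<lambda>t. t powr (min (real j * (2 - 2 * s)) (real m + 2 + e)))"
    using bootstrap[OF f e Cf hold] by blast
  have "real j * (2 - 2 * s) \<le> real j * 2" using s by (intro mult_left_mono) auto
  then have "real m + 2 + e \<le> 2 * real (Suc (m + j))" using j by simp
  moreover have "min (real j * (2 - 2 * s)) (real m + 2 + e) = real m + 2 + e" using j by simp
  ultimately show ?thesis using N by (intro that[of "m + j" N]) auto
qed

text \<open>A modulus \<omega> without a power rate cannot be fed into the iteration. Boundedness
  alone first gives the rate t^(m+2). One more round leaves the factor t^(2-2s), from the fractional
  Laplacian, plus \<omega>(t), from \<open>f\<close>. When \<omega> is Dini, so is this sum.\<close>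

lemma full_decay_Dini:
  assumes f: "f \<in> C_open m (ball 0 r)" and Cf: "0 \<le> Cf"
    and bnd: "\<And>is p q. length is = m \<Longrightarrow> p \<in> ball 0 r \<Longrightarrow> q \<in> ball 0 r \<Longrightarrow> \<bar>D_multi is f p - D_multi is f q\<bar> \<le> Cf"
    and w: "\<And>is p q t. length is = m \<Longrightarrow> p \<in> ball 0 r \<Longrightarrow> q \<in> ball 0 r \<Longrightarrow> 0 < t \<Longrightarrow> norm (p - q) \<le> t \<Longrightarrow>
      \<bar>D_multi is f p - D_multi is f q\<bar> \<le> \<omega> t" and w0: "\<And>t. 0 < t \<Longrightarrow> 0 \<le> \<omega> t"
  obtains M N where "\<And>\<kappa>. \<kappa> \<in> bump N \<Longrightarrow> decay r ((laplacian ^^ Suc M) \<kappa>) v (\<lambda>t. t ^ (m + 2) * (t powr (2 - 2 * s) + \<omega> t))"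
proof -
  have bnd': "\<bar>D_multi is f p - D_multi is f q\<bar> \<le> Cf * t powr 0" if "length is = m" "p \<in> ball 0 r" "q \<in> ball 0 r" "0 < t" "norm (p - q) \<le> t" for "is" p q t
    using bnd[OF that(1-3)] that by simp
  obtain M N where MN: "m \<le> M" "real m + 2 + 0 \<le> 2 * real (Suc M)"
    and dec: "\<And>\<kappa>. \<kappa> \<in> bump N \<Longrightarrow> decay r ((laplacian ^^ Suc M) \<kappa>) v (\<lambda>t. t powr (real m + 2 + 0))"
    using full_decay[OF f order_refl Cf bnd'] by blast
  show ?thesis
  proof (rule that[of "N + 4 + 2 * Suc M" "Suc M"])
    fix \<kappa> :: "real^'n \<Rightarrow> real" assume k: "\<kappa> \<in> bump (N + 4 + 2 * Suc M)"
    have k1: "\<kappa> \<in> bump N" "laplacian \<kappa> \<in> bump N" "\<kappa> \<in> bump (4 + 2 * Suc M)" "\<kappa> \<in> bump (0 + 2 * Suc M)" "\<kappa> \<in> bump (Suc (Suc 0) + 2 * Suc M)"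
      by (auto intro!: bump_laplacian intro: bump_antimono[OF _ k])
    have swap: "laplacian ((laplacian ^^ Suc M) \<kappa>) = (laplacian ^^ Suc M) (laplacian \<kappa>)" by (rule funpow_swap1)
    have G: "decay r ((laplacian ^^ Suc M) \<kappa>) (frac_laplacian s v) (\<lambda>t. t powr (real m + 2 + 0 - 2 * s))"
    proof (rule frac_decay[OF k1(3) _ MN(2) dec[OF k1(1)]])
      show "decay r (laplacian ((laplacian ^^ Suc M) \<kappa>)) v (\<lambda>t. t powr (real m + 2 + 0))"
        unfolding swap by (rule dec[OF k1(2)])
    qed simp
    have F: "decay r ((laplacian ^^ Suc M) \<kappa>) f (\<lambda>t. t ^ m * \<omega> t)"
      by (rule decay_of_C_open[OF f _ k1(4) w]) (use MN in auto)
    have "decay r (laplacian ((laplacian ^^ Suc M) \<kappa>)) v (\<lambda>t. t\<^sup>2 * (t powr (real m + 2 + 0 - 2 * s) + t ^ m * \<omega> t))"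
      by (rule laplacian_decay[OF bump_laplacian_pow[OF k1(5)] G F]) (use w0 in auto)
    then have "decay r (laplacian ((laplacian ^^ Suc M) \<kappa>)) v (\<lambda>t. t ^ (m + 2) * (t powr (2 - 2 * s) + \<omega> t))"
    proof (rule decay_mono)
      fix t :: real assume t: "0 < t"
      have "t powr (real m + 2 + 0 - 2 * s) = t powr (real m + (2 - 2 * s))" by (simp add: algebra_simps)
      also have "\<dots> = t ^ m * t powr (2 - 2 * s)" using t by (simp only: powr_add powr_realpow)
      finally show "t\<^sup>2 * (t powr (real m + 2 + 0 - 2 * s) + t ^ m * \<omega> t) \<le> t ^ (m + 2) * (t powr (2 - 2 * s) + \<omega> t)"
        by (simp add: power_add algebra_simps power2_eq_square)
    qed
    then show "decay r ((laplacian ^^ Suc (Suc M)) \<kappa>) v (\<lambda>t. t ^ (m + 2) * (t powr (2 - 2 * s) + \<omega> t))" by simp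
  qed
qed

end

section \<open>Reconstruction from averages\<close>

lemma decay_uniform:
  assumes fin: "finite L" and dec: "\<And>l. l \<in> L \<Longrightarrow> decay r (\<kappa> l) g b" and rho: "\<rho> < r" and b: "\<And>t. 0 < t \<Longrightarrow> 0 \<le> b t"
  obtains C d where "0 \<le> C" "0 < d" "\<And>l t x. l \<in> L \<Longrightarrow> 0 < t \<Longrightarrow> t < d \<Longrightarrow> norm x < \<rho> \<Longrightarrow> \<bar>av (\<kappa> l) t g x\<bar> \<le> C * b t"
proof -
  have "\<exists>C d. 0 \<le> C \<and> 0 < d \<and> (\<forall>l\<in>L. \<forall>t x. 0 < t \<longrightarrow> t < d \<longrightarrow> norm x < \<rho> \<longrightarrow> \<bar>av (\<kappa> l) t g x\<bar> \<le> C * b t)"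
    using fin dec
  proof (induction L rule: finite_induct)
    case empty
    then show ?case by (intro exI[of _ 1]) simp
  next
    case (insert l L)
    then obtain C d where C: "0 \<le> C" "0 < d" "\<And>l t x. l \<in> L \<Longrightarrow> 0 < t \<Longrightarrow> t < d \<Longrightarrow> norm x < \<rho> \<Longrightarrow> \<bar>av (\<kappa> l) t g x\<bar> \<le> C * b t"
      by blast
    obtain C' d' where C': "0 \<le> C'" "0 < d'" "\<And>t x. 0 < t \<Longrightarrow> t < d' \<Longrightarrow> norm x < \<rho> \<Longrightarrow> \<bar>av (\<kappa> l) t g x\<bar> \<le> C' * b t"
      using decayE[OF insert.prems[of l] rho] by blast
    have "\<bar>av (\<kappa> l') t g x\<bar> \<le> max C C' * b t" if "l' \<in> insert l L" "0 < t" "t < min d d'" "norm x < \<rho>" for l' t x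
    proof -
      have "C * b t \<le> max C C' * b t" "C' * b t \<le> max C C' * b t" using b[OF that(2)] by (auto intro: mult_right_mono)
      then show ?thesis using that C(3)[of l' t x] C'(3)[of t x] by auto
    qed
    then show ?case using C C' by (intro exI[of _ "max C C'"] exI[of _ "min d d'"]) auto
  qed
  then show ?thesis using that by blast
qed

text \<open>With \<xi> = E \<phi>, integrating the derivative in the scale gives v = av \<phi>
  \<delta> v + the integral over 0 < t <= \<delta> of (1/t) av \<xi> t v. Each derivative in
  \<open>x\<close> costs a factor 1/t, so up to order \<open>k\<close> the integrand is bounded by a
  multiple of \<theta>(t)/t. One derivative beyond \<open>k\<close> is not integrated but serves as
  a Lipschitz bound at each fixed scale; combined with the trivial bound it gives the factor min(1,
  h/t). For this reason kernels differentiated up to \<open>Suc k\<close> times appear among the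
  assumptions.\<close>

lemma reconstruction:
  fixes v \<phi> :: "real^'n::finite \<Rightarrow> real"
  assumes li: "loc_int v" and cont: "continuous_on (ball 0 r) v"
    and phi: "\<phi> \<in> bump (Suc (Suc k))" and I1: "(\<integral>z. \<phi> z \<partial>lborel) = 1"
    and dec: "\<And>is. length is \<le> Suc k \<Longrightarrow> decay r (D_multi is (euler \<phi>)) v (\<lambda>t. t ^ k * \<theta> t)"
    and th0: "\<And>t. 0 < t \<Longrightarrow> 0 \<le> \<theta> t" and d0: "0 < \<delta>\<^sub>0"
    and int: "integrable lborel (\<lambda>t. indicator {0<..\<delta>\<^sub>0} t * (\<theta> t / t))"
    and rho: "0 < \<rho>" "\<rho> < r"
  shows "v \<in> C_open k (ball 0 \<rho>)"
    and "\<exists>C\<ge>0. \<exists>\<delta>>0. \<delta> \<le> 1/2 \<and> \<delta> \<le> \<delta>\<^sub>0 \<and> (\<forall>is x y. length is = k \<longrightarrow> x \<in> ball 0 \<rho> \<longrightarrow> y \<in> ball 0 \<rho> \<longrightarrow>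
      \<bar>D_multi is v x - D_multi is v y\<bar> \<le> C * (norm (x - y) + (\<integral>t. indicator {0<..\<delta>} t * (min 1 (norm (x - y) / t) * (\<theta> t / t)) \<partial>lborel)))"
proof -
  let ?\<xi> = "euler \<phi>"
  have xi: "?\<xi> \<in> bump (Suc k)" by (rule bump_euler[OF phi])
  have xib: "D_multi is ?\<xi> \<in> bump N" if "N + length is \<le> Suc k" for N "is"
    by (rule D_multi_bump[OF bump_antimono[OF that xi]])
  have phib: "D_multi is \<phi> \<in> bump N" if "N + length is \<le> Suc (Suc k)" for N "is"
    by (rule D_multi_bump[OF bump_antimono[OF that phi]])
  have fin: "finite {is :: 'n list. length is \<le> Suc k}" using finite_lists_length_le[of "UNIV :: 'n set" "Suc k"] by simp
  obtain C d where C: "0 \<le> C" "0 < d"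
    and Cb: "\<And>is t x. length is \<le> Suc k \<Longrightarrow> 0 < t \<Longrightarrow> t < d \<Longrightarrow> norm x < \<rho> \<Longrightarrow> \<bar>av (D_multi is ?\<xi>) t v x\<bar> \<le> C * (t ^ k * \<theta> t)"
    using decay_uniform[OF fin, of r "\<lambda>is. D_multi is ?\<xi>" v "\<lambda>t. t ^ k * \<theta> t" \<rho>] dec rho(2) th0
    by (metis (no_types, lifting) mem_Collect_eq mult_nonneg_nonneg zero_le_power less_imp_le)
  \<comment> \<open>Small enough for the decay estimates, for balls of radius \<delta> to stay
    inside \<open>ball 0 r\<close>, and for integrability up to \<open>\<delta>\<^sub>0\<close>. The
    bound 1/2 is for the logarithmic estimate that uses this result.\<close>
  define \<delta> where "\<delta> = min (min (d / 2) (1 / 2)) (min \<delta>\<^sub>0 ((r - \<rho>) / 2))"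
  have del: "0 < \<delta>" "\<delta> < d" "\<delta> \<le> 1 / 2" "\<delta> \<le> \<delta>\<^sub>0" "\<delta> < r - \<rho>"
    using C d0 rho by (auto simp: \<delta>_def min_def)
  define \<Theta> where "\<Theta> t = indicator {0<..\<delta>} t * (\<theta> t / t)" for t
  have Ti: "integrable lborel \<Theta>"
  proof -
    have "integrable lborel (\<lambda>t. indicator {0<..\<delta>} t *\<^sub>R (indicator {0<..\<delta>\<^sub>0} t * (\<theta> t / t)))"
      by (rule integrable_mult_indicator[OF _ int]) simp
    moreover have "(\<lambda>t. indicator {0<..\<delta>} t *\<^sub>R (indicator {0<..\<delta>\<^sub>0} t * (\<theta> t / t))) = \<Theta>"
      using del by (auto simp: \<Theta>_def indicator_def fun_eq_iff)
    ultimately show ?thesis by simp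
  qed
  have T0: "0 \<le> \<Theta> t" for t using th0[of t] by (auto simp: \<Theta>_def indicator_def)
  \<comment> \<open>The integrand after \<open>l\<close> derivatives, up to sign: \<open>l\<close>
    factors 1/t from differentiation and one from the measure dt/t.\<close>
  define P where "P l \<kappa> t x = indicator {0<..\<delta>} t * (inverse t ^ Suc l * av \<kappa> t v x)" for l \<kappa> and t :: real and x :: "real^'n"
  have v_meas[measurable]: "v \<in> borel_measurable borel" using li by auto
  have Pm: "(\<lambda>t. P l \<kappa> t x) \<in> borel_measurable lborel" if "\<kappa> \<in> bump N" for l \<kappa> x N
  proof -
    have [measurable]: "\<kappa> \<in> borel_measurable borel" using that by auto
    have "(\<lambda>t. \<integral>z. \<kappa> z * v (x + t *\<^sub>R z) \<partial>lborel) \<in> borel_measurable lborel"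
      by (intro lborel.borel_measurable_lebesgue_integral) measurable
    then show ?thesis unfolding P_def av_def by measurable
  qed
  have tpow: "inverse t ^ Suc l * (t ^ k * \<theta> t) \<le> \<theta> t / t" if "0 < t" "t \<le> 1" "l \<le> k" for l t
  proof -
    have "inverse t ^ Suc l * t ^ k = t ^ (k - l) * inverse t"
      using that by (simp add: power_inverse power_diff field_simps)
    also have "\<dots> \<le> 1 * inverse t" using that by (intro mult_right_mono power_le_one) auto
    finally have "inverse t ^ Suc l * t ^ k * \<theta> t \<le> inverse t * \<theta> t" using th0[OF that(1)] by (intro mult_right_mono) auto
    then show ?thesis by (simp add: divide_inverse mult_ac)
  qed
  have Pb: "\<bar>P l (D_multi is ?\<xi>) t x\<bar> \<le> C * \<Theta> t" if "l \<le> k" "length is \<le> Suc k" "norm x < \<rho>" for l "is" t x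
  proof (cases "t \<in> {0<..\<delta>}")
    case True
    then have t: "0 < t" "t < d" "t \<le> 1" using del by auto
    have "\<bar>P l (D_multi is ?\<xi>) t x\<bar> = inverse t ^ Suc l * \<bar>av (D_multi is ?\<xi>) t v x\<bar>"
      using True by (simp add: P_def abs_mult)
    also have "\<dots> \<le> inverse t ^ Suc l * (C * (t ^ k * \<theta> t))"
      using Cb[OF that(2) t(1,2) that(3)] t by (intro mult_left_mono) auto
    also have "\<dots> = C * (inverse t ^ Suc l * (t ^ k * \<theta> t))" by (simp only: mult.left_commute)
    also have "\<dots> \<le> C * (\<theta> t / t)" by (intro mult_left_mono tpow t C that)
    finally show ?thesis using True by (simp add: \<Theta>_def)
  qed (simp add: P_def \<Theta>_def)
  have CTi: "integrable lborel (\<lambda>t. C * \<Theta> t)" using Ti by simp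
  have Pi: "integrable lborel (\<lambda>t. P l (D_multi is ?\<xi>) t x)" if "l \<le> k" "length is \<le> Suc k" "norm x < \<rho>" for l "is" x
    by (rule Bochner_Integration.integrable_bound[OF CTi Pm[OF xib[where N=0]]])
       (use Pb[OF that] that in \<open>auto intro!: AE_I2 intro: order_trans[OF _ abs_ge_self]\<close>)
  \<comment> \<open>The representation formula differentiated formally along \<open>is\<close>. That
    it equals the iterated derivative of \<open>v\<close> is shown by induction: order zero is the
    fundamental theorem of calculus, and each further order is differentiation under the
    integral.\<close>
  define W where "W is x = (- (1 / \<delta>)) ^ length is * av (D_multi is \<phi>) \<delta> v x + (- 1) ^ length is * (\<integral>t. P (length is) (D_multi is ?\<xi>) t x \<partial>lborel)" for "is" x
  have W0: "v x = W [] x" if x: "norm x < \<rho>" for x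
  proof -
    have sub: "cball x \<delta> \<subseteq> ball 0 r"
    proof
      fix y assume "y \<in> cball x \<delta>"
      then show "y \<in> ball 0 r" using del x norm_triangle_ineq[of x "y - x"] by (simp add: dist_norm norm_minus_commute)
    qed
    have "((\<lambda>t. - (1 / t) * av ?\<xi> t v x) has_integral (av \<phi> \<delta> v x - av \<phi> 0 v x)) {0..\<delta>}"
    proof (rule fundamental_theorem_of_calculus_interior)
      show "continuous_on {0..\<delta>} (\<lambda>t. av \<phi> t v x)"
        by (rule av_continuous_scale[OF phi continuous_on_subset[OF cont sub]])
      show "((\<lambda>t. av \<phi> t v x) has_vector_derivative - (1 / t) * av ?\<xi> t v x) (at t)" if "t \<in> {0<..<\<delta>}" for t
        using av_scale_derivative[OF phi li, of t x] that by (simp add: has_real_derivative_iff_has_vector_derivative)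
    qed (use del in simp)
    then have h1: "((\<lambda>t. if t \<in> {0..\<delta>} then - (1 / t) * av ?\<xi> t v x else 0) has_integral (av \<phi> \<delta> v x - v x)) UNIV"
      using I1 by (simp only: has_integral_restrict_UNIV av_zero mult_1)
    have eq: "(\<lambda>t. if t \<in> {0..\<delta>} then - (1 / t) * av ?\<xi> t v x else 0) = (\<lambda>t. - P 0 ?\<xi> t x)"
      by (auto simp: P_def indicator_def fun_eq_iff inverse_eq_divide)
    have h2: "((\<lambda>t. - P 0 ?\<xi> t x) has_integral - (\<integral>t. P 0 ?\<xi> t x \<partial>lborel)) UNIV"
      using has_integral_integral_lborel[OF Pi[of 0 "[]" x]] x by (intro has_integral_neg) simp
    have "av \<phi> \<delta> v x - v x = - (\<integral>t. P 0 ?\<xi> t x \<partial>lborel)" by (rule has_integral_unique[OF h1[unfolded eq] h2])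
    then show ?thesis by (simp add: W_def)
  qed
  have Wpd: "has_pd i (W is) x (W (i # is) x)" if len: "length is < k" and x: "norm x < \<rho>" for i "is" x
  proof -
    let ?p = "\<lambda>h. x + h *\<^sub>R axis i (1::real)"
    have k1: "D_multi is \<phi> \<in> bump (Suc 0)" "D_multi is ?\<xi> \<in> bump (Suc 0)" using len by (auto intro: phib xib)
    have 1: "has_pd i (av (D_multi is \<phi>) \<delta> v) x (- (1 / \<delta>) * av (D_multi (i # is) \<phi>) \<delta> v x)"
      using av_has_pd[OF k1(1) li del(1)] by simp
    have near: "norm (?p h) < \<rho>" if "\<bar>h - 0\<bar> < \<rho> - norm x" for h
      using that norm_triangle_ineq[of x "h *\<^sub>R axis i 1"] by (simp add: norm_axis_1)
    have 2: "((\<lambda>h. \<integral>t. P (length is) (D_multi is ?\<xi>) t (?p h) \<partial>lborel) has_real_derivative (\<integral>t. - P (Suc (length is)) (D_multi (i # is) ?\<xi>) t (?p 0) \<partial>lborel)) (at 0)"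
    proof (rule DERIV_under_integral(1)[where d="\<rho> - norm x" and w="\<lambda>t. C * \<Theta> t" and F'="\<lambda>h t. - P (Suc (length is)) (D_multi (i # is) ?\<xi>) t (?p h)"])
      fix h :: real assume h: "\<bar>h - 0\<bar> < \<rho> - norm x"
      show "integrable lborel (\<lambda>t. P (length is) (D_multi is ?\<xi>) t (?p h))"
        using len near[OF h] by (intro Pi) auto
      fix t :: real
      show "\<bar>- P (Suc (length is)) (D_multi (i # is) ?\<xi>) t (?p h)\<bar> \<le> C * \<Theta> t"
        using Pb[of "Suc (length is)" "i # is" "?p h" t] len near[OF h] by (simp del: D_multi.simps)
      show "((\<lambda>h. P (length is) (D_multi is ?\<xi>) t (?p h)) has_real_derivative - P (Suc (length is)) (D_multi (i # is) ?\<xi>) t (?p h)) (at h)"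
      proof (cases "t \<in> {0<..\<delta>}")
        case True
        then have t: "0 < t" by simp
        have "((\<lambda>h. inverse t ^ Suc (length is) * av (D_multi is ?\<xi>) t v (?p h)) has_real_derivative inverse t ^ Suc (length is) * (- (1 / t) * av (partial_deriv i (D_multi is ?\<xi>)) t v (?p h))) (at h)"
          by (rule DERIV_cmult[OF has_pd_line[OF av_has_pd[OF k1(2) li t]]])
        then show ?thesis using True by (simp add: P_def inverse_eq_divide)
      qed (simp add: P_def)
    qed (use CTi x in auto)
    have "((\<lambda>h. W is (?p h)) has_real_derivative (- (1 / \<delta>)) ^ length is * (- (1 / \<delta>) * av (D_multi (i # is) \<phi>) \<delta> v x) +
       (- 1) ^ length is * (\<integral>t. - P (Suc (length is)) (D_multi (i # is) ?\<xi>) t (?p 0) \<partial>lborel)) (at 0)"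
      unfolding W_def by (intro DERIV_add DERIV_cmult 1 2)
    then show ?thesis unfolding W_def by simp
  qed
  have Wc: "continuous_on (ball 0 \<rho>) (W is)" if len: "length is \<le> k" for "is"
    unfolding W_def
  proof (intro continuous_on_add continuous_on_mult_left)
    show "continuous_on (ball 0 \<rho>) (av (D_multi is \<phi>) \<delta> v)"
      using av_continuous[OF phib[where N=0] li del(1)] len continuous_on_subset[OF _ subset_UNIV] by force
    show "continuous_on (ball 0 \<rho>) (\<lambda>x. \<integral>t. P (length is) (D_multi is ?\<xi>) t x \<partial>lborel)"
    proof (rule continuous_on_integral_dominated[where w="\<lambda>t. C * \<Theta> t"])
      show "(\<lambda>t. P (length is) (D_multi is ?\<xi>) t x) \<in> borel_measurable lborel" for x
        by (rule Pm[OF xib[where N=0]]) (use len in simp)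
      show "\<bar>P (length is) (D_multi is ?\<xi>) t x\<bar> \<le> C * \<Theta> t" if "x \<in> ball 0 \<rho>" for x t
        using that len by (intro Pb) auto
      show "continuous_on (ball 0 \<rho>) (\<lambda>x. P (length is) (D_multi is ?\<xi>) t x)" for t
      proof (cases "t \<in> {0<..\<delta>}")
        case True
        have "D_multi is ?\<xi> \<in> bump 0" by (rule xib) (use len in simp)
        from av_continuous[OF this li, of t] True
        have "continuous_on (ball 0 \<rho>) (av (D_multi is ?\<xi>) t v)" using continuous_on_subset by auto
        then show ?thesis unfolding P_def by (intro continuous_on_mult_left)
      qed (simp add: P_def)
    qed (rule CTi)
  qed
  have DW: "D_multi is v x = W is x" if "length is \<le> k" "norm x < \<rho>" for "is" x
    using that
  proof (induction "is" arbitrary: x)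
    case Nil
    then show ?case using W0 by simp
  next
    case (Cons i js)
    have "has_pd i (W js) x (W (i # js) x)" using Cons.prems by (intro Wpd) auto
    then have "has_pd i (D_multi js v) x (W (i # js) x)"
      by (rule has_pd_cong_open[of _ _ _ _ "ball 0 \<rho>"]) (use Cons in auto)
    then show ?case using has_pd_imp_partial_deriv by simp
  qed
  show "v \<in> C_open k (ball 0 \<rho>)"
    unfolding C_open_def
  proof (intro CollectI conjI allI impI ballI)
    fix "is" :: "'n list" and i :: 'n and x :: "real^'n" assume len: "length is < k" and x: "x \<in> ball 0 \<rho>"
    have "has_pd i (D_multi is v) x (W (i # is) x)"
      by (rule has_pd_cong_open[where g="W is" and U="ball 0 \<rho>"]) (use len x DW[of "is"] Wpd[of "is" x i] in auto)
    then show "has_partial_at i (D_multi is v) x" by (rule has_pd_imp_has_partial_at)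
  next
    fix "is" :: "'n list" assume len: "length is \<le> k"
    show "continuous_on (ball 0 \<rho>) (D_multi is v)"
      using Wc[OF len] by (rule continuous_on_cong[THEN iffD1, OF refl, rotated]) (use DW len in auto)
  qed
  have "\<exists>B\<ge>0. \<forall>is i x. length is = k \<longrightarrow> x \<in> ball 0 \<rho> \<longrightarrow> \<bar>- (1 / \<delta>) * av (partial_deriv i (D_multi is \<phi>)) \<delta> v x\<bar> \<le> B"
  proof -
    let ?L = "{is :: 'n list. length is \<le> Suc k}"
    have "\<forall>is\<in>?L. \<exists>B. 0 \<le> B \<and> (\<forall>x\<in>ball 0 \<rho>. \<bar>av (D_multi is \<phi>) \<delta> v x\<bar> \<le> B)"
    proof
      fix "is" :: "'n list" assume "is \<in> ?L"
      then have b: "D_multi is \<phi> \<in> bump 0" by (intro phib) simp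
      obtain K where K: "K > 0" "\<And>z. \<bar>D_multi is \<phi> z\<bar> \<le> K * indicator (cball 0 1) z" using bump_bounded[OF b] by blast
      have "\<bar>av (D_multi is \<phi>) \<delta> v x\<bar> \<le> K * inverse \<delta> ^ CARD('n) * mass v (\<rho> + \<delta>)" if "x \<in> ball 0 \<rho>" for x
        by (rule av_mass_bound[OF b li del(1) K(2)]) (use that in simp)
      then show "\<exists>B. 0 \<le> B \<and> (\<forall>x\<in>ball 0 \<rho>. \<bar>av (D_multi is \<phi>) \<delta> v x\<bar> \<le> B)"
        using K(1) del(1) mass_nonneg[of v "\<rho> + \<delta>"] by (intro exI[of _ "K * inverse \<delta> ^ CARD('n) * mass v (\<rho> + \<delta>)"]) auto
    qed
    from bchoice[OF this] obtain B where B: "\<And>is. is \<in> ?L \<Longrightarrow> 0 \<le> B is" "\<And>is x. is \<in> ?L \<Longrightarrow> x \<in> ball 0 \<rho> \<Longrightarrow> \<bar>av (D_multi is \<phi>) \<delta> v x\<bar> \<le> B is"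
      by blast
    have "\<bar>- (1 / \<delta>) * av (partial_deriv i (D_multi is \<phi>)) \<delta> v x\<bar> \<le> (1 / \<delta>) * sum B ?L" if "length is = k" "x \<in> ball 0 \<rho>" for "is" i x
    proof -
      have "B (i # is) \<le> sum B ?L" using that B(1) fin by (intro member_le_sum) auto
      then have "\<bar>av (partial_deriv i (D_multi is \<phi>)) \<delta> v x\<bar> \<le> sum B ?L" using B(2)[of "i # is" x] that by simp
      then have "(1 / \<delta>) * \<bar>av (partial_deriv i (D_multi is \<phi>)) \<delta> v x\<bar> \<le> (1 / \<delta>) * sum B ?L" using del(1) by (intro mult_left_mono) auto
      then show ?thesis using del(1) by (simp add: abs_mult)
    qed
    then show ?thesis using B(1) del(1) by (intro exI[of _ "(1 / \<delta>) * sum B ?L"] conjI) (auto intro!: sum_nonneg divide_nonneg_pos)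
  qed
  then obtain B where B: "0 \<le> B" "\<And>is i x. length is = k \<Longrightarrow> x \<in> ball 0 \<rho> \<Longrightarrow> \<bar>- (1 / \<delta>) * av (partial_deriv i (D_multi is \<phi>)) \<delta> v x\<bar> \<le> B" by blast
  let ?n = "real CARD('n)"
  define K where "K = (1 / \<delta>) ^ k * (?n * B) + 2 * ?n * C"
  have n1: "1 \<le> ?n" by (simp add: Suc_leI)
  have diff: "\<bar>D_multi is v x - D_multi is v y\<bar> \<le> K * (norm (x - y) + (\<integral>t. indicator {0<..\<delta>} t * (min 1 (norm (x - y) / t) * (\<theta> t / t)) \<partial>lborel))"
    if len: "length is = k" and xy: "x \<in> ball 0 \<rho>" "y \<in> ball 0 \<rho>" for "is" x y
  proof -
    let ?h = "norm (x - y)"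
    have nxy: "norm x < \<rho>" "norm y < \<rho>" using xy by auto
    let ?M = "\<lambda>t. indicator {0<..\<delta>} t * (min 1 (?h / t) * (\<theta> t / t))"
    have Mi: "integrable lborel ?M"
    proof (rule Bochner_Integration.integrable_bound[OF Ti])
      have [measurable]: "\<Theta> \<in> borel_measurable borel" using Ti by auto
      have eq: "?M = (\<lambda>t. min 1 (?h / t) * \<Theta> t)" by (auto simp: \<Theta>_def fun_eq_iff)
      show "?M \<in> borel_measurable lborel" unfolding eq by measurable
      show "AE t in lborel. norm (?M t) \<le> norm (\<Theta> t)"
      proof (intro AE_I2)
        fix t :: real
        show "norm (?M t) \<le> norm (\<Theta> t)"
        proof (cases "t \<in> {0<..\<delta>}")
          case True
          then have "0 \<le> \<theta> t / t" using th0[of t] by simp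
          then have "min 1 (?h / t) * (\<theta> t / t) \<le> 1 * (\<theta> t / t)" by (intro mult_right_mono) auto
          moreover have "0 \<le> min 1 (?h / t) * (\<theta> t / t)" using True \<open>0 \<le> \<theta> t / t\<close> by (intro mult_nonneg_nonneg) auto
          moreover have "?M t = min 1 (?h / t) * (\<theta> t / t)" "\<Theta> t = \<theta> t / t" using True by (simp_all add: \<Theta>_def)
          ultimately show ?thesis unfolding real_norm_def by linarith
        qed (simp add: \<Theta>_def)
      qed
    qed
    have M0: "0 \<le> ?M t" for t using th0[of t] by (auto simp: indicator_def)
    have k1: "D_multi is \<phi> \<in> bump (Suc 0)" "D_multi is ?\<xi> \<in> bump (Suc 0)" using len by (auto intro: phib xib)
    have "\<bar>av (D_multi is \<phi>) \<delta> v x - av (D_multi is \<phi>) \<delta> v y\<bar> \<le> ?n * B * ?h"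
      by (rule Lipschitz_from_partials[OF open_UNIV convex_ball subset_UNIV av_has_pd[OF k1(1) li del(1)] _ B(2)[OF len] xy])
         (intro continuous_on_mult_left av_continuous[OF bump_pd[OF k1(1)] li del(1)])
    then have 1: "\<bar>(- (1 / \<delta>)) ^ k * (av (D_multi is \<phi>) \<delta> v x - av (D_multi is \<phi>) \<delta> v y)\<bar> \<le> (1 / \<delta>) ^ k * (?n * B * ?h)"
      using del(1) by (simp add: abs_mult power_abs mult_left_mono)
    \<comment> \<open>At a fixed scale the difference is bounded by the sum of the two values
      (\<open>a1\<close>) and by a Lipschitz estimate with constant of order 1/t
      (\<open>a2\<close>). A common constant 2 n is used so that the two combine into a
      minimum.\<close>
    have Pd: "\<bar>P k (D_multi is ?\<xi>) t x - P k (D_multi is ?\<xi>) t y\<bar> \<le> 2 * ?n * C * ?M t" for t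
    proof (cases "t \<in> {0<..\<delta>}")
      case True
      then have t: "0 < t" "t < d" "t \<le> 1" using del by auto
      let ?b = "C * (t ^ k * \<theta> t)"
      have b0: "0 \<le> ?b" using C(1) th0[OF t(1)] t by simp
      have a1: "\<bar>av (D_multi is ?\<xi>) t v x - av (D_multi is ?\<xi>) t v y\<bar> \<le> 2 * ?n * ?b * 1"
      proof -
        have "\<bar>av (D_multi is ?\<xi>) t v x\<bar> \<le> ?b" "\<bar>av (D_multi is ?\<xi>) t v y\<bar> \<le> ?b"
          using Cb[of "is" t] len t nxy by auto
        moreover have "?b \<le> ?n * ?b" using mult_right_mono[OF n1 b0] by simp
        ultimately show ?thesis by linarith
      qed
      have a2: "\<bar>av (D_multi is ?\<xi>) t v x - av (D_multi is ?\<xi>) t v y\<bar> \<le> 2 * ?n * ?b * (?h / t)"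
      proof -
        have "\<bar>av (D_multi is ?\<xi>) t v x - av (D_multi is ?\<xi>) t v y\<bar> \<le> ?n * ((1 / t) * ?b) * ?h"
        proof (rule Lipschitz_from_partials[OF open_UNIV convex_ball subset_UNIV av_has_pd[OF k1(2) li t(1)] _ _ xy])
          show "continuous_on UNIV (\<lambda>x. - (1 / t) * av (partial_deriv i (D_multi is ?\<xi>)) t v x)" for i
            by (intro continuous_on_mult_left av_continuous[OF bump_pd[OF k1(2)] li t(1)])
          show "\<bar>- (1 / t) * av (partial_deriv i (D_multi is ?\<xi>)) t v p\<bar> \<le> (1 / t) * ?b" if "p \<in> ball 0 \<rho>" for i p
          proof -
            have "\<bar>av (D_multi (i # is) ?\<xi>) t v p\<bar> \<le> ?b" by (rule Cb) (use len t that in auto)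
            then show ?thesis using t by (simp add: abs_mult divide_right_mono)
          qed
        qed
        also have "?n * ((1 / t) * ?b) * ?h \<le> 2 * ?n * ?b * (?h / t)"
        proof -
          have "0 \<le> ?n * ?b * (?h / t)" by (rule mult_nonneg_nonneg[OF mult_nonneg_nonneg[OF of_nat_0_le_iff b0]]) (use t in simp)
          moreover have "?n * ((1 / t) * ?b) * ?h = ?n * ?b * (?h / t)" by (simp add: mult_ac)
          moreover have "2 * ?n * ?b * (?h / t) = 2 * (?n * ?b * (?h / t))" by (simp only: mult.assoc)
          ultimately show ?thesis by linarith
        qed
        finally show ?thesis .
      qed
      have "\<bar>av (D_multi is ?\<xi>) t v x - av (D_multi is ?\<xi>) t v y\<bar> \<le> 2 * ?n * ?b * min 1 (?h / t)"
        using a1 a2 by (simp only: min_def split: if_split) simp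
      then have "inverse t ^ Suc k * \<bar>av (D_multi is ?\<xi>) t v x - av (D_multi is ?\<xi>) t v y\<bar> \<le> inverse t ^ Suc k * (2 * ?n * ?b * min 1 (?h / t))"
        using t by (intro mult_left_mono) auto
      also have "\<dots> = 2 * ?n * C * (min 1 (?h / t) * (inverse t ^ Suc k * (t ^ k * \<theta> t)))" by (simp only: mult_ac)
      also have "\<dots> \<le> 2 * ?n * C * (min 1 (?h / t) * (\<theta> t / t))"
        using C(1) t by (intro mult_left_mono tpow) auto
      finally show ?thesis using True t by (simp add: P_def abs_mult right_diff_distrib[symmetric])
    qed (simp add: P_def)
    have "\<bar>\<integral>t. P k (D_multi is ?\<xi>) t x - P k (D_multi is ?\<xi>) t y \<partial>lborel\<bar> \<le> (\<integral>t. 2 * ?n * C * ?M t \<partial>lborel)"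
      by (rule abs_integral_le[OF integrable_mult_right[OF Mi] Pd])
    then have 2: "\<bar>(\<integral>t. P k (D_multi is ?\<xi>) t x \<partial>lborel) - (\<integral>t. P k (D_multi is ?\<xi>) t y \<partial>lborel)\<bar> \<le> 2 * ?n * C * (\<integral>t. ?M t \<partial>lborel)"
      unfolding integral_mult_right_zero
      by (subst (asm) Bochner_Integration.integral_diff) (use Pi[of k "is"] len nxy in auto)
    define A1 where "A1 = (- (1 / \<delta>)) ^ k * (av (D_multi is \<phi>) \<delta> v x - av (D_multi is \<phi>) \<delta> v y)"
    define A2 where "A2 = (\<integral>t. P k (D_multi is ?\<xi>) t x \<partial>lborel) - (\<integral>t. P k (D_multi is ?\<xi>) t y \<partial>lborel)"
    define J where "J = (\<integral>t. ?M t \<partial>lborel)"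
    have J0: "0 \<le> J" unfolding J_def using M0 by (intro Bochner_Integration.integral_nonneg) auto
    have A1b: "\<bar>A1\<bar> \<le> ((1 / \<delta>) ^ k * (?n * B)) * ?h" using 1 unfolding A1_def by (simp only: mult.assoc)
    have A2b: "\<bar>A2\<bar> \<le> 2 * ?n * C * J" using 2 unfolding A2_def J_def .
    have "D_multi is v x - D_multi is v y = A1 + (- 1) ^ k * A2"
      using DW[of "is"] len nxy unfolding A1_def A2_def by (simp add: W_def right_diff_distrib)
    then have "\<bar>D_multi is v x - D_multi is v y\<bar> \<le> \<bar>A1\<bar> + \<bar>(- 1) ^ k * A2\<bar>" by (simp only: abs_triangle_ineq)
    moreover have "\<bar>(- 1) ^ k * A2\<bar> = \<bar>A2\<bar>" by (simp add: abs_mult power_abs)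
    moreover have "((1 / \<delta>) ^ k * (?n * B)) * ?h \<le> K * ?h"
      unfolding K_def using C(1) by (intro mult_right_mono) auto
    moreover have "2 * ?n * C * J \<le> K * J"
      unfolding K_def using B(1) del(1) J0 by (intro mult_right_mono) auto
    ultimately have "\<bar>D_multi is v x - D_multi is v y\<bar> \<le> K * ?h + K * J" using A1b A2b by linarith
    then show ?thesis unfolding J_def by (simp only: distrib_left)
  qed
  have "0 \<le> K" unfolding K_def using B(1) C(1) del(1) by simp
  then show "\<exists>C\<ge>0. \<exists>\<delta>>0. \<delta> \<le> 1/2 \<and> \<delta> \<le> \<delta>\<^sub>0 \<and> (\<forall>is x y. length is = k \<longrightarrow> x \<in> ball 0 \<rho> \<longrightarrow> y \<in> ball 0 \<rho> \<longrightarrow>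
      \<bar>D_multi is v x - D_multi is v y\<bar> \<le> C * (norm (x - y) + (\<integral>t. indicator {0<..\<delta>} t * (min 1 (norm (x - y) / t) * (\<theta> t / t)) \<partial>lborel)))"
    using diff del by blast
qed

section \<open>Moduli of continuity\<close>

text \<open>Split at t = h: below, the minimum is at most 1 and the integral of t^(\<alpha>-1) gives
  h^\<alpha> / \<alpha>; above, it is at most h/t and gives h^\<alpha> / (1 - \<alpha>), convergent
  at infinity because \<alpha> < 1.\<close>

lemma integral_min_powr:
  fixes \<alpha> h \<delta> :: real
  assumes a: "0 < \<alpha>" "\<alpha> < 1" and h: "0 < h"
  shows "(\<integral>t. indicator {0<..\<delta>} t * (min 1 (h / t) * (t powr \<alpha> / t)) \<partial>lborel) \<le> (1 / \<alpha> + 1 / (1 - \<alpha>)) * h powr \<alpha>"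
proof -
  let ?w = "\<lambda>t. indicator {0..h} t * t powr (\<alpha> - 1) + h * (indicator {h..} t * t powr (- 1 - (1 - \<alpha>)))"
  have w: "has_bochner_integral lborel ?w (h powr \<alpha> / \<alpha> + h * (h powr (- (1 - \<alpha>)) / (1 - \<alpha>)))"
    by (intro has_bochner_integral_add has_bochner_integral_mult_right has_bochner_integral_powr_from_0 has_bochner_integral_powr_to_inf) (use a h in auto)
  have le: "\<bar>indicator {0<..\<delta>} t * (min 1 (h / t) * (t powr \<alpha> / t))\<bar> \<le> ?w t" for t
  proof (cases "0 < t")
    case True
    have p: "t powr \<alpha> / t = t powr (\<alpha> - 1)" using True by (simp add: powr_diff)
    have nn: "0 \<le> min 1 (h / t) * (t powr \<alpha> / t)" using True h by (intro mult_nonneg_nonneg) auto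
    have ind: "\<bar>indicator {0<..\<delta>} t * X\<bar> \<le> X" if "0 \<le> X" for X :: real
      using that by (simp add: indicator_def)
    show ?thesis
    proof (cases "t \<le> h")
      case le: True
      have "min 1 (h / t) * (t powr \<alpha> / t) \<le> 1 * (t powr \<alpha> / t)" using True by (intro mult_right_mono) auto
      also have "\<dots> \<le> ?w t" using True le h by (simp add: p)
      finally show ?thesis using ind[OF nn] by (rule order_trans[rotated])
    next
      case False
      have "h / t * (t powr \<alpha> / t) = h * (t powr (\<alpha> - 1) / t)" by (simp add: p)
      also have "t powr (\<alpha> - 1) / t = t powr (- 1 - (1 - \<alpha>))" using powr_diff[of t "\<alpha> - 1" 1] True by simp
      finally have e: "h / t * (t powr \<alpha> / t) = h * t powr (- 1 - (1 - \<alpha>))" .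
      have "min 1 (h / t) * (t powr \<alpha> / t) \<le> h / t * (t powr \<alpha> / t)" using True by (intro mult_right_mono) auto
      also have "\<dots> \<le> ?w t" unfolding e using False True by simp
      finally show ?thesis using ind[OF nn] by (rule order_trans[rotated])
    qed
  next
    case False
    then show ?thesis using h by simp
  qed
  have "\<bar>\<integral>t. indicator {0<..\<delta>} t * (min 1 (h / t) * (t powr \<alpha> / t)) \<partial>lborel\<bar> \<le> (\<integral>t. ?w t \<partial>lborel)"
    by (rule abs_integral_le[OF _ le]) (use w in \<open>simp add: has_bochner_integral_iff\<close>)
  also have "(\<integral>t. ?w t \<partial>lborel) = h powr \<alpha> / \<alpha> + h * (h powr (- (1 - \<alpha>)) / (1 - \<alpha>))"
    by (rule has_bochner_integral_integral_eq[OF w])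
  also have "h * (h powr (- (1 - \<alpha>)) / (1 - \<alpha>)) = h powr \<alpha> / (1 - \<alpha>)"
  proof -
    have "h * h powr (- (1 - \<alpha>)) = h powr 1 * h powr (- (1 - \<alpha>))" using h by simp
    also have "\<dots> = h powr \<alpha>" by (simp only: powr_add[symmetric]) simp
    finally show ?thesis by simp
  qed
  finally show ?thesis by (simp add: distrib_right abs_le_iff)
qed

text \<open>From ln y <= y - 1 at y <= 1/2. It allows the Lipschitz term h to be absorbed into h |ln
  h|.\<close>

lemma half_le_abs_ln:
  fixes h :: real assumes "0 < h"
  shows "1 / 2 \<le> \<bar>ln (min h (1 / 2))\<bar>"
proof -
  have "ln (min h (1 / 2)) \<le> min h (1 / 2) - 1" by (rule ln_le_minus_one) (use assms in simp)
  then show ?thesis by linarith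
qed

text \<open>The borderline exponent 1 of the same splitting: the part above h is h times the
  integral of 1/t, truncated at 1, and produces the logarithm. The quotient t / t is the instance
  \<theta>(t) = t of \<theta>(t) / t. For h >= 1/2 the whole integral is at most \<delta> <= 1/2 <=
  h.\<close>

lemma integral_min_ln:
  fixes h \<delta> :: real
  assumes h: "0 < h" and d: "0 < \<delta>" "\<delta> \<le> 1 / 2"
  shows "(\<integral>t. indicator {0<..\<delta>} t * (min 1 (h / t) * (t / t)) \<partial>lborel) \<le> 3 * h * \<bar>ln (min h (1 / 2))\<bar>"
proof -
  let ?f = "\<lambda>t. indicator {0<..\<delta>} t * (min 1 (h / t) * (t / t)) :: real"
  have lnb: "h \<le> 2 * (h * \<bar>ln (min h (1 / 2))\<bar>)"
  proof -
    have "h * (1 / 2) \<le> h * \<bar>ln (min h (1 / 2))\<bar>" by (rule mult_left_mono[OF half_le_abs_ln[OF h]]) (use h in simp)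
    then show ?thesis by linarith
  qed
  have unit: "has_bochner_integral lborel (\<lambda>t::real. indicator {0..a} t * 1) a" if "0 \<le> a" for a
    using has_bochner_integral_powr_from_0[OF that, of 1] that
    by (simp add: has_bochner_integral_iff)
  show ?thesis
  proof (cases "h < 1 / 2")
    case False
    have "\<bar>\<integral>t. ?f t \<partial>lborel\<bar> \<le> (\<integral>t. indicator {0..\<delta>} t * 1 \<partial>lborel)"
    proof (rule abs_integral_le)
      show "integrable lborel (\<lambda>t::real. indicator {0..\<delta>} t * 1 :: real)" using unit[of \<delta>] d by (simp add: has_bochner_integral_iff)
      show "\<bar>?f t\<bar> \<le> indicator {0..\<delta>} t * 1" for t using h by (auto simp: indicator_def)
    qed
    also have "\<dots> = \<delta>" using has_bochner_integral_integral_eq[OF unit[of \<delta>]] d by simp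
    finally have "(\<integral>t. ?f t \<partial>lborel) \<le> h" using d False by linarith
    then show ?thesis using lnb h by linarith
  next
    case True
    let ?w = "\<lambda>t. indicator {0..h} t * 1 + h * (1 / t * indicator {h..1} t) :: real"
    have w: "has_bochner_integral lborel ?w (h + h * (ln 1 - ln h))"
      by (intro has_bochner_integral_add has_bochner_integral_mult_right unit has_bochner_integral_FTC_Icc_nonneg)
         (use h True in \<open>auto intro!: derivative_eq_intros\<close>)
    have "\<bar>\<integral>t. ?f t \<partial>lborel\<bar> \<le> (\<integral>t. ?w t \<partial>lborel)"
    proof (rule abs_integral_le)
      show "integrable lborel ?w" using w by (simp add: has_bochner_integral_iff)
      show "\<bar>?f t\<bar> \<le> ?w t" for t using h d by (auto simp: indicator_def min_def)
    qed
    also have "\<dots> = h + h * (ln 1 - ln h)" by (rule has_bochner_integral_integral_eq[OF w])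
    also have "\<dots> = h + h * \<bar>ln (min h (1 / 2))\<bar>" using h True by (simp add: abs_if)
    finally show ?thesis using lnb by linarith
  qed
qed

section \<open>Function classes on open and closed balls\<close>

lemma C_closed_imp_C_open: "g \<in> C_closed k \<rho> \<Longrightarrow> g \<in> C_open k (ball 0 \<rho>)"
  by (simp add: C_closed_def)

lemma C_open_imp_C_closed:
  assumes g: "g \<in> C_open k (ball 0 \<rho>)" and rho: "\<rho>' < \<rho>"
  shows "g \<in> C_closed k \<rho>'"
proof -
  have sub: "cball 0 \<rho>' \<subseteq> (ball 0 \<rho> :: (real^'a) set)" "ball 0 \<rho>' \<subseteq> (ball 0 \<rho> :: (real^'a) set)" using rho by auto
  have c: "continuous_on (cball 0 \<rho>') (D_multi is g)" if "length is \<le> k" for "is"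
    using C_open_continuous[OF g that] sub(1) by (rule continuous_on_subset)
  have o: "g \<in> C_open k (ball 0 \<rho>')"
    using g sub(2) unfolding C_open_def by (auto intro: continuous_on_subset)
  show ?thesis unfolding C_closed_def using c[of "[]"] c o by auto
qed

lemma C_open_cong:
  assumes g: "g \<in> C_open k U" and U: "open U" and eq: "\<And>x. x \<in> U \<Longrightarrow> g x = h x"
  shows "h \<in> C_open k U"
proof -
  have D: "D_multi is g x = D_multi is h x" if "x \<in> U" for "is" x
    by (rule D_multi_cong_open[OF U eq that])
  have "has_partial_at i (D_multi is h) x" if "length is < k" "x \<in> U" for i "is" x
    using has_pd_cong_open[OF C_open_has_pd[OF g that] U that(2), of "D_multi is h"] D has_pd_imp_has_partial_at by blast
  moreover have "continuous_on U (D_multi is h)" if "length is \<le> k" for "is"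
    using C_open_continuous[OF g that] by (rule continuous_on_cong[THEN iffD1, OF refl, rotated]) (simp add: D)
  ultimately show ?thesis by (simp add: C_open_def)
qed

lemma C_closed_D_multi_bounded:
  fixes f :: "real^'n::finite \<Rightarrow> real"
  assumes f: "f \<in> C_closed m r"
  obtains B where "0 < B" "\<And>is p. length is \<le> m \<Longrightarrow> p \<in> ball 0 r \<Longrightarrow> \<bar>D_multi is f p\<bar> \<le> B"
proof -
  let ?L = "{is :: 'n list. length is \<le> m}"
  have fin: "finite ?L" using finite_lists_length_le[of "UNIV :: 'n set" m] by simp
  have ex: "\<forall>is\<in>?L. \<exists>B. 0 < B \<and> (\<forall>p\<in>ball 0 r. \<bar>D_multi is f p\<bar> \<le> B)"
  proof
    fix "is" :: "'n list" assume "is \<in> ?L"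
    then obtain h where h: "continuous_on (cball 0 r) h" "\<forall>x\<in>ball 0 r. h x = D_multi is f x"
      using f unfolding C_closed_def by auto
    obtain B where "0 < B" "\<And>z. z \<in> cball 0 r \<Longrightarrow> \<bar>h z\<bar> \<le> B" using continuous_cball_bounded[OF h(1)] by blast
    then show "\<exists>B. 0 < B \<and> (\<forall>p\<in>ball 0 r. \<bar>D_multi is f p\<bar> \<le> B)"
      using h(2) by (intro exI[of _ B]) (auto simp flip: h(2))
  qed
  obtain B where "\<forall>is\<in>?L. 0 < B is \<and> (\<forall>p\<in>ball 0 r. \<bar>D_multi is f p\<bar> \<le> B is)"
    using bchoice[OF ex] by blast
  then have B: "\<And>is. is \<in> ?L \<Longrightarrow> 0 < B is" "\<And>is p. is \<in> ?L \<Longrightarrow> p \<in> ball 0 r \<Longrightarrow> \<bar>D_multi is f p\<bar> \<le> B is"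
    by blast+
  have "\<bar>D_multi is f p\<bar> \<le> sum B ?L + 1" if "length is \<le> m" "p \<in> ball 0 r" for "is" p
  proof -
    have "B is \<le> sum B ?L" using that B fin by (intro member_le_sum) (auto intro: less_imp_le)
    then show ?thesis using B(2)[of "is" p] that by simp
  qed
  moreover have "0 \<le> sum B ?L" using B(1) by (intro sum_nonneg) (auto intro: less_imp_le)
  ultimately show ?thesis by (intro that[of "sum B ?L + 1"]) auto
qed

section \<open>The three regularity statements for Borel solutions\<close>

context mixed_equation
begin

text \<open>Derivatives commute with powers of the Laplacian on kernels, so each derivative of
  \<open>euler \<phi>\<close> up to order k + 1 is again an (M + 1)-fold Laplacian of a kernel in
  \<open>bump N\<close>, where the rate is known. The k + 2 orders added to \<open>N\<close> in
  \<open>?K\<close> pay for these derivatives.\<close>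

lemma regularity:
  assumes dec: "\<And>\<kappa>. \<kappa> \<in> bump N \<Longrightarrow> decay r ((laplacian ^^ Suc M) \<kappa>) v (\<lambda>t. t ^ k * \<theta> t)"
    and th0: "\<And>t. 0 < t \<Longrightarrow> 0 \<le> \<theta> t" and d0: "0 < \<delta>\<^sub>0"
    and int: "integrable lborel (\<lambda>t. indicator {0<..\<delta>\<^sub>0} t * (\<theta> t / t))"
    and rho: "0 < \<rho>" "\<rho> < r"
  shows "v \<in> C_open k (ball 0 \<rho>)"
    and "\<exists>C\<ge>0. \<exists>\<delta>>0. \<delta> \<le> 1/2 \<and> \<delta> \<le> \<delta>\<^sub>0 \<and> (\<forall>is x y. length is = k \<longrightarrow> x \<in> ball 0 \<rho> \<longrightarrow> y \<in> ball 0 \<rho> \<longrightarrow>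
      \<bar>D_multi is v x - D_multi is v y\<bar> \<le> C * (norm (x - y) + (\<integral>t. indicator {0<..\<delta>} t * (min 1 (norm (x - y) / t) * (\<theta> t / t)) \<partial>lborel)))"
proof -
  let ?K = "N + Suc (Suc k)"
  obtain \<phi> \<kappa> :: "real^'n \<Rightarrow> real" where phi: "\<phi> \<in> bump ?K" and kap: "\<kappa> \<in> bump (?K + 2 * Suc M)"
    and I: "(\<integral>z. \<phi> z \<partial>lborel) = 1" and e: "euler \<phi> = (laplacian ^^ Suc M) \<kappa>"
    using mollifier_exists by blast
  have phi': "\<phi> \<in> bump (Suc (Suc k))" using bump_antimono[OF _ phi] by simp
  have d: "decay r (D_multi is (euler \<phi>)) v (\<lambda>t. t ^ k * \<theta> t)" if "length is \<le> Suc k" for "is"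
  proof -
    have "D_multi is (euler \<phi>) = (laplacian ^^ Suc M) (D_multi is \<kappa>)"
      unfolding e by (rule D_multi_laplacian_pow[where N=0]) (use that in \<open>intro bump_antimono[OF _ kap], simp\<close>)
    moreover have "D_multi is \<kappa> \<in> bump N"
      by (rule D_multi_bump) (use that in \<open>intro bump_antimono[OF _ kap], simp\<close>)
    ultimately show ?thesis using dec by simp
  qed
  have cont: "continuous_on (ball 0 r) v" using C_open_continuous[OF v_C2, of "[]"] by simp
  show "v \<in> C_open k (ball 0 \<rho>)"
    by (rule reconstruction(1)[OF v_loc_int cont phi' I d th0 d0 int rho])
  show "\<exists>C\<ge>0. \<exists>\<delta>>0. \<delta> \<le> 1/2 \<and> \<delta> \<le> \<delta>\<^sub>0 \<and> (\<forall>is x y. length is = k \<longrightarrow> x \<in> ball 0 \<rho> \<longrightarrow> y \<in> ball 0 \<rho> \<longrightarrow>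
      \<bar>D_multi is v x - D_multi is v y\<bar> \<le> C * (norm (x - y) + (\<integral>t. indicator {0<..\<delta>} t * (min 1 (norm (x - y) / t) * (\<theta> t / t)) \<partial>lborel)))"
    by (rule reconstruction(2)[OF v_loc_int cont phi' I d th0 d0 int rho])
qed

text \<open>Bounded m-th derivatives correspond to exponent e = 0 and rate t^(m+2). Taking k = m + 2
  would leave \<theta> = 1, for which \<theta>(t)/t is not integrable; therefore k = m + 1 and
  \<theta>(t) = t, and the modulus is logarithmic.\<close>

lemma lnL_regularity:
  assumes f: "f \<in> C_closed m r"
  shows "v \<in> C_lnL (m + 1) (r / 2)"
proof -
  obtain B where B: "0 < B" "\<And>is p. length is \<le> m \<Longrightarrow> p \<in> ball 0 r \<Longrightarrow> \<bar>D_multi is f p\<bar> \<le> B"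
    using C_closed_D_multi_bounded[OF f] by blast
  have hold: "\<bar>D_multi is f p - D_multi is f q\<bar> \<le> (2 * B) * t powr 0"
    if "length is = m" "p \<in> ball 0 r" "q \<in> ball 0 r" "0 < t" "norm (p - q) \<le> t" for "is" p q t
    using B(2)[of "is" p] B(2)[of "is" q] that by simp
  have B2: "0 \<le> 2 * B" using B(1) by simp
  obtain M N where dec0: "\<And>\<kappa>. \<kappa> \<in> bump N \<Longrightarrow> decay r ((laplacian ^^ Suc M) \<kappa>) v (\<lambda>t. t powr (real m + 2 + 0))"
    using full_decay[OF C_closed_imp_C_open[OF f] order_refl B2 hold] by blast
  have dec: "decay r ((laplacian ^^ Suc M) \<kappa>) v (\<lambda>t. t ^ (m + 1) * t)" if "\<kappa> \<in> bump N" for \<kappa>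
  proof (rule decay_mono[OF dec0[OF that]])
    fix t :: real assume "0 < t"
    then have "t powr (real m + 2 + 0) = t powr (real (m + 2))" by (simp add: add.commute)
    also have "\<dots> = t ^ (m + 2)" using \<open>0 < t\<close> by (rule powr_realpow)
    finally show "t powr (real m + 2 + 0) \<le> t ^ (m + 1) * t" by simp
  qed
  have int: "integrable lborel (\<lambda>t::real. indicator {0<..1} t * (t / t))"
  proof (rule Bochner_Integration.integrable_bound)
    show "integrable lborel (indicator {0<..1::real} :: real \<Rightarrow> real)" by (intro integrable_real_indicator) auto
    show "AE t in (lborel :: real measure). norm (indicator {0<..1} t * (t / t)) \<le> norm (indicator {0<..1} t :: real)"
      by (intro AE_I2) (auto simp: indicator_def)
  qed measurable
  \<comment> \<open>Any radius strictly between r/2 and r would do: continuity on the closed ball of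
    radius r/2 is deduced from an open ball containing it.\<close>
  have rho: "0 < 3 * r / 4" "3 * r / 4 < r" using r by auto
  note reg = regularity[OF dec less_imp_le zero_less_one int rho]
  from reg(2) obtain C \<delta> where C: "0 \<le> C" "0 < \<delta>" "\<delta> \<le> 1 / 2"
    and est: "\<And>is x y. length is = m + 1 \<Longrightarrow> x \<in> ball 0 (3 * r / 4) \<Longrightarrow> y \<in> ball 0 (3 * r / 4) \<Longrightarrow>
      \<bar>D_multi is v x - D_multi is v y\<bar> \<le> C * (norm (x - y) + (\<integral>t. indicator {0<..\<delta>} t * (min 1 (norm (x - y) / t) * (t / t)) \<partial>lborel))"
    by blast
  have "\<bar>D_multi is v x - D_multi is v y\<bar> \<le> (5 * C) * norm (x - y) * \<bar>ln (min (norm (x - y)) (1/2))\<bar>"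
    if "length is = m + 1" "x \<in> ball 0 (r / 2)" "y \<in> ball 0 (r / 2)" "x \<noteq> y" for "is" x y
  proof -
    let ?h = "norm (x - y)"
    have h: "0 < ?h" using that by simp
    have "\<bar>D_multi is v x - D_multi is v y\<bar> \<le> C * (?h + (\<integral>t. indicator {0<..\<delta>} t * (min 1 (?h / t) * (t / t)) \<partial>lborel))"
      using that r by (intro est) auto
    also have "\<dots> \<le> C * (2 * (?h * \<bar>ln (min ?h (1/2))\<bar>) + 3 * ?h * \<bar>ln (min ?h (1/2))\<bar>)"
      using integral_min_ln[OF h C(2,3)] mult_left_mono[OF half_le_abs_ln[OF h], of ?h] h C(1) by (intro mult_left_mono add_mono) auto
    finally show ?thesis by (simp add: algebra_simps)
  qed
  moreover have "v \<in> C_closed (m + 1) (r / 2)" by (rule C_open_imp_C_closed[OF reg(1)]) (use r in auto)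
  ultimately show ?thesis unfolding C_lnL_def by blast
qed

text \<open>Here k = m + 2 and \<theta>(t) = t^\<alpha>, and \<alpha> > 0 makes \<theta>(t)/t
  integrable at 0. The same exponent reappears in the modulus through
  \<open>integral_min_powr\<close>.\<close>

lemma Hoelder_regularity:
  assumes f: "f \<in> C_Hoelder m \<alpha> r" and a: "0 < \<alpha>" "\<alpha> < 1"
  shows "v \<in> C_Hoelder (m + 2) \<alpha> (r / 2)"
proof -
  have fc: "f \<in> C_closed m r" using f by (simp add: C_Hoelder_def)
  obtain C0 where C0: "\<And>is x y. length is = m \<Longrightarrow> x \<in> ball 0 r \<Longrightarrow> y \<in> ball 0 r \<Longrightarrow> x \<noteq> y \<Longrightarrow>
       \<bar>D_multi is f x - D_multi is f y\<bar> \<le> C0 * norm (x - y) powr \<alpha>"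
    using f unfolding C_Hoelder_def by blast
  have hold: "\<bar>D_multi is f p - D_multi is f q\<bar> \<le> \<bar>C0\<bar> * t powr \<alpha>"
    if "length is = m" "p \<in> ball 0 r" "q \<in> ball 0 r" "0 < t" "norm (p - q) \<le> t" for "is" p q t
  proof (cases "p = q")
    case False
    have "C0 * norm (p - q) powr \<alpha> \<le> \<bar>C0\<bar> * t powr \<alpha>"
      using that a by (intro mult_mono powr_mono2) auto
    then show ?thesis using C0[OF that(1-3) False] by linarith
  qed simp
  obtain M N where dec0: "\<And>\<kappa>. \<kappa> \<in> bump N \<Longrightarrow> decay r ((laplacian ^^ Suc M) \<kappa>) v (\<lambda>t. t powr (real m + 2 + \<alpha>))"
    using full_decay[OF C_closed_imp_C_open[OF fc] less_imp_le[OF a(1)] abs_ge_zero hold] by blast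
  have dec: "decay r ((laplacian ^^ Suc M) \<kappa>) v (\<lambda>t. t ^ (m + 2) * t powr \<alpha>)" if "\<kappa> \<in> bump N" for \<kappa>
  proof (rule decay_mono[OF dec0[OF that]])
    fix t :: real assume "0 < t"
    then have "t powr (real m + 2 + \<alpha>) = t powr (real (m + 2)) * t powr \<alpha>" by (simp add: powr_add)
    also have "t powr (real (m + 2)) = t ^ (m + 2)" using \<open>0 < t\<close> by (rule powr_realpow)
    finally show "t powr (real m + 2 + \<alpha>) \<le> t ^ (m + 2) * t powr \<alpha>" by simp
  qed
  have int: "integrable lborel (\<lambda>t::real. indicator {0<..1} t * (t powr \<alpha> / t))"
  proof -
    have "(\<lambda>t::real. indicator {0<..1} t * (t powr \<alpha> / t)) = (\<lambda>t. indicator {0..1} t * t powr (\<alpha> - 1))"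
      by (auto simp: fun_eq_iff indicator_def powr_diff)
    then show ?thesis using has_bochner_integral_powr_from_0[of 1 \<alpha>] a by (simp add: has_bochner_integral_iff)
  qed
  have rho: "0 < 3 * r / 4" "3 * r / 4 < r" using r by auto
  have nn: "0 \<le> t powr \<alpha>" for t :: real by simp
  note reg = regularity[OF dec nn zero_less_one int rho]
  from reg(2) obtain C \<delta> where C: "0 \<le> C" "0 < \<delta>"
    and est: "\<And>is x y. length is = m + 2 \<Longrightarrow> x \<in> ball 0 (3 * r / 4) \<Longrightarrow> y \<in> ball 0 (3 * r / 4) \<Longrightarrow>
      \<bar>D_multi is v x - D_multi is v y\<bar> \<le> C * (norm (x - y) + (\<integral>t. indicator {0<..\<delta>} t * (min 1 (norm (x - y) / t) * (t powr \<alpha> / t)) \<partial>lborel))"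
    by blast
  have "\<bar>D_multi is v x - D_multi is v y\<bar> \<le> (C * (1 + (1 / \<alpha> + 1 / (1 - \<alpha>)))) * norm (x - y) powr \<alpha>"
    if "length is = m + 2" "x \<in> ball 0 (r / 2)" "y \<in> ball 0 (r / 2)" "x \<noteq> y" for "is" x y
  proof -
    let ?h = "norm (x - y)"
    have h: "0 < ?h" using that by simp
    \<comment> \<open>Both points lie in the ball of radius r/2 with r <= 1, so h <= 1 and the
      Lipschitz term h is dominated by h^\<alpha>.\<close>
    have "?h \<le> norm x + norm y" by (rule norm_triangle_ineq4)
    then have "?h \<le> 1" using that r by simp
    then have "?h powr 1 \<le> ?h powr \<alpha>" using h a by (intro powr_mono') auto
    then have h1: "?h \<le> ?h powr \<alpha>" using h by simp
    have "\<bar>D_multi is v x - D_multi is v y\<bar> \<le> C * (?h + (\<integral>t. indicator {0<..\<delta>} t * (min 1 (?h / t) * (t powr \<alpha> / t)) \<partial>lborel))"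
      using that r by (intro est) auto
    also have "\<dots> \<le> C * (?h powr \<alpha> + (1 / \<alpha> + 1 / (1 - \<alpha>)) * ?h powr \<alpha>)"
      by (intro mult_left_mono add_mono h1 integral_min_powr a h C(1))
    finally show ?thesis by (simp only: mult.assoc distrib_right mult_1_left)
  qed
  moreover have "v \<in> C_closed (m + 2) (r / 2)" by (rule C_open_imp_C_closed[OF reg(1)]) (use r in auto)
  ultimately show ?thesis unfolding C_Hoelder_def by blast
qed

text \<open>Here k = m + 2 and \<theta>(t) = t^(2-2s) + \<omega>(t). Only membership in
  \<open>C_open\<close> is drawn from \<open>regularity\<close>, as no modulus is claimed for the
  derivatives of order m + 2.\<close>

lemma Dini_regularity:
  assumes f: "f \<in> C_Dini m r"
  shows "v \<in> C_closed (m + 2) (r / 2)"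
proof -
  have fc: "f \<in> C_closed m r" using f by (simp add: C_Dini_def)
  obtain B where B: "0 < B" "\<And>is p. length is \<le> m \<Longrightarrow> p \<in> ball 0 r \<Longrightarrow> \<bar>D_multi is f p\<bar> \<le> B"
    using C_closed_D_multi_bounded[OF fc] by blast
  let ?L = "{is :: 'n list. length is = m}"
  have fin: "finite ?L" using finite_lists_length_eq[of "UNIV :: 'n set" m] by simp
  have bnd: "\<bar>D_multi is f p - D_multi is f q\<bar> \<le> 2 * B" if "length is = m" "p \<in> ball 0 r" "q \<in> ball 0 r" for "is" p q
    using B(2)[of "is" p] B(2)[of "is" q] that by simp
  have bdd: "bdd_above {\<bar>D_multi is f x - D_multi is f y\<bar> | x y. x \<in> ball 0 r \<and> y \<in> ball 0 r \<and> norm (x - y) \<le> t}" if "length is = m" for "is" t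
    using bnd[OF that] by (intro bdd_aboveI[of _ "2 * B"]) blast
  have mod: "\<bar>D_multi is f p - D_multi is f q\<bar> \<le> modulus r (D_multi is f) t"
    if "length is = m" "p \<in> ball 0 r" "q \<in> ball 0 r" "norm (p - q) \<le> t" for "is" p q t
    unfolding modulus_def by (rule cSup_upper[OF _ bdd[OF that(1)]]) (use that in blast)
  have mod0: "0 \<le> modulus r (D_multi is f) t" if "length is = m" "0 < t" for "is" t
    using mod[OF that(1), of 0 0 t] that r by simp
  \<comment> \<open>One modulus for all derivatives of order m. A sum rather than a maximum, so that
    integrability of \<omega>(t)/t follows from that of the finitely many terms.\<close>
  define \<omega> where "\<omega> t = (\<Sum>is\<in>?L. modulus r (D_multi is f) t)" for t
  have w0: "0 \<le> \<omega> t" if "0 < t" for t unfolding \<omega>_def using mod0[OF _ that] by (intro sum_nonneg) auto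
  have w: "\<bar>D_multi is f p - D_multi is f q\<bar> \<le> \<omega> t"
    if "length is = m" "p \<in> ball 0 r" "q \<in> ball 0 r" "0 < t" "norm (p - q) \<le> t" for "is" p q t
  proof -
    have "modulus r (D_multi is f) t \<le> \<omega> t"
      unfolding \<omega>_def using that mod0[OF _ that(4)] fin by (intro member_le_sum) auto
    then show ?thesis using mod[OF that(1,2,3,5)] by linarith
  qed
  have B2: "0 \<le> 2 * B" using B(1) by simp
  obtain M N where dec: "\<And>\<kappa>. \<kappa> \<in> bump N \<Longrightarrow> decay r ((laplacian ^^ Suc M) \<kappa>) v (\<lambda>t. t ^ (m + 2) * (t powr (2 - 2 * s) + \<omega> t))"
    by (rule full_decay_Dini[where \<omega>=\<omega>, OF C_closed_imp_C_open[OF fc] B2]) ((rule bnd w w0; assumption) | blast)+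
  have int: "integrable lborel (\<lambda>t. indicator {0<..r} t * ((t powr (2 - 2 * s) + \<omega> t) / t))"
  proof -
    have 1: "integrable lborel (\<lambda>t::real. indicator {0..r} t * t powr ((2 - 2 * s) - 1))"
      using has_bochner_integral_powr_from_0[of r "2 - 2 * s"] s r by (simp add: has_bochner_integral_iff)
    have 2: "integrable lborel (\<lambda>t. indicator {0<..r} t * (modulus r (D_multi is f) t / t))" if "length is = m" for "is"
    proof -
      have "set_integrable lborel {0<..<diameter (ball (0::real^'n) r)} (\<lambda>t. modulus r (D_multi is f) t / t)"
        using f that unfolding C_Dini_def by blast
      then have "set_integrable lborel {0<..r} (\<lambda>t. modulus r (D_multi is f) t / t)"
        by (rule set_integrable_subset) (use r in \<open>auto simp: diameter_ball\<close>)
      then show ?thesis by (simp add: set_integrable_def)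
    qed
    have "(\<lambda>t. indicator {0<..r} t * ((t powr (2 - 2 * s) + \<omega> t) / t)) =
      (\<lambda>t. indicator {0..r} t * t powr ((2 - 2 * s) - 1) + (\<Sum>is\<in>?L. indicator {0<..r} t * (modulus r (D_multi is f) t / t)))"
    proof
      fix t :: real
      show "indicator {0<..r} t * ((t powr (2 - 2 * s) + \<omega> t) / t) =
        indicator {0..r} t * t powr ((2 - 2 * s) - 1) + (\<Sum>is\<in>?L. indicator {0<..r} t * (modulus r (D_multi is f) t / t))"
      proof (cases "t \<in> {0<..r}")
        case True
        then have "t powr ((2 - 2 * s) - 1) = t powr (2 - 2 * s) / t" by (subst powr_diff) simp
        then show ?thesis using True by (simp add: \<omega>_def add_divide_distrib sum_divide_distrib)
      qed (auto simp: indicator_def)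
    qed
    then show ?thesis using 1 2 by (simp only:) (intro Bochner_Integration.integrable_add Bochner_Integration.integrable_sum; simp)
  qed
  have nn: "0 \<le> t powr (2 - 2 * s) + \<omega> t" if "0 < t" for t using w0[OF that] by simp
  have rho: "0 < 3 * r / 4" "3 * r / 4 < r" using r by auto
  have "v \<in> C_open (m + 2) (ball 0 (3 * r / 4))"
    by (rule regularity(1)[OF dec nn r(1) int rho])
  then show ?thesis by (rule C_open_imp_C_closed) (use r in auto)
qed

end

section \<open>From a Lebesgue measurable solution to a Borel one\<close>

lemma C_closed_cong:
  assumes g: "g \<in> C_closed k \<rho>" and eq: "\<And>x. x \<in> cball 0 \<rho> \<Longrightarrow> g x = h x"
  shows "h \<in> C_closed k \<rho>"
proof -
  have D: "D_multi is g x = D_multi is h x" if "x \<in> ball 0 \<rho>" for "is" x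
    by (rule D_multi_cong_open[OF open_ball _ that]) (use eq in auto)
  have "continuous_on (cball 0 \<rho>) h"
  proof (rule continuous_on_cong[THEN iffD1, OF refl])
    show "continuous_on (cball 0 \<rho>) g" using g by (simp add: C_closed_def)
  qed (rule eq)
  moreover have "h \<in> C_open k (ball 0 \<rho>)"
    by (rule C_open_cong[OF C_closed_imp_C_open[OF g] open_ball]) (use eq in auto)
  ultimately show ?thesis using g D unfolding C_closed_def by fastforce
qed

text \<open>A member of \<open>L_2s\<close> is only Lebesgue measurable. On the ball, where
  pointwise derivatives matter, \<open>u\<close> is kept as it is, being continuous there; outside,
  it is replaced by a Borel function equal to it almost everywhere.\<close>

lemma borel_representative:
  fixes u :: "real^'n::finite \<Rightarrow> real"
  assumes u: "u \<in> L_2s s" and cont: "continuous_on (ball 0 r) u"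
  obtains v where "v \<in> borel_measurable borel" "\<And>x. x \<in> ball 0 r \<Longrightarrow> v x = u x" "AE x in lborel. v x = u x"
    "u \<in> borel_measurable lebesgue"
proof -
  have um: "u \<in> borel_measurable lebesgue"
  proof (rule borel_measurable_LIMSEQ_real)
    fix x :: "real^'n"
    obtain n0 :: nat where "norm x \<le> real n0" using real_arch_simple by blast
    then have "eventually (\<lambda>n. indicator (cball 0 (real n)) x *\<^sub>R u x = u x) sequentially"
      by (intro eventually_sequentiallyI[of n0]) (auto simp: indicator_def)
    then show "(\<lambda>n. indicator (cball 0 (real n)) x *\<^sub>R u x) \<longlonglongrightarrow> u x" by (rule tendsto_eventually)
  next
    show "(\<lambda>x. indicator (cball 0 (real n)) x *\<^sub>R u x) \<in> borel_measurable lebesgue" for n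
      using u compact_cball unfolding L_2s_def set_integrable_def by (blast intro: borel_measurable_integrable)
  qed
  then obtain w where w: "w \<in> borel_measurable lborel" "AE x in lborel. u x = w x"
    using completion_ex_borel_measurable_real by blast
  define v where "v x = indicator (ball 0 r) x *\<^sub>R u x + indicator (- ball 0 r) x *\<^sub>R w x" for x
  have "v \<in> borel_measurable borel"
    unfolding v_def using w(1)
    by (intro borel_measurable_add borel_measurable_continuous_on_indicator cont borel_measurable_scaleR borel_measurable_indicator) auto
  moreover have "AE x in lborel. v x = u x"
    using w(2) by eventually_elim (auto simp: v_def indicator_def)
  ultimately show ?thesis using um by (intro that[of v]) (auto simp: v_def)
qed

theorem corollary1p2:
  fixes u f :: "real^'n::finite \<Rightarrow> real" and s \<alpha> r :: real and m :: nat
  assumes "0 < s" "s < 1" and "0 < \<alpha>" "\<alpha> < 1" and "0 < r" "r \<le> 1"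
    and "u \<in> C_open 2 (ball 0 r) \<inter> C_closed 0 r \<inter> L_2s s"
    and "\<forall>x\<in>ball 0 r. frac_laplacian s u x - laplacian u x = f x"
  shows "(f \<in> C_closed m r \<longrightarrow> u \<in> C_lnL (m + 1) (r / 2)) \<and>
         (f \<in> C_Dini m r \<longrightarrow> u \<in> C_closed (m + 2) (r / 2)) \<and>
         (f \<in> C_Hoelder m \<alpha> r \<longrightarrow> u \<in> C_Hoelder (m + 2) \<alpha> (r / 2))"
proof -
  have uC2: "u \<in> C_open 2 (ball 0 r)" and uL: "u \<in> L_2s s" using assms(7) by auto
  have "continuous_on (ball 0 r) u" using C_open_continuous[OF uC2, of "[]"] by simp
  then obtain v where v: "v \<in> borel_measurable borel" and eq: "\<And>x. x \<in> ball 0 r \<Longrightarrow> v x = u x"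
    and ae: "AE x in lborel. v x = u x" and um: "u \<in> borel_measurable lebesgue"
    using borel_representative[OF uL] by blast
  let ?a = "real CARD('n) + 2 * s"
  have ael: "AE x in lebesgue. v x = u x" by (rule AE_completion[OF ae])
  have vl: "v \<in> borel_measurable lebesgue" using v by (simp add: measurable_completion)
  have wm: "(\<lambda>y. \<bar>v y\<bar> / (1 + norm y powr ?a)) \<in> borel_measurable lborel" using v by measurable
  have "integrable lebesgue (\<lambda>y. \<bar>u y\<bar> / (1 + norm y powr ?a))" using uL by (simp add: L_2s_def)
  moreover have "AE y in lebesgue. \<bar>u y\<bar> / (1 + norm y powr ?a) = \<bar>v y\<bar> / (1 + norm y powr ?a)"
    using ael by eventually_elim simp
  ultimately have "integrable lebesgue (\<lambda>y. \<bar>v y\<bar> / (1 + norm y powr ?a))"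
    using measurable_completion[OF wm] by (subst integrable_cong_AE[of _ _ "\<lambda>y. \<bar>u y\<bar> / (1 + norm y powr ?a)"]) (auto elim: eventually_mono)
  then have vw: "integrable lborel (\<lambda>y. \<bar>v y\<bar> / (1 + norm y powr ?a))"
    using integrable_completion[OF wm] by simp
  have vC2: "v \<in> C_open 2 (ball 0 r)" by (rule C_open_cong[OF uC2 open_ball]) (simp add: eq)
  \<comment> \<open>The truncated integrals ignore null sets, and at the centre \<open>x\<close> the
    two functions agree exactly, so the integrals coincide for every \<epsilon> and hence so do
    their limits.\<close>
  have fl: "frac_laplacian s v x = frac_laplacian s u x" if x: "x \<in> ball 0 r" for x
  proof -
    have "(LINT y:(- ball x \<epsilon>)|lebesgue. (v x - v y) / norm (x - y) powr ?a) = (LINT y:(- ball x \<epsilon>)|lebesgue. (u x - u y) / norm (x - y) powr ?a)" for \<epsilon>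
      unfolding set_lebesgue_integral_def
    proof (rule integral_cong_AE)
      have m: "(\<lambda>y. indicator (- ball x \<epsilon>) y *\<^sub>R ((c - g y) / norm (x - y) powr ?a)) \<in> borel_measurable lebesgue" if "g \<in> borel_measurable lebesgue" for g c
      proof -
        have "(\<lambda>y. norm (x - y) powr ?a) \<in> borel_measurable lborel" by measurable
        then have "(\<lambda>y. norm (x - y) powr ?a) \<in> borel_measurable lebesgue" by (rule measurable_completion)
        then show ?thesis using that
          by (intro borel_measurable_scaleR borel_measurable_indicator borel_measurable_divide borel_measurable_diff borel_measurable_const) auto
      qed
      show "(\<lambda>y. indicator (- ball x \<epsilon>) y *\<^sub>R ((v x - v y) / norm (x - y) powr ?a)) \<in> borel_measurable lebesgue" by (rule m[OF vl])
      show "(\<lambda>y. indicator (- ball x \<epsilon>) y *\<^sub>R ((u x - u y) / norm (x - y) powr ?a)) \<in> borel_measurable lebesgue" by (rule m[OF um])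
      show "AE y in lebesgue. indicator (- ball x \<epsilon>) y *\<^sub>R ((v x - v y) / norm (x - y) powr ?a) = indicator (- ball x \<epsilon>) y *\<^sub>R ((u x - u y) / norm (x - y) powr ?a)"
        using ael by eventually_elim (simp add: eq[OF x])
    qed
    then show ?thesis by (simp add: frac_laplacian_def)
  qed
  have lap: "laplacian v x = laplacian u x" if "x \<in> ball 0 r" for x
    unfolding laplacian_def by (intro sum.cong refl D_multi_cong_open[OF open_ball eq that])
  have loc: "mixed_equation v f s r" if "f \<in> C_closed m r"
  proof
    show "continuous_on (ball 0 r) f" using C_open_continuous[OF C_closed_imp_C_open[OF that], of "[]"] by simp
  qed (use assms v vw vC2 fl lap in auto)
  have eqc: "v x = u x" if "x \<in> cball 0 (r / 2)" for x using that assms(5) by (intro eq) auto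
  have D: "D_multi is v x = D_multi is u x" if "x \<in> ball 0 (r / 2)" for "is" x
    by (rule D_multi_cong_open[OF open_ball[of 0 r] eq]) (use that assms(5) in auto)
  have cc: "u \<in> C_closed k (r / 2)" if "v \<in> C_closed k (r / 2)" for k
    by (rule C_closed_cong[OF that eqc])
  show ?thesis
  proof (intro conjI impI)
    assume f: "f \<in> C_closed m r"
    have "v \<in> C_lnL (m + 1) (r / 2)" by (rule mixed_equation.lnL_regularity[OF loc[OF f] f])
    then show "u \<in> C_lnL (m + 1) (r / 2)"
      unfolding C_lnL_def using cc D by auto
  next
    assume f: "f \<in> C_Dini m r"
    then have "f \<in> C_closed m r" by (simp add: C_Dini_def)
    then have "v \<in> C_closed (m + 2) (r / 2)" by (rule mixed_equation.Dini_regularity[OF loc f])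
    then show "u \<in> C_closed (m + 2) (r / 2)" by (rule cc)
  next
    assume f: "f \<in> C_Hoelder m \<alpha> r"
    then have "f \<in> C_closed m r" by (simp add: C_Hoelder_def)
    then have "v \<in> C_Hoelder (m + 2) \<alpha> (r / 2)" by (rule mixed_equation.Hoelder_regularity[OF loc f assms(3,4)])
    then show "u \<in> C_Hoelder (m + 2) \<alpha> (r / 2)"
      unfolding C_Hoelder_def using cc D by auto
  qed
qed

end
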